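(* Let $M$ be a finite-dimensional analytic manifold over a complete ultrametric field. Let $p\in M$ be a fixed point of an analytic diffeomorphism $f\colon M\to M$, and $\alpha:=T_p(f)$. If $R(\alpha)\subseteq(0,1]$, then $W_a^{s}(f,p)$ is a submanifold of $M$, for each $a\in(0,1]$ such that $T_p(f)$ is $a$-hyperbolic.
   Context: A complete ultrametric field $(\mathbb{K},|\cdot|)$ is a field with an absolute value satisfying the ultrametric inequality whose metric is complete and defines a non-discrete topology. Analytic maps are the locally analytic ones (locally given by convergent power series); an analytic diffeomorphism has analytic inverse. A subset $N\subseteq M$ is a submanifold if there is a vector subspace $F$ of the modelling space of $M$ such that each point of $N$ lies in the domain $U$ of a chart $\phi\colon U\to V$ of $M$ with $\phi(N\cap U)=F\cap V$. $R(\alpha)$ is the set of all $|\lambda|$, where $\lambda$ runs through the eigenvalues of $\alpha\otimes_{\mathbb{K}}\mathrm{id}_{\overline{\mathbb{K}}}$ in an algebraic closure $\overline{\mathbb{K}}$ of $\mathbb{K}$, equipped with the unique absolute value extending $|\cdot|$. A continuous linear self-map $\alpha$ of an ultrametric Banach space $E$ is $a$-hyperbolic ($a\in(0,\infty)$) if there are $\alpha$-invariant subspaces with $E=E_{a,s}\oplus E_{a,u}$ and an ultrametric norm $\|\cdot\|$ on $E$ defining its topology such that $\|x+y\|=\max\{\|x\|,\|y\|\}$ for all $x\in E_{a,s}$, $y\in E_{a,u}$; $\alpha_2:=\alpha|_{E_{a,u}}\colon E_{a,u}\to E_{a,u}$ is invertible; and $\|\alpha|_{E_{a,s}}\|<a$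 and $\frac{1}{\|\alpha_2^{-1}\|}>a$ for the operator norms (with $\frac10:=\infty$). For $a\in(0,1]$, the $a$-stable set $W_a^{s}(f,p)$ is the set of all $x\in M$ such that $f^n(x)\to p$ as $n\to\infty$ and $a^{-n}\|\kappa(f^n(x))\|\to0$ as $n\to\infty$, for some (equivalently, every) chart $\kappa\colon U\to V\subseteq E$ of $M$ around $p$ with $\kappa(p)=0$ and some (equivalently, every) ultrametric norm $\|\cdot\|$ on the modelling space $E$ defining its topology. *)

theory Defs
  imports
    "HOL-Analysis.Analysis"
    "HOL-Algebra.Algebraic_Closure_Type"
begin

text \<open>The library constant \<open>norm\<close> is constrained to real normed vector spaces, so the classes
  below have a parameter of their own.\<close>

class ultrametric_group = ab_group_add + metric_space +
  fixes unorm :: "'a \<Rightarrow> real"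
  assumes dist_unorm: "dist x y = unorm (x - y)"
    and unorm_add_le_max: "unorm (x + y) \<le> max (unorm x) (unorm y)"

text \<open>Non-discreteness of the topology is the axiom of \<^class>\<open>perfect_space\<close>: no singleton is open
  (equivalently, by translation, \<open>{0}\<close> is not open).\<close>

class complete_ultrametric_field = field + ultrametric_group + complete_space + perfect_space +
  assumes unorm_mult: "unorm (x * y) = unorm x * unorm y"

text \<open>An absolute value on the algebraic closure extending the given one. As the field is
  complete, there is exactly one.\<close>

definition absolute_value_extension ::
    "('k::complete_ultrametric_field alg_closure \<Rightarrow> real) \<Rightarrow> bool" where
  "absolute_value_extension v \<longleftrightarrow>
     (\<forall>x. 0 \<le> v x) \<and> (\<forall>x. v x = 0 \<longleftrightarrow> x = 0) \<and>
     (\<forall>x y. v (x * y) = v x * v y) \<and>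
     (\<forall>x y. v (x + y) \<le> max (v x) (v y)) \<and>
     (\<forall>c. v (to_ac c) = unorm c)"

text \<open>The modelling space. The basis may be empty, so dimension 0 is included. The norm of the
  type only serves to fix the topology, which in finite dimension is the only Hausdorff vector
  space topology.\<close>

locale ultrametric_space = finite_dimensional_vector_space scale Basis
  for scale :: "'k::complete_ultrametric_field \<Rightarrow> 'e::ultrametric_group \<Rightarrow> 'e"
    and Basis :: "'e set" +
  assumes unorm_scale: "unorm (scale c x) = unorm c * unorm x"
begin

definition topology_norm :: "('e \<Rightarrow> real) \<Rightarrow> bool" where
  "topology_norm N \<longleftrightarrow>
     (\<forall>x. 0 \<le> N x) \<and> (\<forall>x. N x = 0 \<longleftrightarrow> x = 0) \<and>
     (\<forall>c x. N (scale c x) = unorm c * N x) \<and>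
     (\<forall>x y. N (x + y) \<le> max (N x) (N y)) \<and>
     (\<forall>U. open U \<longleftrightarrow> (\<forall>x\<in>U. \<exists>e>0. \<forall>y. N (y - x) < e \<longrightarrow> y \<in> U))"

text \<open>The term for \<open>x = 0\<close> is \<open>0 / 0 = 0\<close>, so the operator norm on the zero space is 0.\<close>

definition op_norm :: "('e \<Rightarrow> real) \<Rightarrow> 'e set \<Rightarrow> ('e \<Rightarrow> 'e) \<Rightarrow> real" where
  "op_norm N F g = (SUP x\<in>F. N (g x) / N x)"

definition hyperbolic :: "real \<Rightarrow> ('e \<Rightarrow> 'e) \<Rightarrow> bool" where
  "hyperbolic a \<alpha> \<longleftrightarrow>
     0 < a \<and> Vector_Spaces.linear scale scale \<alpha> \<and> continuous_on UNIV \<alpha> \<and>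
     (\<exists>Es Eu N.
        subspace Es \<and> subspace Eu \<and> \<alpha> ` Es \<subseteq> Es \<and> \<alpha> ` Eu \<subseteq> Eu \<and>
        Es \<inter> Eu = {0} \<and> {x + y | x y. x \<in> Es \<and> y \<in> Eu} = UNIV \<and>
        topology_norm N \<and>
        (\<forall>x\<in>Es. \<forall>y\<in>Eu. N (x + y) = max (N x) (N y)) \<and>
        bij_betw \<alpha> Eu Eu \<and>
        op_norm N Es \<alpha> < a \<and>
        (let c = op_norm N Eu (the_inv_into Eu \<alpha>) in c = 0 \<or> 1 / c > a))"

text \<open>Eigenvalues after extension of scalars: \<open>w\<close> is the coordinate vector, with respect to
  the basis \<open>b \<otimes> 1\<close>, of an eigenvector in \<open>E\<close> tensored with the algebraic closure.\<close>

definition eigenvalue_ac :: "('e \<Rightarrow> 'e) \<Rightarrow> 'k alg_closure \<Rightarrow> bool" where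
  "eigenvalue_ac \<alpha> \<mu> \<longleftrightarrow>
     (\<exists>w. (\<exists>b\<in>Basis. w b \<noteq> 0) \<and>
          (\<forall>b\<in>Basis. (\<Sum>c\<in>Basis. to_ac (representation Basis (\<alpha> c) b) * w c) = \<mu> * w b))"

definition eigenvalue_moduli ::
    "('k alg_closure \<Rightarrow> real) \<Rightarrow> ('e \<Rightarrow> 'e) \<Rightarrow> real set" where
  "eigenvalue_moduli v \<alpha> = {v \<mu> | \<mu>. eigenvalue_ac \<alpha> \<mu>}"

text \<open>Power series in the coordinates \<open>representation Basis h b\<close>, with multi-indices
  \<open>\<nu>\<close> and coefficients \<open>c \<nu>\<close> in \<open>E\<close>. Only the germ of \<open>f\<close> at \<open>x\<close> matters.\<close>

definition analytic_at :: "('e \<Rightarrow> 'e) \<Rightarrow> 'e \<Rightarrow> bool" where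
  "analytic_at f x \<longleftrightarrow>
     (\<exists>r>0. \<exists>c :: ('e \<Rightarrow> nat) \<Rightarrow> 'e. \<forall>h. unorm h < r \<longrightarrow>
        ((\<lambda>\<nu>. scale (\<Prod>b\<in>Basis. representation Basis h b ^ \<nu> b) (c \<nu>)) has_sum f (x + h))
          {\<nu>. \<forall>b. b \<notin> Basis \<longrightarrow> \<nu> b = 0})"

definition has_frechet_derivative :: "('e \<Rightarrow> 'e) \<Rightarrow> ('e \<Rightarrow> 'e) \<Rightarrow> 'e \<Rightarrow> bool" where
  "has_frechet_derivative f D x \<longleftrightarrow>
     Vector_Spaces.linear scale scale D \<and> continuous_on UNIV D \<and>
     ((\<lambda>h. unorm (f (x + h) - f x - D h) / unorm h) \<longlongrightarrow> 0) (at 0)"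

definition frechet_derivative_at :: "('e \<Rightarrow> 'e) \<Rightarrow> 'e \<Rightarrow> ('e \<Rightarrow> 'e)" where
  "frechet_derivative_at f x = (THE D. has_frechet_derivative f D x)"

text \<open>A chart \<open>(U, \<phi>)\<close> of a topological space; the values of \<open>\<phi>\<close> outside \<open>U\<close> are irrelevant.\<close>

definition topological_chart :: "'m::topological_space set \<times> ('m \<Rightarrow> 'e) \<Rightarrow> bool" where
  "topological_chart = (\<lambda>(U, \<phi>).
     open U \<and> open (\<phi> ` U) \<and> inj_on \<phi> U \<and>
     homeomorphism U (\<phi> ` U) \<phi> (the_inv_into U \<phi>))"

definition compatible ::
    "'m::topological_space set \<times> ('m \<Rightarrow> 'e) \<Rightarrow> 'm set \<times> ('m \<Rightarrow> 'e) \<Rightarrow> bool" where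
  "compatible = (\<lambda>(U, \<phi>) (V, \<psi>).
     (\<forall>x\<in>U \<inter> V. analytic_at (\<psi> \<circ> the_inv_into U \<phi>) (\<phi> x) \<and>
                 analytic_at (\<phi> \<circ> the_inv_into V \<psi>) (\<psi> x)))"

end

text \<open>The underlying set of the manifold is the whole type \<open>'m\<close>. No Hausdorff assumption is made.\<close>

locale analytic_manifold = ultrametric_space scale Basis
  for scale :: "'k::complete_ultrametric_field \<Rightarrow> 'e::ultrametric_group \<Rightarrow> 'e"
    and Basis :: "'e set" +
  fixes atlas :: "('m::topological_space set \<times> ('m \<Rightarrow> 'e)) set"
  assumes atlas_charts: "\<kappa> \<in> atlas \<Longrightarrow> topological_chart \<kappa>"
    and atlas_compatible: "\<lbrakk>\<kappa> \<in> atlas; \<kappa>' \<in> atlas\<rbrakk> \<Longrightarrow> compatible \<kappa> \<kappa>'"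
    and atlas_covers: "(\<Union>(U, \<phi>)\<in>atlas. U) = UNIV"
begin

text \<open>The maximal atlas.\<close>

definition charts :: "('m set \<times> ('m \<Rightarrow> 'e)) set" where
  "charts = {\<kappa>. topological_chart \<kappa> \<and> (\<forall>\<kappa>'\<in>atlas. compatible \<kappa> \<kappa>')}"

definition analytic_map :: "('m \<Rightarrow> 'm) \<Rightarrow> bool" where
  "analytic_map f \<longleftrightarrow> continuous_on UNIV f \<and>
     (\<forall>(U, \<phi>)\<in>charts. \<forall>(V, \<psi>)\<in>charts. \<forall>x\<in>U. f x \<in> V \<longrightarrow>
        analytic_at (\<psi> \<circ> f \<circ> the_inv_into U \<phi>) (\<phi> x))"

definition analytic_diffeomorphism :: "('m \<Rightarrow> 'm) \<Rightarrow> bool" where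
  "analytic_diffeomorphism f \<longleftrightarrow> bij f \<and> analytic_map f \<and> analytic_map (inv_into UNIV f)"

text \<open>The tangent map of \<open>f\<close> at a fixed point \<open>p\<close>, with the tangent space at \<open>p\<close> identified
  with the modelling space by means of a chart \<open>(U, \<phi>)\<close> around \<open>p\<close>.\<close>

definition tangent_map :: "'m set \<times> ('m \<Rightarrow> 'e) \<Rightarrow> ('m \<Rightarrow> 'm) \<Rightarrow> 'm \<Rightarrow> ('e \<Rightarrow> 'e)" where
  "tangent_map = (\<lambda>(U, \<phi>) f p. frechet_derivative_at (\<phi> \<circ> f \<circ> the_inv_into U \<phi>) (\<phi> p))"

definition submanifold :: "'m set \<Rightarrow> bool" where
  "submanifold S \<longleftrightarrow>
     (\<exists>F. subspace F \<and> (\<forall>x\<in>S. \<exists>(U, \<phi>)\<in>charts. x \<in> U \<and> \<phi> ` (S \<inter> U) = F \<inter> \<phi> ` U))"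

definition stable_set :: "real \<Rightarrow> ('m \<Rightarrow> 'm) \<Rightarrow> 'm \<Rightarrow> 'm set" where
  "stable_set a f p =
     {x. (\<lambda>n. (f ^^ n) x) \<longlonglongrightarrow> p \<and>
         (\<exists>(U, \<phi>)\<in>charts. p \<in> U \<and> \<phi> p = 0 \<and>
            (\<exists>N. topology_norm N \<and> (\<lambda>n. N (\<phi> ((f ^^ n) x)) / a ^ n) \<longlonglongrightarrow> 0))}"

end

end

theory Submission
  imports Defs
begin

text \<open>In a chart around \<open>p\<close>, write \<open>f = \<alpha> + R\<close>. A norm adapted to the hyperbolic splitting can be
  replaced by a weighted maximum norm in suitable coordinates, because a finite-dimensional
  ultrametric space has almost orthogonal bases. On a small polydisc \<open>R\<close> has a small Gauss norm, and the
  graph transform \<open>g \<mapsto> \<alpha>\<^sub>u\<^sup>-\<^sup>1 (g \<circ> f\<^sub>s(id, g) - R\<^sub>u(id, g))\<close> is a contraction for the Gauss norm of convergent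
  power series; its fixed point \<open>g\<close> is analytic and its graph is invariant. On the graph \<open>f\<close> contracts
  by a factor below \<open>a\<close>, while the distance from the graph grows by a factor above \<open>a\<close>. Hence a point
  whose orbit stays in the polydisc lies in the stable set if and only if it lies on the graph.

  The hypothesis on the eigenvalues enters only globally: it makes the powers of \<open>\<alpha>\<close> bounded, so
  there are arbitrarily small neighbourhoods \<open>\<Omega>\<close> of \<open>p\<close> with \<open>f(\<Omega>) \<subseteq> \<Omega>\<close>. Every orbit in the stable set
  eventually enters \<open>\<Omega>\<close>, and pulling the local picture back along an iterate of \<open>f\<close> shows that the stable
  set is a submanifold.\<close>

subsection \<open>Ultrametric groups and null families\<close>

text \<open>Exact orthogonal bases need not exist over an arbitrary complete ultrametric field, so
  coordinates reproduce the adapted norm only up to a factor t < 1. Hyperbolicity is strict, so t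
  can be taken close enough to 1 for rates \<theta> < a and \<beta> with \<beta> * a < 1 to survive.
  The expanding part may still contract in the ordinary sense: \<beta> can exceed 1 when a < 1. The
  graph transform contracts because \<beta> * \<theta> < 1, and the factor \<theta> comes from a
  Schwarz-type estimate: substituting a map that shrinks the polydisc by \<theta> into a series
  vanishing at 0 shrinks its Gauss bound by \<theta>. Hence all candidate graphs pass through the
  origin. The global difficulty is that a point near p could leave the chart and return later, which
  could add further sheets to the stable set. The invariant neighbourhood consists of the points
  whose whole orbit under the linear part stays in the polydisc; being an additive group, it absorbs
  a sufficiently small nonlinear remainder.\<close>

lemma unorm_eq_dist: "unorm x = dist x (0::'a::ultrametric_group)"
  by (simp add: dist_unorm)

lemma unorm_nonneg [simp]: "0 \<le> unorm (x::'a::ultrametric_group)"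
  by (simp add: unorm_eq_dist)

lemma unorm_eq_0_iff [simp]: "unorm (x::'a::ultrametric_group) = 0 \<longleftrightarrow> x = 0"
  by (simp add: unorm_eq_dist)

lemma unorm_zero [simp]: "unorm (0::'a::ultrametric_group) = 0"
  by simp

lemma unorm_pos_iff [simp]: "0 < unorm (x::'a::ultrametric_group) \<longleftrightarrow> x \<noteq> 0"
  using unorm_nonneg[of x] unorm_eq_0_iff[of x] by linarith

lemma unorm_minus [simp]: "unorm (- x) = unorm (x::'a::ultrametric_group)"
  using dist_unorm[of 0 x] by (simp add: unorm_eq_dist dist_commute)

lemma unorm_minus_commute: "unorm (x - y) = unorm (y - x :: 'a::ultrametric_group)"
  by (metis dist_commute dist_unorm)

lemma unorm_add_le:
  "unorm (x::'a::ultrametric_group) \<le> C \<Longrightarrow> unorm y \<le> C \<Longrightarrow> unorm (x + y) \<le> C"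
  using unorm_add_le_max[of x y] by linarith

lemma unorm_diff_le:
  "unorm (x::'a::ultrametric_group) \<le> C \<Longrightarrow> unorm y \<le> C \<Longrightarrow> unorm (x - y) \<le> C"
  using unorm_add_le[of x C "- y"] by simp

lemma unorm_diff_less:
  "unorm (x::'a::ultrametric_group) < C \<Longrightarrow> unorm y < C \<Longrightarrow> unorm (x - y) < C"
  using unorm_add_le_max[of x "- y"] by simp

lemma unorm_sum_le:
  fixes f :: "'b \<Rightarrow> 'a::ultrametric_group"
  assumes "\<And>i. i \<in> A \<Longrightarrow> unorm (f i) \<le> C" "0 \<le> C"
  shows "unorm (sum f A) \<le> C"
  using assms by (induction A rule: infinite_finite_induct) (auto intro: unorm_add_le)

lemma unorm_one [simp]: "unorm (1::'a::complete_ultrametric_field) = 1"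
  using unorm_mult[of "1::'a" 1] by simp

lemma unorm_power: "unorm (x ^ n) = unorm (x::'a::complete_ultrametric_field) ^ n"
  by (induction n) (auto simp: unorm_mult)

lemma unorm_prod: "unorm (prod f A) = (\<Prod>x\<in>A. unorm (f x :: 'a::complete_ultrametric_field))"
  by (induction A rule: infinite_finite_induct) (auto simp: unorm_mult)

instance ultrametric_group \<subseteq> topological_ab_group_add
proof
  fix a b :: 'a
  show "((\<lambda>x. fst x + snd x) \<longlongrightarrow> a + b) (nhds a \<times>\<^sub>F nhds b)"
  proof (rule tendstoI)
    fix e :: real assume "e > 0"
    have "eventually (\<lambda>x. dist x a < e) (nhds a)" "eventually (\<lambda>x. dist x b < e) (nhds b)"
      using \<open>e > 0\<close> by (auto simp: eventually_nhds_metric)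
    then have "eventually (\<lambda>x. dist (fst x) a < e \<and> dist (snd x) b < e) (nhds a \<times>\<^sub>F nhds b)"
      unfolding eventually_prod_filter by (metis fst_conv snd_conv)
    then show "eventually (\<lambda>x. dist (fst x + snd x) (a + b) < e) (nhds a \<times>\<^sub>F nhds b)"
    proof (rule eventually_mono)
      fix x :: "'a \<times> 'a" assume "dist (fst x) a < e \<and> dist (snd x) b < e"
      moreover have "fst x + snd x - (a + b) = (fst x - a) + (snd x - b)"
        by (simp add: algebra_simps)
      ultimately show "dist (fst x + snd x) (a + b) < e"
        using unorm_add_le_max[of "fst x - a" "snd x - b"] unfolding dist_unorm by (metis max_less_iff_conj order_le_less_trans)
    qed
  qed
  show "(uminus \<longlongrightarrow> - a) (nhds a)"
  proof (rule tendstoI)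
    fix e :: real assume "e > 0"
    then have "eventually (\<lambda>x. dist x a < e) (nhds a)"
      by (auto simp: eventually_nhds_metric)
    then show "eventually (\<lambda>x. dist (- x) (- a) < e) (nhds a)"
      by (rule eventually_mono) (simp add: dist_unorm unorm_minus_commute)
  qed
qed

instance complete_ultrametric_field \<subseteq> topological_semigroup_mult
proof
  fix a b :: 'a
  show "((\<lambda>x. fst x * snd x) \<longlongrightarrow> a * b) (nhds a \<times>\<^sub>F nhds b)"
  proof (rule tendstoI)
    fix e :: real assume "e > 0"
    \<comment> \<open>The bound \<open>d \<le> 1\<close> lets the quadratic term
      \<open>u * v\<close> be estimated like a linear one.\<close>
    define d where "d = min 1 (e / (1 + unorm a + unorm b))"
    have pos: "0 < 1 + unorm a + unorm b"
      by (simp add: add_pos_nonneg)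
    have "d > 0" "d \<le> 1"
      using \<open>e > 0\<close> pos by (auto simp: d_def)
    have "d * (1 + unorm a + unorm b) \<le> e / (1 + unorm a + unorm b) * (1 + unorm a + unorm b)"
      using pos by (intro mult_right_mono) (auto simp: d_def)
    then have d: "d * (1 + unorm a + unorm b) \<le> e"
      using pos by simp
    have "eventually (\<lambda>x. dist x a < d) (nhds a)" "eventually (\<lambda>x. dist x b < d) (nhds b)"
      using \<open>d > 0\<close> by (auto simp: eventually_nhds_metric)
    then have "eventually (\<lambda>x. dist (fst x) a < d \<and> dist (snd x) b < d) (nhds a \<times>\<^sub>F nhds b)"
      unfolding eventually_prod_filter by (metis fst_conv snd_conv)
    then show "eventually (\<lambda>x. dist (fst x * snd x) (a * b) < e) (nhds a \<times>\<^sub>F nhds b)"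
    proof (rule eventually_mono)
      fix x :: "'a \<times> 'a" assume *: "dist (fst x) a < d \<and> dist (snd x) b < d"
      define u v where "u = fst x - a" and "v = snd x - b"
      have u: "unorm u < d" and v: "unorm v < d"
        using * by (auto simp: dist_unorm u_def v_def)
      have eq: "fst x * snd x - a * b = u * v + (a * v + u * b)"
        by (simp add: u_def v_def algebra_simps)
      have "unorm (fst x * snd x - a * b) \<le> unorm (u * v) + (unorm (a * v) + unorm (u * b))"
        unfolding eq
        using unorm_add_le_max[of "u * v" "a * v + u * b"] unorm_add_le_max[of "a * v" "u * b"]
          unorm_nonneg[of "u * v"] unorm_nonneg[of "a * v"] unorm_nonneg[of "u * b"] by linarith
      also have "\<dots> = unorm u * unorm v + (unorm a * unorm v + unorm u * unorm b)"
        by (simp add: unorm_mult)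
      also have "\<dots> < d * 1 + (unorm a * d + d * unorm b)"
      proof (intro add_less_le_mono add_mono mult_left_mono mult_right_mono)
        have "unorm u * unorm v \<le> unorm u * 1"
          using v \<open>d \<le> 1\<close> by (intro mult_left_mono) auto
        then show "unorm u * unorm v < d * 1"
          using u by simp
      qed (use u v in auto)
      also have "\<dots> \<le> e"
        using d by (simp add: algebra_simps)
      finally show "dist (fst x * snd x) (a * b) < e"
        by (simp add: dist_unorm)
    qed
  qed
qed

section \<open>Unconditional summation in ultrametric groups\<close>

lemma has_sum_bounded_additive:
  fixes f :: "'a::ultrametric_group \<Rightarrow> 'b::ultrametric_group"
  assumes add: "\<And>x y. f (x + y) = f x + f y"
    and le: "\<And>x. unorm (f x) \<le> C * unorm x" and g: "(g has_sum s) A"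
  shows "((\<lambda>i. f (g i)) has_sum f s) A"
proof -
  interpret Modules.additive f
    by unfold_locales (rule add)
  have "f \<midarrow>s\<rightarrow> f s"
  proof (rule metric_LIM_I)
    fix r :: real assume "0 < r"
    \<comment> \<open>Replacing \<open>C\<close> by \<open>max C 0 + 1\<close> gives a positive
      Lipschitz constant whatever the sign of \<open>C\<close>.\<close>
    define d where "d = r / (max C 0 + 1)"
    have pos: "0 < max C 0 + 1"
      by linarith
    have "dist (f x) (f s) < r" if "dist x s < d" for x
    proof -
      have "dist (f x) (f s) \<le> (max C 0 + 1) * unorm (x - s)"
        using le[of "x - s"] mult_right_mono[of C "max C 0 + 1" "unorm (x - s)"]
        unfolding dist_unorm diff[symmetric] by (smt (verit) unorm_nonneg)
      also have "\<dots> < (max C 0 + 1) * d"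
        using that pos by (simp add: dist_unorm)
      also have "\<dots> = r"
        using pos by (simp add: d_def)
      finally show ?thesis .
    qed
    then show "\<exists>d>0. \<forall>x. x \<noteq> s \<and> dist x s < d \<longrightarrow> dist (f x) (f s) < r"
      using \<open>0 < r\<close> pos by (intro exI[of _ d]) (auto simp: d_def)
  qed
  then show ?thesis
    using has_sum_comm_additive[OF additive_axioms _ g] by (simp add: o_def)
qed

text \<open>Convergence to 0 along the cofinite filter, one-sided because it is applied to norms. In
  a complete ultrametric group it is equivalent to unconditional summability, so it serves as the
  convergence condition for power series.\<close>

definition null_fam :: "'a set \<Rightarrow> ('a \<Rightarrow> real) \<Rightarrow> bool" where
  "null_fam A f \<longleftrightarrow> (\<forall>e>0. finite {a\<in>A. e \<le> f a})"

lemma null_fam_mono: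
  assumes "null_fam A g" "\<And>a. a \<in> A \<Longrightarrow> f a \<le> g a"
  shows "null_fam A f"
  unfolding null_fam_def
proof safe
  fix e :: real assume "e > 0"
  then have "finite {a\<in>A. e \<le> g a}"
    using assms(1) by (auto simp: null_fam_def)
  then show "finite {a\<in>A. e \<le> f a}"
    by (rule rev_finite_subset) (use assms(2) in force)
qed

lemma null_fam_cmult:
  assumes "null_fam A f" "0 \<le> k"
  shows "null_fam A (\<lambda>a. k * f a)"
proof (cases "k = 0")
  case False
  with assms have "k > 0" by simp
  show ?thesis
    unfolding null_fam_def
  proof safe
    fix e :: real assume "e > 0"
    then have "finite {a\<in>A. e / k \<le> f a}"
      using assms(1) \<open>k > 0\<close> by (auto simp: null_fam_def)
    then show "finite {a\<in>A. e \<le> k * f a}"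
      using \<open>k > 0\<close> by (simp add: field_simps)
  qed
qed (auto simp: null_fam_def)

lemma null_fam_finite: "finite A \<Longrightarrow> null_fam A f"
  by (simp add: null_fam_def)

lemma null_fam_seq:
  assumes "f \<longlonglongrightarrow> 0"
  shows "null_fam (UNIV::nat set) f"
  unfolding null_fam_def
proof safe
  fix e :: real assume "e > 0"
  then have "eventually (\<lambda>n. f n < e) sequentially"
    using assms by (metis order_tendstoD(2))
  then obtain N where "\<And>n. n \<ge> N \<Longrightarrow> f n < e"
    by (auto simp: eventually_sequentially)
  then have "{n\<in>UNIV. e \<le> f n} \<subseteq> {..<N}"
    by (force simp: not_le)
  then show "finite {n\<in>UNIV. e \<le> f n}"
    using finite_subset by blast
qed

lemma has_sum_metric_iff:
  fixes f :: "'b \<Rightarrow> 'a::ultrametric_group"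
  shows "(f has_sum s) A \<longleftrightarrow>
    (\<forall>e>0. \<exists>H. finite H \<and> H \<subseteq> A \<and> (\<forall>Y. finite Y \<and> H \<subseteq> Y \<and> Y \<subseteq> A \<longrightarrow> unorm (sum f Y - s) < e))"
  unfolding has_sum_def tendsto_iff eventually_finite_subsets_at_top dist_unorm by blast

text \<open>Adding one index \<open>a\<close> to a good finite set \<open>H\<close> changes the
  partial sum by \<open>f a\<close>, while both partial sums are within \<open>e\<close> of the
  limit.\<close>

lemma has_sum_imp_null:
  fixes f :: "'b \<Rightarrow> 'a::ultrametric_group"
  assumes "(f has_sum s) A"
  shows "null_fam A (\<lambda>i. unorm (f i))"
  unfolding null_fam_def
proof safe
  fix e :: real assume "e > 0"
  then obtain H where H: "finite H" "H \<subseteq> A"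
    "\<And>Y. finite Y \<and> H \<subseteq> Y \<and> Y \<subseteq> A \<Longrightarrow> unorm (sum f Y - s) < e"
    using assms unfolding has_sum_metric_iff by metis
  have "unorm (f a) < e" if "a \<in> A - H" for a
  proof -
    have "f a = (sum f (insert a H) - s) - (sum f H - s)"
      using that H(1) by simp
    moreover have "unorm (sum f (insert a H) - s) < e" "unorm (sum f H - s) < e"
      using that by (auto simp del: sum.insert intro!: H(3) simp: H(1) subsetD[OF H(2)])
    ultimately show ?thesis
      using unorm_diff_less by metis
  qed
  then have "{a\<in>A. e \<le> unorm (f a)} \<subseteq> H"
    by (force simp: not_le)
  then show "finite {a\<in>A. e \<le> unorm (f a)}"
    using H(1) finite_subset by blast
qed

text \<open>A finite sum is never larger than its largest term, so null terms alone make partial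
  sums Cauchy. The sets \<open>H n\<close> exhaust the non-negligible terms as the threshold
  \<open>1 / (n + 1)\<close> decreases.\<close>

lemma null_imp_has_sum:
  fixes f :: "'b \<Rightarrow> 'a::{ultrametric_group, complete_space}"
  assumes "null_fam A (\<lambda>i. unorm (f i))"
  obtains s where "(f has_sum s) A"
proof -
  define H where "H n = {a\<in>A. inverse (real (Suc n)) \<le> unorm (f a)}" for n
  have fin: "finite (H n)" for n
    using assms by (auto simp: H_def null_fam_def)
  have tail: "unorm (sum f (Y - H n)) \<le> inverse (real (Suc n))" if "Y \<subseteq> A" for Y n
    using that by (intro unorm_sum_le) (auto simp: H_def)
  have diff: "unorm (sum f Y - sum f (H n)) \<le> inverse (real (Suc n))"
    if "H n \<subseteq> Y" "Y \<subseteq> A" "finite Y" for Y n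
    using tail[of Y n] that by (simp add: sum_diff)
  have mono: "H n \<subseteq> H m" if "n \<le> m" for n m
  proof -
    have "inverse (real (Suc m)) \<le> inverse (real (Suc n))"
      using that by (intro le_imp_inverse_le) auto
    then show ?thesis
      unfolding H_def using order_trans by blast
  qed
  have "Cauchy (\<lambda>n. sum f (H n))"
  proof (rule metric_CauchyI)
    fix e :: real assume "e > 0"
    then obtain n where n: "inverse (real (Suc n)) < e"
      using reals_Archimedean by blast
    have "unorm (sum f (H m) - sum f (H n)) < e" if "m \<ge> n" for m
      using diff[of n "H m"] mono[OF that] n fin[of m] by (auto simp: H_def)
    then have "unorm ((sum f (H m) - sum f (H n)) - (sum f (H m') - sum f (H n))) < e"
      if "m \<ge> n" "m' \<ge> n" for m m'
      using that unorm_diff_less by blast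
    then show "\<exists>M. \<forall>m\<ge>M. \<forall>n\<ge>M. dist (sum f (H m)) (sum f (H n)) < e"
      by (auto simp: dist_unorm)
  qed
  then obtain s where s: "(\<lambda>n. sum f (H n)) \<longlonglongrightarrow> s"
    using Cauchy_convergent convergent_def by blast
  have "(f has_sum s) A"
    unfolding has_sum_metric_iff
  proof safe
    fix e :: real assume "e > 0"
    have "eventually (\<lambda>n. dist (sum f (H n)) s < e) sequentially"
      using s \<open>e > 0\<close> by (auto simp: tendsto_iff)
    moreover have "eventually (\<lambda>n. inverse (real (Suc n)) < e) sequentially"
      using LIMSEQ_inverse_real_of_nat \<open>e > 0\<close> by (metis order_tendstoD(2))
    ultimately obtain n where n: "dist (sum f (H n)) s < e" "inverse (real (Suc n)) < e"
      by (metis (mono_tags, lifting) eventually_conj eventually_sequentially order_refl)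
    have "unorm (sum f Y - s) < e" if Y: "finite Y" "H n \<subseteq> Y" "Y \<subseteq> A" for Y
    proof -
      have "unorm ((sum f Y - sum f (H n)) - (s - sum f (H n))) < e"
        using diff[of n Y] Y n by (rule_tac unorm_diff_less) (auto simp: dist_unorm unorm_minus_commute)
      then show ?thesis by simp
    qed
    then show "\<exists>Z. finite Z \<and> Z \<subseteq> A \<and> (\<forall>Y. finite Y \<and> Z \<subseteq> Y \<and> Y \<subseteq> A \<longrightarrow> unorm (sum f Y - s) < e)"
      using fin[of n] by (intro exI[of _ "H n"]) (auto simp: H_def)
  qed
  then show thesis by (rule that)
qed

text \<open>If \<open>unorm s\<close> exceeded \<open>C\<close>, some partial sum would be closer to
  \<open>s\<close> than \<open>unorm s\<close> while having norm at most \<open>C < unorm s\<close>;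
  the ultrametric inequality forbids this.\<close>

lemma has_sum_unorm_le:
  fixes f :: "'b \<Rightarrow> 'a::ultrametric_group"
  assumes "(f has_sum s) A" "\<And>i. i \<in> A \<Longrightarrow> unorm (f i) \<le> C" "0 \<le> C"
  shows "unorm s \<le> C"
proof (rule ccontr)
  assume "\<not> unorm s \<le> C"
  then have "0 < unorm s"
    using assms(3) by linarith
  then obtain H where H: "H \<subseteq> A" "unorm (sum f H - s) < unorm s"
    using assms(1) unfolding has_sum_metric_iff by blast
  have "unorm (sum f H) < unorm s"
    using unorm_sum_le[of H f C] H(1) assms \<open>\<not> unorm s \<le> C\<close> by fastforce
  then show False
    using unorm_diff_less[OF _ H(2)] by fastforce
qed

text \<open>A null double family is summable over the product, and both iterated sums compute that
  one value.\<close>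

lemma has_sum_swap_null:
  fixes f :: "'b \<Rightarrow> 'c \<Rightarrow> 'a::{ultrametric_group, complete_space}"
  assumes null: "null_fam (I \<times> J) (\<lambda>(i,j). unorm (f i j))"
    and rows: "\<And>i. i \<in> I \<Longrightarrow> (f i has_sum r i) J"
    and cols: "\<And>j. j \<in> J \<Longrightarrow> ((\<lambda>i. f i j) has_sum c j) I"
    and sum: "(c has_sum s) J"
  shows "(r has_sum s) I"
proof -
  obtain t where t: "((\<lambda>(i,j). f i j) has_sum t) (I \<times> J)"
    using null_imp_has_sum[of "I \<times> J" "\<lambda>(i,j). f i j"] null by (auto simp: case_prod_unfold)
  have r: "(r has_sum t) I"
    by (rule has_sum_SigmaD[OF t]) (use rows in auto)
  have "((\<lambda>(j,i). f i j) has_sum t) (J \<times> I)"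
  proof -
    have "((\<lambda>(i,j). f i j) has_sum t) (prod.swap ` (J \<times> I))"
      using t by (simp add: product_swap)
    then show ?thesis
      by (subst (asm) has_sum_reindex) (auto simp: o_def case_prod_unfold)
  qed
  then have "(c has_sum t) J"
    by (rule has_sum_SigmaD) (use cols in auto)
  then show ?thesis
    using r sum has_sum_unique by blast
qed

subsection \<open>Convergent power series on polydiscs\<close>

text \<open>Requiring 0 outside \<open>I\<close> represents each multi-index on \<open>I\<close> by
  exactly one function; for \<open>I = Basis\<close> this is the index set in
  \<open>analytic_at\<close>.\<close>

definition midx :: "'i set \<Rightarrow> ('i \<Rightarrow> nat) set" where
  "midx I = {\<nu>. \<forall>b. b \<notin> I \<longrightarrow> \<nu> b = 0}"

definition mpow :: "'i set \<Rightarrow> ('i \<Rightarrow> 'a::comm_monoid_mult) \<Rightarrow> ('i \<Rightarrow> nat) \<Rightarrow> 'a" where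
  "mpow I x \<nu> = (\<Prod>b\<in>I. x b ^ \<nu> b)"

lemma mpow_0 [simp]: "mpow I x (\<lambda>_. 0) = 1"
  by (simp add: mpow_def)

lemma mpow_add: "mpow I x (\<lambda>b. \<mu> b + \<nu> b) = mpow I x \<mu> * mpow I x \<nu>"
  by (simp add: mpow_def power_add prod.distrib)

lemma mpow_pos: "(\<And>b. b \<in> I \<Longrightarrow> 0 < w b) \<Longrightarrow> 0 < (mpow I w \<nu> :: real)"
  by (simp add: mpow_def prod_pos)

lemma mpow_nonneg: "(\<And>b. b \<in> I \<Longrightarrow> 0 \<le> w b) \<Longrightarrow> 0 \<le> (mpow I w \<nu> :: real)"
  by (simp add: mpow_def prod_nonneg)

lemma mpow_mono:
  "(\<And>b. b \<in> I \<Longrightarrow> 0 \<le> v b \<and> v b \<le> w b) \<Longrightarrow> mpow I v \<nu> \<le> (mpow I w \<nu> :: real)"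
  unfolding mpow_def by (intro prod_mono) (auto intro: power_mono)

lemma unorm_mpow_le:
  fixes x :: "'i \<Rightarrow> 'k::complete_ultrametric_field"
  assumes "\<And>b. b \<in> I \<Longrightarrow> unorm (x b) \<le> w b"
  shows "unorm (mpow I x \<nu>) \<le> mpow I w \<nu>"
  unfolding mpow_def unorm_prod unorm_power
  using assms by (intro prod_mono) (auto intro: power_mono)

lemma mpow_unit:
  assumes "finite I" "b \<in> I"
  shows "mpow I x (\<lambda>b'. if b' = b then 1 else 0) = x b"
proof -
  have "mpow I x (\<lambda>b'. if b' = b then 1 else 0) = (\<Prod>b'\<in>I. if b' = b then x b' else 1)"
    unfolding mpow_def by (intro prod.cong) auto
  then show ?thesis
    using assms by simp
qed

text \<open>Membership in the ball of radius \<open>C\<close> of the Tate algebra on the polydisc with radii \<open>w\<close>,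
  phrased for functions: working with functions instead of coefficient families makes
  substitution an ordinary composition.\<close>

definition tate :: "'i set \<Rightarrow> ('i \<Rightarrow> real) \<Rightarrow> real \<Rightarrow>
    (('i \<Rightarrow> 'k::complete_ultrametric_field) \<Rightarrow> 'k) \<Rightarrow> bool" where
  "tate I w C F \<longleftrightarrow> (\<exists>c.
     (\<forall>\<nu>\<in>midx I. unorm (c \<nu>) * mpow I w \<nu> \<le> C) \<and>
     null_fam (midx I) (\<lambda>\<nu>. unorm (c \<nu>) * mpow I w \<nu>) \<and>
     (\<forall>x. (\<forall>b\<in>I. unorm (x b) \<le> w b) \<longrightarrow>
        ((\<lambda>\<nu>. c \<nu> * mpow I x \<nu>) has_sum F x) (midx I)))"

lemma tate_nonneg:
  fixes F :: "('i \<Rightarrow> 'k::complete_ultrametric_field) \<Rightarrow> 'k"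
  assumes "tate I w C F" shows "0 \<le> C"
proof -
  obtain c :: "('i \<Rightarrow> nat) \<Rightarrow> 'k" where "\<forall>\<nu>\<in>midx I. unorm (c \<nu>) * mpow I w \<nu> \<le> C"
    using assms unfolding tate_def by blast
  then have "unorm (c (\<lambda>_. 0)) * mpow I w (\<lambda>_. 0) \<le> C"
    by (rule bspec) (simp add: midx_def)
  then show ?thesis
    using unorm_nonneg[of "c (\<lambda>_. 0)"] unfolding mpow_0 by linarith
qed

lemma tate_mono: "tate I w C F \<Longrightarrow> C \<le> D \<Longrightarrow> tate I w D F"
  unfolding tate_def by (meson order_trans)

lemma tate_cong:
  assumes "tate I w C F" "\<And>x. (\<And>b. b \<in> I \<Longrightarrow> unorm (x b) \<le> w b) \<Longrightarrow> F x = G x"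
  shows "tate I w C G"
  using assms unfolding tate_def by fastforce

text \<open>Arguments are total functions on the index type. This allows a point of the full space
  to be fed to a series in the variables \<open>S\<close> alone.\<close>

lemma tate_depends:
  assumes "tate I w C F" "\<And>b. b \<in> I \<Longrightarrow> x b = y b" "\<And>b. b \<in> I \<Longrightarrow> unorm (x b) \<le> w b"
  shows "F x = F y"
proof -
  obtain c where c: "\<And>x. (\<forall>b\<in>I. unorm (x b) \<le> w b) \<Longrightarrow>
      ((\<lambda>\<nu>. c \<nu> * mpow I x \<nu>) has_sum F x) (midx I)"
    using assms(1) unfolding tate_def by blast
  have "mpow I x \<nu> = mpow I y \<nu>" for \<nu>
    unfolding mpow_def using assms(2) by (intro prod.cong) auto
  then show ?thesis
    using c[of x] c[of y] assms(2,3) has_sum_unique by fastforce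
qed

lemma tate_weights:
  assumes "tate I w C F" "\<And>b. b \<in> I \<Longrightarrow> 0 \<le> v b \<and> v b \<le> w b"
  shows "tate I v C F"
proof -
  obtain c where c: "\<forall>\<nu>\<in>midx I. unorm (c \<nu>) * mpow I w \<nu> \<le> C"
     "null_fam (midx I) (\<lambda>\<nu>. unorm (c \<nu>) * mpow I w \<nu>)"
     "\<forall>x. (\<forall>b\<in>I. unorm (x b) \<le> w b) \<longrightarrow>
        ((\<lambda>\<nu>. c \<nu> * mpow I x \<nu>) has_sum F x) (midx I)"
    using assms(1) unfolding tate_def by blast
  have le: "unorm (c \<nu>) * mpow I v \<nu> \<le> unorm (c \<nu>) * mpow I w \<nu>" for \<nu>
    by (intro mult_left_mono mpow_mono assms(2)) auto
  have "\<forall>\<nu>\<in>midx I. unorm (c \<nu>) * mpow I v \<nu> \<le> C"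
    using c(1) le order_trans by blast
  moreover have "null_fam (midx I) (\<lambda>\<nu>. unorm (c \<nu>) * mpow I v \<nu>)"
    using c(2) le by (rule null_fam_mono)
  moreover have "\<forall>x. (\<forall>b\<in>I. unorm (x b) \<le> v b) \<longrightarrow>
        ((\<lambda>\<nu>. c \<nu> * mpow I x \<nu>) has_sum F x) (midx I)"
    using c(3) assms(2) by (meson order_trans)
  ultimately show ?thesis
    unfolding tate_def by blast
qed

section \<open>Closure properties of the balls of the Tate algebra\<close>

lemma tate_cmult:
  assumes "tate I w C F"
  shows "tate I w (unorm k * C) (\<lambda>x. k * F x)"
proof -
  obtain c where c: "\<forall>\<nu>\<in>midx I. unorm (c \<nu>) * mpow I w \<nu> \<le> C"
     "null_fam (midx I) (\<lambda>\<nu>. unorm (c \<nu>) * mpow I w \<nu>)"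
     "\<forall>x. (\<forall>b\<in>I. unorm (x b) \<le> w b) \<longrightarrow>
        ((\<lambda>\<nu>. c \<nu> * mpow I x \<nu>) has_sum F x) (midx I)"
    using assms(1) unfolding tate_def by blast
  show ?thesis
    unfolding tate_def
  proof (intro exI[of _ "\<lambda>\<nu>. k * c \<nu>"] conjI allI impI ballI)
    show "unorm (k * c \<nu>) * mpow I w \<nu> \<le> unorm k * C" if "\<nu> \<in> midx I" for \<nu>
      using c(1) that by (simp add: unorm_mult mult.assoc mult_left_mono)
    show "null_fam (midx I) (\<lambda>\<nu>. unorm (k * c \<nu>) * mpow I w \<nu>)"
      using null_fam_cmult[OF c(2), of "unorm k"] by (simp add: unorm_mult mult.assoc)
    show "((\<lambda>\<nu>. k * c \<nu> * mpow I x \<nu>) has_sum k * F x) (midx I)"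
      if "\<forall>b\<in>I. unorm (x b) \<le> w b" for x
      using has_sum_cmult_right[OF c(3)[rule_format, OF bspec[OF that]]] by (simp add: mult.assoc)
  qed
qed

lemma tate_const:
  assumes "\<And>b. b \<in> I \<Longrightarrow> 0 \<le> w b"
  shows "tate I w (unorm k) (\<lambda>_. k)"
proof -
  define c :: "('a \<Rightarrow> nat) \<Rightarrow> 'b" where "c \<nu> = (if \<nu> = (\<lambda>_. 0) then k else 0)" for \<nu>
  have z: "(\<lambda>_. 0) \<in> midx I"
    by (simp add: midx_def)
  show ?thesis
    unfolding tate_def
  proof (intro exI[of _ c] conjI allI impI ballI)
    show "unorm (c \<nu>) * mpow I w \<nu> \<le> unorm k" for \<nu>
      by (simp add: c_def)
    show "null_fam (midx I) (\<lambda>\<nu>. unorm (c \<nu>) * mpow I w \<nu>)"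
      unfolding null_fam_def
    proof safe
      fix e :: real assume "e > 0"
      then have "{\<nu> \<in> midx I. e \<le> unorm (c \<nu>) * mpow I w \<nu>} \<subseteq> {\<lambda>_. 0}"
        by (auto simp: c_def)
      then show "finite {\<nu> \<in> midx I. e \<le> unorm (c \<nu>) * mpow I w \<nu>}"
        using finite_subset by blast
    qed
    show "((\<lambda>\<nu>. c \<nu> * mpow I x \<nu>) has_sum k) (midx I)" for x
    proof -
      have "((\<lambda>\<nu>. c \<nu> * mpow I x \<nu>) has_sum k) {\<lambda>_. 0}"
        by (rule has_sum_finiteI) (auto simp: c_def)
      then show ?thesis
        by (rule has_sum_cong_neutral[THEN iffD1, rotated -1]) (auto simp: c_def z)
    qed
  qed
qed

lemma tate_zero: "0 \<le> C \<Longrightarrow> (\<And>b. b \<in> I \<Longrightarrow> 0 \<le> w b) \<Longrightarrow> tate I w C (\<lambda>_. 0)"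
  using tate_const[of I w 0] by (auto intro: tate_mono)

text \<open>Multiplying by a monomial merely translates the coefficient family. Products of two
  series are reduced to this case, so no Cauchy product has to be rearranged.\<close>

lemma tate_shift:
  assumes G: "tate I w D G" and w: "\<And>b. b \<in> I \<Longrightarrow> 0 < w b" and \<mu>: "\<mu> \<in> midx I"
  shows "tate I w (mpow I w \<mu> * D) (\<lambda>x. mpow I x \<mu> * G x)"
proof -
  obtain c where c: "\<forall>\<nu>\<in>midx I. unorm (c \<nu>) * mpow I w \<nu> \<le> D"
     "null_fam (midx I) (\<lambda>\<nu>. unorm (c \<nu>) * mpow I w \<nu>)"
     "\<forall>x. (\<forall>b\<in>I. unorm (x b) \<le> w b) \<longrightarrow>
        ((\<lambda>\<nu>. c \<nu> * mpow I x \<nu>) has_sum G x) (midx I)"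
    using G unfolding tate_def by blast
  define h :: "('a \<Rightarrow> nat) \<Rightarrow> 'a \<Rightarrow> nat" where "h \<nu> = (\<lambda>b. \<mu> b + \<nu> b)" for \<nu>
  define d where "d \<kappa> = (if \<kappa> \<in> h ` midx I then c (\<lambda>b. \<kappa> b - \<mu> b) else 0)" for \<kappa>
  have dh: "d (h \<nu>) = c \<nu>" if "\<nu> \<in> midx I" for \<nu>
    using that by (auto simp: d_def h_def)
  have inj: "inj_on h (midx I)"
    by (auto simp: inj_on_def h_def fun_eq_iff)
  have sub: "h ` midx I \<subseteq> midx I"
    using \<mu> by (auto simp: midx_def h_def)
  have mh: "mpow I x (h \<nu>) = mpow I x \<mu> * mpow I x \<nu>" for \<nu> and x :: "'a \<Rightarrow> 'c::comm_monoid_mult"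
    by (simp add: h_def mpow_add)
  have wp: "0 < mpow I w \<mu>"
    using w by (rule mpow_pos)
  have zero: "d \<kappa> = 0" if "\<kappa> \<notin> h ` midx I" for \<kappa>
    using that by (simp add: d_def)
  show ?thesis
    unfolding tate_def
  proof (intro exI[of _ d] conjI allI impI ballI)
    show "unorm (d \<kappa>) * mpow I w \<kappa> \<le> mpow I w \<mu> * D" if "\<kappa> \<in> midx I" for \<kappa>
    proof (cases "\<kappa> \<in> h ` midx I")
      case True
      then obtain \<nu> where "\<nu> \<in> midx I" "\<kappa> = h \<nu>" by blast
      then show ?thesis
        using c(1) wp by (simp add: dh mh mult.left_commute)
    next
      case False
      then show ?thesis
        using tate_nonneg[OF G] wp by (simp add: zero)
    qed
    show "null_fam (midx I) (\<lambda>\<nu>. unorm (d \<nu>) * mpow I w \<nu>)"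
      unfolding null_fam_def
    proof safe
      fix e :: real assume "e > 0"
      then have "finite (h ` {\<nu> \<in> midx I. e \<le> mpow I w \<mu> * (unorm (c \<nu>) * mpow I w \<nu>)})"
        using null_fam_cmult[OF c(2), of "mpow I w \<mu>"] wp by (auto simp: null_fam_def)
      moreover have "{\<nu> \<in> midx I. e \<le> unorm (d \<nu>) * mpow I w \<nu>} \<subseteq>
          h ` {\<nu> \<in> midx I. e \<le> mpow I w \<mu> * (unorm (c \<nu>) * mpow I w \<nu>)}"
      proof safe
        fix \<kappa> assume \<kappa>: "e \<le> unorm (d \<kappa>) * mpow I w \<kappa>"
        then obtain \<nu> where "\<nu> \<in> midx I" "\<kappa> = h \<nu>"
          using \<open>e > 0\<close> zero[of \<kappa>] by fastforce
        with \<kappa> show "\<kappa> \<in> h ` {\<nu> \<in> midx I. e \<le> mpow I w \<mu> * (unorm (c \<nu>) * mpow I w \<nu>)}"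
          by (auto simp: dh mh mult.left_commute)
      qed
      ultimately show "finite {\<nu> \<in> midx I. e \<le> unorm (d \<nu>) * mpow I w \<nu>}"
        using finite_subset by blast
    qed
    show "((\<lambda>\<nu>. d \<nu> * mpow I x \<nu>) has_sum mpow I x \<mu> * G x) (midx I)"
      if "\<forall>b\<in>I. unorm (x b) \<le> w b" for x
    proof -
      have "((\<lambda>\<nu>. mpow I x \<mu> * (c \<nu> * mpow I x \<nu>)) has_sum mpow I x \<mu> * G x) (midx I)"
        using c(3) that by (intro has_sum_cmult_right) blast
      then have "((\<lambda>\<nu>. d (h \<nu>) * mpow I x (h \<nu>)) has_sum mpow I x \<mu> * G x) (midx I)"
        by (rule has_sum_cong[THEN iffD1, rotated]) (simp add: dh mh mult.left_commute)
      then have "((\<lambda>\<nu>. d \<nu> * mpow I x \<nu>) has_sum mpow I x \<mu> * G x) (h ` midx I)"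
        by (subst has_sum_reindex[OF inj]) (simp add: o_def)
      then show ?thesis
        by (rule has_sum_cong_neutral[THEN iffD1, rotated -1]) (use sub zero in auto)
    qed
  qed
qed

lemma tate_var:
  assumes "finite I" "b \<in> I" "\<And>b. b \<in> I \<Longrightarrow> 0 < w b"
  shows "tate I w (w b) (\<lambda>x::'i \<Rightarrow> 'k::complete_ultrametric_field. x b)"
proof -
  have "tate I w (mpow I w (\<lambda>b'. if b' = b then 1 else 0) * unorm (1::'k))
     (\<lambda>x::'i \<Rightarrow> 'k. mpow I x (\<lambda>b'. if b' = b then 1 else 0) * 1)"
    using assms by (intro tate_shift tate_const) (auto simp: midx_def less_imp_le)
  then show ?thesis
    using assms by (simp add: mpow_unit)
qed

text \<open>Completeness of the Tate algebra, in the form from which sums, products, substitution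
  and the limit of the graph iteration are derived: if the Gauss bounds \<open>C j\<close> tend to
  0, the series can be summed coefficient by coefficient.\<close>

lemma tate_has_sum:
  assumes F: "\<And>j. j \<in> J \<Longrightarrow> tate I w (C j) (F j)"
    and null: "null_fam J C" and le: "\<And>j. j \<in> J \<Longrightarrow> C j \<le> D" and "0 \<le> D"
    and w: "\<And>b. b \<in> I \<Longrightarrow> 0 < w b"
    and G: "\<And>x. (\<And>b. b \<in> I \<Longrightarrow> unorm (x b) \<le> w b) \<Longrightarrow> ((\<lambda>j. F j x) has_sum G x) J"
  shows "tate I w D G"
proof -
  have "\<forall>j. \<exists>c. j \<in> J \<longrightarrow> (\<forall>\<nu>\<in>midx I. unorm (c \<nu>) * mpow I w \<nu> \<le> C j) \<and>
     null_fam (midx I) (\<lambda>\<nu>. unorm (c \<nu>) * mpow I w \<nu>) \<and>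
     (\<forall>x. (\<forall>b\<in>I. unorm (x b) \<le> w b) \<longrightarrow>
        ((\<lambda>\<nu>. c \<nu> * mpow I x \<nu>) has_sum F j x) (midx I))"
    using F unfolding tate_def by blast
  from choice[OF this] obtain c where
     c: "\<forall>j. j \<in> J \<longrightarrow> (\<forall>\<nu>\<in>midx I. unorm (c j \<nu>) * mpow I w \<nu> \<le> C j) \<and>
     null_fam (midx I) (\<lambda>\<nu>. unorm (c j \<nu>) * mpow I w \<nu>) \<and>
     (\<forall>x. (\<forall>b\<in>I. unorm (x b) \<le> w b) \<longrightarrow>
        ((\<lambda>\<nu>. c j \<nu> * mpow I x \<nu>) has_sum F j x) (midx I))" ..
  have c1: "unorm (c j \<nu>) * mpow I w \<nu> \<le> C j" if "j \<in> J" "\<nu> \<in> midx I" for j \<nu>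
    using c[rule_format, OF that(1)] that(2) by blast
  have c2: "null_fam (midx I) (\<lambda>\<nu>. unorm (c j \<nu>) * mpow I w \<nu>)" if "j \<in> J" for j
    using c[rule_format, OF that(1)] by blast
  have c3: "((\<lambda>\<nu>. c j \<nu> * mpow I x \<nu>) has_sum F j x) (midx I)"
    if "j \<in> J" "\<forall>b\<in>I. unorm (x b) \<le> w b" for j x
    using c that by blast
  have wp: "0 < mpow I w \<nu>" for \<nu>
    using w by (rule mpow_pos)
  have "\<exists>d. ((\<lambda>j. c j \<nu>) has_sum d) J" if "\<nu> \<in> midx I" for \<nu>
  proof -
    have "null_fam J (\<lambda>j. inverse (mpow I w \<nu>) * C j)"
      using null wp[of \<nu>] by (intro null_fam_cmult) auto
    then have "null_fam J (\<lambda>j. unorm (c j \<nu>))"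
    proof (rule null_fam_mono)
      show "unorm (c j \<nu>) \<le> inverse (mpow I w \<nu>) * C j" if "j \<in> J" for j
        using c1[OF that \<open>\<nu> \<in> midx I\<close>] wp[of \<nu>] by (simp add: field_simps)
    qed
    then show ?thesis
      by (rule null_imp_has_sum) blast
  qed
  then have "\<forall>\<nu>. \<exists>d. \<nu> \<in> midx I \<longrightarrow> ((\<lambda>j. c j \<nu>) has_sum d) J"
    by blast
  from choice[OF this] obtain d
    where d: "\<And>\<nu>. \<nu> \<in> midx I \<Longrightarrow> ((\<lambda>j. c j \<nu>) has_sum d \<nu>) J"
    by blast
  \<comment> \<open>\<open>K\<close> is kept free: \<open>K = D\<close> yields the global bound, and
    \<open>K = e / 2\<close> shows that the new coefficients are null.\<close>
  have d_le: "unorm (d \<nu>) * mpow I w \<nu> \<le> K"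
    if "\<nu> \<in> midx I" "\<And>j. j \<in> J \<Longrightarrow> unorm (c j \<nu>) * mpow I w \<nu> \<le> K" "0 \<le> K" for \<nu> K
  proof -
    have "unorm (d \<nu>) \<le> K / mpow I w \<nu>"
      using d[OF that(1)]
      by (rule has_sum_unorm_le) (use that wp[of \<nu>] in \<open>auto simp: field_simps\<close>)
    then show ?thesis
      using wp[of \<nu>] by (simp add: field_simps)
  qed
  show ?thesis
    unfolding tate_def
  proof (intro exI[of _ d] conjI allI impI ballI)
    show "unorm (d \<nu>) * mpow I w \<nu> \<le> D" if "\<nu> \<in> midx I" for \<nu>
      using that \<open>0 \<le> D\<close> c1 le by (intro d_le) (auto intro: order_trans)
    show "null_fam (midx I) (\<lambda>\<nu>. unorm (d \<nu>) * mpow I w \<nu>)"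
      unfolding null_fam_def
    proof safe
      fix e :: real assume "e > 0"
      \<comment> \<open>If every contribution to the coefficient at \<nu> were at most
        \<open>e / 2\<close>, so would be their sum; hence some \<open>j\<close> contributes more,
        and only finitely many \<open>j\<close> can. Halving turns the non-strict bound into a
        contradiction.\<close>
      have "{\<nu> \<in> midx I. e \<le> unorm (d \<nu>) * mpow I w \<nu>} \<subseteq>
         (\<Union>j\<in>{j\<in>J. e / 2 \<le> C j}. {\<nu> \<in> midx I. e / 2 \<le> unorm (c j \<nu>) * mpow I w \<nu>})"
      proof safe
        fix \<nu> assume \<nu>: "\<nu> \<in> midx I" "e \<le> unorm (d \<nu>) * mpow I w \<nu>"
        then have "\<not> (\<forall>j\<in>J. unorm (c j \<nu>) * mpow I w \<nu> \<le> e / 2)"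
          using d_le[of \<nu> "e / 2"] \<open>e > 0\<close> by fastforce
        then obtain j where "j \<in> J" "e / 2 \<le> unorm (c j \<nu>) * mpow I w \<nu>"
          by force
        then show "\<nu> \<in> (\<Union>j\<in>{j\<in>J. e / 2 \<le> C j}. {\<nu> \<in> midx I. e / 2 \<le> unorm (c j \<nu>) * mpow I w \<nu>})"
          using \<nu>(1) c1[of j \<nu>] by fastforce
      qed
      moreover have "finite \<dots>"
        using null c2 half_gt_zero[OF \<open>e > 0\<close>] unfolding null_fam_def by (intro finite_UN_I) blast+
      ultimately show "finite {\<nu> \<in> midx I. e \<le> unorm (d \<nu>) * mpow I w \<nu>}"
        using finite_subset by blast
    qed
    show "((\<lambda>\<nu>. d \<nu> * mpow I x \<nu>) has_sum G x) (midx I)" if x: "\<forall>b\<in>I. unorm (x b) \<le> w b" for x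
    proof (rule has_sum_swap_null[where f = "\<lambda>\<nu> j. c j \<nu> * mpow I x \<nu>"])
      have le': "unorm (c j \<nu> * mpow I x \<nu>) \<le> unorm (c j \<nu>) * mpow I w \<nu>" for j \<nu>
        unfolding unorm_mult using x by (intro mult_left_mono unorm_mpow_le) auto
      show "null_fam (midx I \<times> J) (\<lambda>(\<nu>,j). unorm (c j \<nu> * mpow I x \<nu>))"
        unfolding null_fam_def
      proof safe
        fix e :: real assume "e > 0"
        have "{a \<in> midx I \<times> J. e \<le> (case a of (\<nu>, j) \<Rightarrow> unorm (c j \<nu> * mpow I x \<nu>))} \<subseteq>
          (\<Union>j\<in>{j\<in>J. e \<le> C j}. (\<lambda>\<nu>. (\<nu>, j)) ` {\<nu> \<in> midx I. e \<le> unorm (c j \<nu>) * mpow I w \<nu>})"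
        proof safe
          fix \<nu> j assume "\<nu> \<in> midx I" "j \<in> J" "e \<le> unorm (c j \<nu> * mpow I x \<nu>)"
          then show "(\<nu>, j) \<in> (\<Union>j\<in>{j\<in>J. e \<le> C j}.
              (\<lambda>\<nu>. (\<nu>, j)) ` {\<nu> \<in> midx I. e \<le> unorm (c j \<nu>) * mpow I w \<nu>})"
            using c1[of j \<nu>] le'[of j \<nu>] by force
        qed
        moreover have "finite \<dots>"
          using null c2 \<open>e > 0\<close> by (intro finite_UN_I finite_imageI) (auto simp: null_fam_def)
        ultimately show "finite {a \<in> midx I \<times> J. e \<le> (case a of (\<nu>, j) \<Rightarrow> unorm (c j \<nu> * mpow I x \<nu>))}"
          using finite_subset by blast
      qed
      show "((\<lambda>j. c j \<nu> * mpow I x \<nu>) has_sum d \<nu> * mpow I x \<nu>) J" if "\<nu> \<in> midx I" for \<nu>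
        using d[OF that] by (rule has_sum_cmult_left)
      show "((\<lambda>\<nu>. c j \<nu> * mpow I x \<nu>) has_sum F j x) (midx I)" if "j \<in> J" for j
        using c3 that x by blast
      show "((\<lambda>j. F j x) has_sum G x) J"
        using G x by blast
    qed
  qed
qed

lemma tate_sum:
  assumes "finite J" "\<And>j. j \<in> J \<Longrightarrow> tate I w D (F j)" "0 \<le> D" "\<And>b. b \<in> I \<Longrightarrow> 0 < w b"
  shows "tate I w D (\<lambda>x. \<Sum>j\<in>J. F j x)"
  by (rule tate_has_sum[where J = J and F = F and C = "\<lambda>_. D"])
     (use assms in \<open>auto intro: null_fam_finite\<close>)

lemma tate_add:
  assumes "tate I w D F" "tate I w D G" "\<And>b. b \<in> I \<Longrightarrow> 0 < w b"
  shows "tate I w D (\<lambda>x. F x + G x)"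
  using tate_sum[of "UNIV::bool set" I w D "\<lambda>b. if b then F else G"] assms tate_nonneg[OF assms(1)]
  by (auto simp: UNIV_bool add.commute)

lemma tate_minus: "tate I w D F \<Longrightarrow> tate I w D (\<lambda>x. - F x)"
  using tate_cmult[of I w D F "-1"] by simp

lemma tate_diff:
  assumes "tate I w D F" "tate I w D G" "\<And>b. b \<in> I \<Longrightarrow> 0 < w b"
  shows "tate I w D (\<lambda>x. F x - G x)"
  using tate_add[OF assms(1) tate_minus[OF assms(2)]] assms(3) by simp

text \<open>Only the first factor is expanded; each of its monomials times \<open>G\<close> is
  covered by \<open>tate_shift\<close>.\<close>

lemma tate_mult:
  assumes F: "tate I w C F" and G: "tate I w D G" and w: "\<And>b. b \<in> I \<Longrightarrow> 0 < w b"
  shows "tate I w (C * D) (\<lambda>x. F x * G x)"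
proof -
  obtain c where c: "\<forall>\<nu>\<in>midx I. unorm (c \<nu>) * mpow I w \<nu> \<le> C"
     "null_fam (midx I) (\<lambda>\<nu>. unorm (c \<nu>) * mpow I w \<nu>)"
     "\<forall>x. (\<forall>b\<in>I. unorm (x b) \<le> w b) \<longrightarrow>
        ((\<lambda>\<nu>. c \<nu> * mpow I x \<nu>) has_sum F x) (midx I)"
    using F unfolding tate_def by blast
  show ?thesis
  proof (rule tate_has_sum[where J = "midx I"])
    show "tate I w (unorm (c \<nu>) * (mpow I w \<nu> * D)) (\<lambda>x. c \<nu> * (mpow I x \<nu> * G x))"
      if "\<nu> \<in> midx I" for \<nu>
      using that G w by (intro tate_cmult tate_shift)
    show "null_fam (midx I) (\<lambda>\<nu>. unorm (c \<nu>) * (mpow I w \<nu> * D))"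
      using null_fam_cmult[OF c(2) tate_nonneg[OF G]] by (simp add: mult_ac)
    show "unorm (c \<nu>) * (mpow I w \<nu> * D) \<le> C * D" if "\<nu> \<in> midx I" for \<nu>
      using c(1) that tate_nonneg[OF G] mult_right_mono[of "unorm (c \<nu>) * mpow I w \<nu>" C D]
      by (simp add: mult.assoc)
    show "0 \<le> C * D"
      using tate_nonneg[OF F] tate_nonneg[OF G] by simp
    show "((\<lambda>\<nu>. c \<nu> * (mpow I x \<nu> * G x)) has_sum F x * G x) (midx I)"
      if "\<And>b. b \<in> I \<Longrightarrow> unorm (x b) \<le> w b" for x
      unfolding mult.assoc[symmetric] by (rule has_sum_cmult_left) (use c(3) that in blast)
  qed (use w in auto)
qed

lemma tate_bound:
  assumes "tate I w C F" "\<And>b. b \<in> I \<Longrightarrow> unorm (x b) \<le> w b"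
  shows "unorm (F x) \<le> C"
proof -
  obtain c where c: "\<forall>\<nu>\<in>midx I. unorm (c \<nu>) * mpow I w \<nu> \<le> C"
     "\<forall>x. (\<forall>b\<in>I. unorm (x b) \<le> w b) \<longrightarrow>
        ((\<lambda>\<nu>. c \<nu> * mpow I x \<nu>) has_sum F x) (midx I)"
    using assms(1) unfolding tate_def by blast
  have "((\<lambda>\<nu>. c \<nu> * mpow I x \<nu>) has_sum F x) (midx I)"
    using c(2) assms(2) by blast
  then show ?thesis
  proof (rule has_sum_unorm_le)
    show "unorm (c \<nu> * mpow I x \<nu>) \<le> C" if "\<nu> \<in> midx I" for \<nu>
    proof -
      have "unorm (c \<nu> * mpow I x \<nu>) \<le> unorm (c \<nu>) * mpow I w \<nu>"
        unfolding unorm_mult by (intro mult_left_mono unorm_mpow_le) (use assms in auto)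
      then show ?thesis
        using c(1) that by force
    qed
  qed (use tate_nonneg[OF assms(1)] in auto)
qed

lemma tate_power:
  assumes "tate I w C F" "\<And>b. b \<in> I \<Longrightarrow> 0 < w b"
  shows "tate I w (C ^ n) (\<lambda>x. F x ^ n)"
proof (induction n)
  case 0
  then show ?case
    using tate_const[of I w 1] assms(2) by (simp add: less_imp_le)
next
  case (Suc n)
  then show ?case
    using tate_mult[OF assms(1) Suc assms(2)] by simp
qed

lemma tate_prod:
  assumes "\<And>b. b \<in> A \<Longrightarrow> tate I w (C b) (F b)" "\<And>b. b \<in> I \<Longrightarrow> 0 < w b"
  shows "tate I w (prod C A) (\<lambda>x. \<Prod>b\<in>A. F b x)"
  using assms(1)
proof (induction A rule: infinite_finite_induct)
  case (insert b A)
  then show ?case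
    using tate_mult[of I w "C b" "F b"] assms(2) by simp
qed (use tate_const[of I w 1] assms(2) in \<open>auto simp: less_imp_le\<close>)

text \<open>Telescoping: \<open>F * X - G * Y = (F - G) * X + G * (X - Y)\<close>. By the
  ultrametric inequality the relative error \<delta> does not accumulate with the number of
  factors.\<close>

lemma tate_prod_diff:
  assumes "\<And>b. b \<in> A \<Longrightarrow> tate I w (C b) (F b)" "\<And>b. b \<in> A \<Longrightarrow> tate I w (C b) (G b)"
    and "\<And>b. b \<in> A \<Longrightarrow> tate I w (\<delta> * C b) (\<lambda>x. F b x - G b x)"
    and w: "\<And>b. b \<in> I \<Longrightarrow> 0 < w b" and "0 \<le> \<delta>"
  shows "tate I w (\<delta> * prod C A) (\<lambda>x. (\<Prod>b\<in>A. F b x) - (\<Prod>b\<in>A. G b x))"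
  using assms(1-3)
proof (induction A rule: infinite_finite_induct)
  case (insert b A)
  have 1: "tate I w (prod C A) (\<lambda>x. \<Prod>b\<in>A. F b x)"
    using insert.prems w by (intro tate_prod) auto
  have "tate I w (\<delta> * (C b * prod C A)) (\<lambda>x. (F b x - G b x) * (\<Prod>b\<in>A. F b x))"
    using tate_mult[OF insert.prems(3) 1 w] by (simp add: mult.assoc)
  moreover have "tate I w (\<delta> * (C b * prod C A))
      (\<lambda>x. G b x * ((\<Prod>b\<in>A. F b x) - (\<Prod>b\<in>A. G b x)))"
    using tate_mult[OF insert.prems(2) insert.IH w] insert.prems by (simp add: mult_ac)
  ultimately have "tate I w (\<delta> * (C b * prod C A)) (\<lambda>x. (F b x - G b x) * (\<Prod>b\<in>A. F b x) +
      G b x * ((\<Prod>b\<in>A. F b x) - (\<Prod>b\<in>A. G b x)))"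
    using w by (rule tate_add)
  then show ?case
    using insert.hyps by (simp add: algebra_simps)
qed (use \<open>0 \<le> \<delta>\<close> w in \<open>auto intro!: tate_zero simp: less_imp_le\<close>)

lemma tate_mpow:
  assumes "\<And>b. b \<in> A \<Longrightarrow> tate I w (C b) (F b)" "\<And>b. b \<in> I \<Longrightarrow> 0 < w b"
  shows "tate I w (mpow A C \<nu>) (\<lambda>x. mpow A (\<lambda>b. F b x) \<nu>)"
  unfolding mpow_def using assms by (intro tate_prod tate_power)

lemma tate_mpow_diff:
  assumes "\<And>b. b \<in> A \<Longrightarrow> tate I w (C b) (F b)" "\<And>b. b \<in> A \<Longrightarrow> tate I w (C b) (G b)"
    and "\<And>b. b \<in> A \<Longrightarrow> tate I w (\<delta> * C b) (\<lambda>x. F b x - G b x)"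
    and w: "\<And>b. b \<in> I \<Longrightarrow> 0 < w b" and "0 \<le> \<delta>"
  shows "tate I w (\<delta> * mpow A C \<nu>) (\<lambda>x. mpow A (\<lambda>b. F b x) \<nu> - mpow A (\<lambda>b. G b x) \<nu>)"
  unfolding mpow_def
proof (rule tate_prod_diff)
  \<comment> \<open>A power is a product of \<open>\<nu> b\<close> equal factors, so the product
    estimate applies again.\<close>
  show "tate I w (\<delta> * C b ^ \<nu> b) (\<lambda>x. F b x ^ \<nu> b - G b x ^ \<nu> b)" if "b \<in> A" for b
    using tate_prod_diff[of "{..<\<nu> b}" I w "\<lambda>_. C b" "\<lambda>_. F b" "\<lambda>_. G b" \<delta>] assms that by simp
qed (use assms in \<open>auto intro!: tate_power\<close>)

section \<open>Substitution, and the effect of shrinking the radii\<close>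

lemma tate_compose:
  assumes F: "tate A W C F" and H: "\<And>b. b \<in> A \<Longrightarrow> tate I w (W b) (H b)"
    and w: "\<And>b. b \<in> I \<Longrightarrow> 0 < w b"
  shows "tate I w C (\<lambda>x. F (\<lambda>b. H b x))"
proof -
  obtain c where c: "\<forall>\<nu>\<in>midx A. unorm (c \<nu>) * mpow A W \<nu> \<le> C"
     "null_fam (midx A) (\<lambda>\<nu>. unorm (c \<nu>) * mpow A W \<nu>)"
     "\<forall>x. (\<forall>b\<in>A. unorm (x b) \<le> W b) \<longrightarrow>
        ((\<lambda>\<nu>. c \<nu> * mpow A x \<nu>) has_sum F x) (midx A)"
    using F unfolding tate_def by blast
  show ?thesis
  proof (rule tate_has_sum[where J = "midx A"])
    show "tate I w (unorm (c \<nu>) * mpow A W \<nu>) (\<lambda>x. c \<nu> * mpow A (\<lambda>b. H b x) \<nu>)" for \<nu>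
      using H w by (intro tate_cmult tate_mpow)
    show "((\<lambda>\<nu>. c \<nu> * mpow A (\<lambda>b. H b x) \<nu>) has_sum F (\<lambda>b. H b x)) (midx A)"
      if "\<And>b. b \<in> I \<Longrightarrow> unorm (x b) \<le> w b" for x
      by (rule c(3)[rule_format]) (rule tate_bound[OF H that])
  qed (use c w tate_nonneg[OF F] in auto)
qed

text \<open>The source of all Lipschitz estimates. Measuring \<open>H - H'\<close> relative to the
  radii \<open>W\<close> makes every monomial lose the same factor \<delta>, independently of its
  degree, so the Gauss bound of \<open>F\<close> itself plays the part of a Lipschitz
  constant.\<close>

lemma tate_compose_diff:
  assumes F: "tate A W C F" and w: "\<And>b. b \<in> I \<Longrightarrow> 0 < w b" and "0 \<le> \<delta>"
    and H: "\<And>b. b \<in> A \<Longrightarrow> tate I w (W b) (H b)" and H': "\<And>b. b \<in> A \<Longrightarrow> tate I w (W b) (H' b)"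
    and diff: "\<And>b. b \<in> A \<Longrightarrow> tate I w (\<delta> * W b) (\<lambda>x. H b x - H' b x)"
  shows "tate I w (\<delta> * C) (\<lambda>x. F (\<lambda>b. H b x) - F (\<lambda>b. H' b x))"
proof -
  obtain c where c: "\<forall>\<nu>\<in>midx A. unorm (c \<nu>) * mpow A W \<nu> \<le> C"
     "null_fam (midx A) (\<lambda>\<nu>. unorm (c \<nu>) * mpow A W \<nu>)"
     "\<forall>x. (\<forall>b\<in>A. unorm (x b) \<le> W b) \<longrightarrow>
        ((\<lambda>\<nu>. c \<nu> * mpow A x \<nu>) has_sum F x) (midx A)"
    using F unfolding tate_def by blast
  show ?thesis
  proof (rule tate_has_sum[where J = "midx A"])
    show "tate I w (unorm (c \<nu>) * (\<delta> * mpow A W \<nu>))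
        (\<lambda>x. c \<nu> * (mpow A (\<lambda>b. H b x) \<nu> - mpow A (\<lambda>b. H' b x) \<nu>))" for \<nu>
      using assms by (intro tate_cmult tate_mpow_diff)
    show "null_fam (midx A) (\<lambda>\<nu>. unorm (c \<nu>) * (\<delta> * mpow A W \<nu>))"
      using null_fam_cmult[OF c(2) \<open>0 \<le> \<delta>\<close>] by (simp add: mult.left_commute)
    show "unorm (c \<nu>) * (\<delta> * mpow A W \<nu>) \<le> \<delta> * C" if "\<nu> \<in> midx A" for \<nu>
      using c(1) that \<open>0 \<le> \<delta>\<close> mult_left_mono[of "unorm (c \<nu>) * mpow A W \<nu>" C \<delta>]
      by (simp add: mult.left_commute)
    show "0 \<le> \<delta> * C"
      using tate_nonneg[OF F] \<open>0 \<le> \<delta>\<close> by simp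
    show "((\<lambda>\<nu>. c \<nu> * (mpow A (\<lambda>b. H b x) \<nu> - mpow A (\<lambda>b. H' b x) \<nu>)) has_sum
        F (\<lambda>b. H b x) - F (\<lambda>b. H' b x)) (midx A)"
      if x: "\<And>b. b \<in> I \<Longrightarrow> unorm (x b) \<le> w b" for x
    proof -
      have "\<forall>b\<in>A. unorm (H b x) \<le> W b" "\<forall>b\<in>A. unorm (H' b x) \<le> W b"
        by (auto intro: tate_bound[OF H x] tate_bound[OF H' x])
      then have "((\<lambda>\<nu>. c \<nu> * mpow A (\<lambda>b. H b x) \<nu>) has_sum F (\<lambda>b. H b x)) (midx A)"
        and "((\<lambda>\<nu>. c \<nu> * mpow A (\<lambda>b. H' b x) \<nu>) has_sum F (\<lambda>b. H' b x)) (midx A)"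
        by (auto intro: c(3)[THEN spec, THEN mp])
      then have "((\<lambda>\<nu>. c \<nu> * mpow A (\<lambda>b. H b x) \<nu> + - (c \<nu> * mpow A (\<lambda>b. H' b x) \<nu>)) has_sum
        F (\<lambda>b. H b x) + - F (\<lambda>b. H' b x)) (midx A)"
        by (intro has_sum_add) (simp_all add: has_sum_uminus)
      then show ?thesis
        by (simp add: right_diff_distrib)
    qed
  qed (use w in auto)
qed

text \<open>The identity on the polydisc shrunk by \<open>l\<close> is compared with the zero map;
  relative to the original radii their distance is \<open>l\<close>.\<close>

lemma tate_scaled_weights:
  assumes F: "tate I w C F" and "finite I" and w: "\<And>b. b \<in> I \<Longrightarrow> 0 < w b" and l: "0 < l" "l \<le> 1"
  shows "tate I (\<lambda>b. l * w b) (l * C) (\<lambda>x. F x - F (\<lambda>_. 0))"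
proof (rule tate_compose_diff[where H = "\<lambda>b x. x b" and H' = "\<lambda>b x. 0", OF F])
  have v: "tate I (\<lambda>b. l * w b) (l * w b) (\<lambda>x. x b)" if "b \<in> I" for b
    using tate_var[of I b "\<lambda>b. l * w b"] that assms by simp
  then show "tate I (\<lambda>b. l * w b) (w b) (\<lambda>x. x b)" if "b \<in> I" for b
    using tate_mono[OF v[OF that], of "w b"] w[OF that] l by simp
  show "tate I (\<lambda>b. l * w b) (l * w b) (\<lambda>x. x b - 0)" if "b \<in> I" for b
    using v that by simp
qed (use w l in \<open>auto intro!: tate_zero simp: less_imp_le\<close>)

text \<open>A monomial of total degree at least 2 gains the factor \<open>l\<^sup>2\<close> when all
  radii shrink by \<open>l\<close>. The linear coefficients \<open>A\<close> are chosen before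
  \<open>l\<close>, so one linear part serves every scale.\<close>

lemma tate_remainder:
  assumes F: "tate I w C F" and fin: "finite I" and w: "\<And>b. b \<in> I \<Longrightarrow> 0 < w b"
  obtains A where "\<And>l. 0 < l \<Longrightarrow> l \<le> 1 \<Longrightarrow>
    tate I (\<lambda>b. l * w b) (l\<^sup>2 * C) (\<lambda>x. F x - F (\<lambda>_. 0) - (\<Sum>b\<in>I. A b * x b))"
proof -
  obtain c where c: "\<forall>\<nu>\<in>midx I. unorm (c \<nu>) * mpow I w \<nu> \<le> C"
     "null_fam (midx I) (\<lambda>\<nu>. unorm (c \<nu>) * mpow I w \<nu>)"
     "\<forall>x. (\<forall>b\<in>I. unorm (x b) \<le> w b) \<longrightarrow>
        ((\<lambda>\<nu>. c \<nu> * mpow I x \<nu>) has_sum F x) (midx I)"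
    using F unfolding tate_def by blast
  define u :: "'a \<Rightarrow> 'a \<Rightarrow> nat" where "u b = (\<lambda>b'. if b' = b then 1 else 0)" for b
  \<comment> \<open>The exponents of total degree at most 1, whose terms are removed from the
    series.\<close>
  define Z where "Z = insert (\<lambda>_. 0) (u ` I)"
  have finZ: "finite Z"
    using fin by (simp add: Z_def)
  have Z: "Z \<subseteq> midx I"
    by (auto simp: Z_def midx_def u_def)
  have inj: "inj_on u I"
    unfolding inj_on_def u_def fun_eq_iff by (metis zero_neq_one)
  have u0: "(\<lambda>_. 0) \<notin> u ` I"
    unfolding u_def fun_eq_iff image_iff by (metis zero_neq_one)
  have mu: "mpow I x (u b) = x b" if "b \<in> I" for b and x :: "'a \<Rightarrow> 'c::comm_monoid_mult"
    using that fin unfolding u_def by (simp add: mpow_unit)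
  have sumZ: "(\<Sum>\<nu>\<in>Z. c \<nu> * mpow I x \<nu>) = c (\<lambda>_. 0) + (\<Sum>b\<in>I. c (u b) * x b)" for x
    using fin u0 unfolding Z_def by (simp add: sum.reindex[OF inj] mu)
  define d where "d \<nu> = (if \<nu> \<in> Z then 0 else c \<nu>)" for \<nu>
  have rem: "((\<lambda>\<nu>. d \<nu> * mpow I x \<nu>) has_sum F x - (c (\<lambda>_. 0) + (\<Sum>b\<in>I. c (u b) * x b))) (midx I)"
    if "\<forall>b\<in>I. unorm (x b) \<le> w b" for x
  proof -
    have "((\<lambda>\<nu>. c \<nu> * mpow I x \<nu>) has_sum F x - (c (\<lambda>_. 0) + (\<Sum>b\<in>I. c (u b) * x b))) (midx I - Z)"
      using c(3) that finZ Z sumZ by (intro has_sum_Diff[OF _ has_sum_finiteI]) auto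
    then show ?thesis
      by (rule has_sum_cong_neutral[THEN iffD1, rotated -1]) (auto simp: d_def)
  qed
  have F0: "F (\<lambda>_. 0) = c (\<lambda>_. 0)"
  proof -
    have "((\<lambda>\<nu>. c \<nu> * mpow I (\<lambda>_. 0) \<nu>) has_sum F (\<lambda>_. 0)) (midx I)"
      using c(3) w by (simp add: less_imp_le)
    moreover have "((\<lambda>\<nu>. c \<nu> * mpow I (\<lambda>_. 0) \<nu>) has_sum c (\<lambda>_. 0)) (midx I)"
    proof -
      have "((\<lambda>\<nu>. c \<nu> * mpow I (\<lambda>_. 0) \<nu>) has_sum c (\<lambda>_. 0)) {\<lambda>_. 0}"
        by (rule has_sum_finiteI) auto
      moreover have "mpow I (\<lambda>_. 0::'b) \<nu> = 0" if "\<nu> \<in> midx I" "\<nu> \<noteq> (\<lambda>_. 0)" for \<nu>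
      proof -
        obtain b where b: "\<nu> b \<noteq> 0" "b \<in> I"
          using \<open>\<nu> \<noteq> (\<lambda>_. 0)\<close> \<open>\<nu> \<in> midx I\<close> unfolding midx_def fun_eq_iff by blast
        then show ?thesis
          unfolding mpow_def using fin by (intro prod_zero) (auto intro!: bexI[of _ b])
      qed
      ultimately show ?thesis
        by (subst has_sum_cong_neutral[where T = "{\<lambda>_. 0}" and g = "\<lambda>\<nu>. c \<nu> * mpow I (\<lambda>_. 0) \<nu>"])
           (auto simp: midx_def)
    qed
    ultimately show ?thesis
      by (rule has_sum_unique)
  qed
  have wp: "0 < mpow I w \<nu>" for \<nu>
    using w by (rule mpow_pos)
  show thesis
  proof (rule that[of "\<lambda>b. c (u b)"])
    fix l :: real assume l: "0 < l" "l \<le> 1"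
    have le: "unorm (d \<nu>) * mpow I (\<lambda>b. l * w b) \<nu> \<le> l\<^sup>2 * (unorm (c \<nu>) * mpow I w \<nu>)"
      if \<nu>: "\<nu> \<in> midx I" for \<nu>
    proof (cases "\<nu> \<in> Z")
      case True
      then show ?thesis
        using wp[of \<nu>] by (simp add: d_def)
    next
      case False
      have "2 \<le> (\<Sum>b\<in>I. \<nu> b)"
      proof (rule ccontr)
        assume "\<not> 2 \<le> (\<Sum>b\<in>I. \<nu> b)"
        then consider "(\<Sum>b\<in>I. \<nu> b) = 0" | "(\<Sum>b\<in>I. \<nu> b) = Suc 0"
          by linarith
        then show False
        proof cases
          case 1
          then have "\<nu> = (\<lambda>_. 0)"
            using fin \<nu> by (auto simp: midx_def fun_eq_iff)
          with False show False by (simp add: Z_def)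
        next
          case 2
          then obtain b where "b \<in> I" "\<nu> b = Suc 0" "\<forall>b'\<in>I. b \<noteq> b' \<longrightarrow> \<nu> b' = 0"
            using sum_eq_Suc0_iff[OF fin] by metis
          then have "\<nu> = u b"
            using \<nu> by (auto simp: midx_def fun_eq_iff u_def)
          with False \<open>b \<in> I\<close> show False by (simp add: Z_def)
        qed
      qed
      then have "l ^ (\<Sum>b\<in>I. \<nu> b) \<le> l\<^sup>2"
        using l by (intro power_decreasing) auto
      moreover have "mpow I (\<lambda>b. l * w b) \<nu> = l ^ (\<Sum>b\<in>I. \<nu> b) * mpow I w \<nu>"
        by (simp add: mpow_def power_mult_distrib prod.distrib power_sum)
      ultimately have "mpow I (\<lambda>b. l * w b) \<nu> \<le> l\<^sup>2 * mpow I w \<nu>"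
        using wp[of \<nu>] by (simp add: mult_right_mono)
      then show ?thesis
        using False mult_left_mono[OF _ unorm_nonneg[of "c \<nu>"]]
        by (fastforce simp: d_def mult.left_commute)
    qed
    show "tate I (\<lambda>b. l * w b) (l\<^sup>2 * C) (\<lambda>x. F x - F (\<lambda>_. 0) - (\<Sum>b\<in>I. c (u b) * x b))"
      unfolding tate_def
    proof (intro exI[of _ d] conjI allI impI ballI)
      show "unorm (d \<nu>) * mpow I (\<lambda>b. l * w b) \<nu> \<le> l\<^sup>2 * C" if "\<nu> \<in> midx I" for \<nu>
        using le[OF that] mult_left_mono[of "unorm (c \<nu>) * mpow I w \<nu>" C "l\<^sup>2"] c(1) that
        by fastforce
      show "null_fam (midx I) (\<lambda>\<nu>. unorm (d \<nu>) * mpow I (\<lambda>b. l * w b) \<nu>)"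
        using null_fam_cmult[OF c(2), of "l\<^sup>2"] le by (rule null_fam_mono) auto
      show "((\<lambda>\<nu>. d \<nu> * mpow I x \<nu>) has_sum F x - F (\<lambda>_. 0) - (\<Sum>b\<in>I. c (u b) * x b)) (midx I)"
        if x: "\<forall>b\<in>I. unorm (x b) \<le> l * w b" for x
      proof -
        have "l * w b \<le> w b" if "b \<in> I" for b
          using w[OF that] l by simp
        then show ?thesis
          using rem[of x] x F0 by (fastforce simp: diff_diff_eq intro: order_trans)
      qed
    qed
  qed
qed

subsection \<open>Ultrametric norms on finite-dimensional spaces\<close>

context ultrametric_space
begin

text \<open>\<open>topology_norm\<close> without the clause on the topology. In finite dimension any
  two such norms are equivalent, so the estimates need the algebraic axioms only.\<close>

definition ultra_norm :: "('e \<Rightarrow> real) \<Rightarrow> bool" where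
  "ultra_norm N \<longleftrightarrow> (\<forall>x. 0 \<le> N x) \<and> (\<forall>x. N x = 0 \<longleftrightarrow> x = 0) \<and>
     (\<forall>c x. N (scale c x) = unorm c * N x) \<and> (\<forall>x y. N (x + y) \<le> max (N x) (N y))"

lemma ultra_norm_unorm: "ultra_norm unorm"
  by (simp add: ultra_norm_def unorm_scale unorm_add_le_max)

lemma topology_norm_imp_ultra_norm: "topology_norm N \<Longrightarrow> ultra_norm N"
  by (simp add: topology_norm_def ultra_norm_def)

lemma topology_norm_unorm: "topology_norm unorm"
  by (auto simp: topology_norm_def unorm_scale unorm_add_le_max open_dist dist_unorm)

context
  fixes N assumes N: "ultra_norm N"
begin

lemma ultra_norm_nonneg: "0 \<le> N x" and ultra_norm_eq_0: "N x = 0 \<longleftrightarrow> x = 0"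
  and ultra_norm_scale: "N (scale c x) = unorm c * N x"
  and ultra_norm_add_max: "N (x + y) \<le> max (N x) (N y)"
  using N by (auto simp: ultra_norm_def)

lemma ultra_norm_minus: "N (- x) = N x"
proof -
  have "- x = scale (-1) x"
    by simp
  then show ?thesis
    by (simp only: ultra_norm_scale unorm_minus unorm_one mult_1)
qed

lemma ultra_norm_add: "N x \<le> C \<Longrightarrow> N y \<le> C \<Longrightarrow> N (x + y) \<le> C"
  using ultra_norm_add_max[of x y] by linarith

lemma ultra_norm_diff: "N x \<le> C \<Longrightarrow> N y \<le> C \<Longrightarrow> N (x - y) \<le> C"
  using ultra_norm_add[of x C "- y"] by (simp add: ultra_norm_minus)

lemma ultra_norm_sum:
  assumes "\<And>i. i \<in> A \<Longrightarrow> N (f i) \<le> C" "0 \<le> C"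
  shows "N (sum f A) \<le> C"
  using assms
  by (induction A rule: infinite_finite_induct) (auto intro: ultra_norm_add simp: ultra_norm_eq_0[THEN iffD2])

text \<open>Coordinates are bounded with respect to any norm, because the field is complete. The
  induction rests on the new vector having positive distance from the span of the others: otherwise
  the coefficients of approximating combinations would be Cauchy, and their limits would place it in
  that span.\<close>

lemma coefficients_bounded:
  assumes "finite S" "independent S"
  shows "\<exists>C>0. \<forall>u. \<forall>b\<in>S. unorm (u b) \<le> C * N (\<Sum>b\<in>S. scale (u b) b)"
  using assms
proof (induction S rule: finite_induct)
  case empty
  then show ?case by (auto intro: exI[of _ 1])
next
  case (insert b S)
  have b: "b \<notin> span S" and "independent S"
    using insert.prems insert.hyps by (auto simp: independent_insert)
  then obtain C where "C > 0" and C: "\<And>u b. b \<in> S \<Longrightarrow> unorm (u b) \<le> C * N (\<Sum>b\<in>S. scale (u b) b)"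
    using insert.IH by blast
  \<comment> \<open>\<open>d\<close> is a lower bound for the distance from \<open>b\<close> to the
    span of \<open>S\<close>.\<close>
  have "\<exists>d>0. \<forall>u. d \<le> N (b + (\<Sum>b\<in>S. scale (u b) b))"
  proof (rule ccontr)
    assume "\<not> ?thesis"
    then have "\<forall>n. \<exists>u. N (b + (\<Sum>b\<in>S. scale (u b) b)) < inverse (real (Suc n))"
      by (meson not_le inverse_positive_iff_positive of_nat_0_less_iff zero_less_Suc)
    then obtain u where u: "\<And>n. N (b + (\<Sum>b\<in>S. scale (u n b) b)) < inverse (real (Suc n))"
      by metis
    have "Cauchy (\<lambda>n. u n b')" if "b' \<in> S" for b'
    proof (rule metric_CauchyI)
      fix e :: real assume "e > 0"
      then obtain n0 where n0: "inverse (real (Suc n0)) < e / C"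
        using reals_Archimedean \<open>C > 0\<close> divide_pos_pos by blast
      have "dist (u m b') (u n b') < e" if "m \<ge> n0" "n \<ge> n0" for m n
      proof -
        have le: "N (b + (\<Sum>b\<in>S. scale (u k b) b)) \<le> inverse (real (Suc n0))" if "k \<ge> n0" for k
        proof -
          have "inverse (real (Suc k)) \<le> inverse (real (Suc n0))"
            using that by (intro le_imp_inverse_le) auto
          then show ?thesis
            using u[of k] by linarith
        qed
        have "(\<Sum>b\<in>S. scale (u m b - u n b) b) =
            (b + (\<Sum>b\<in>S. scale (u m b) b)) - (b + (\<Sum>b\<in>S. scale (u n b) b))"
          by (simp add: scale_left_diff_distrib sum_subtractf)
        then have "N (\<Sum>b\<in>S. scale (u m b - u n b) b) \<le> inverse (real (Suc n0))"
          using ultra_norm_diff[OF le[OF that(1)] le[OF that(2)]] by simp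
        then have "unorm (u m b' - u n b') \<le> C * inverse (real (Suc n0))"
          using C[OF \<open>b' \<in> S\<close>, of "\<lambda>b. u m b - u n b"] \<open>C > 0\<close>
          by (meson mult_left_mono less_imp_le order_trans)
        also have "\<dots> < C * (e / C)"
          using n0 \<open>C > 0\<close> by (intro mult_strict_left_mono)
        finally show ?thesis
          using \<open>C > 0\<close> by (simp add: dist_unorm)
      qed
      then show "\<exists>M. \<forall>m\<ge>M. \<forall>n\<ge>M. dist (u m b') (u n b') < e" by blast
    qed
    then have "\<forall>b'. \<exists>l. b' \<in> S \<longrightarrow> (\<lambda>n. u n b') \<longlonglongrightarrow> l"
      using Cauchy_convergent convergent_def by blast
    from choice[OF this] obtain v where v: "\<And>b'. b' \<in> S \<Longrightarrow> (\<lambda>n. u n b') \<longlonglongrightarrow> v b'"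
      by blast
    have "N (b + (\<Sum>b\<in>S. scale (v b) b)) \<le> e" if "e > 0" for e
    proof -
      have "eventually (\<lambda>n. unorm (v b' - u n b') * N b' \<le> e) sequentially" if "b' \<in> S" for b'
      proof -
        have pos: "0 < N b' + 1"
          using ultra_norm_nonneg[of b'] by linarith
        then have "eventually (\<lambda>n. dist (u n b') (v b') < e / (N b' + 1)) sequentially"
          using v[OF that] \<open>e > 0\<close> by (auto simp: tendsto_iff)
        then show ?thesis
        proof (rule eventually_mono)
          fix n assume "dist (u n b') (v b') < e / (N b' + 1)"
          then have "unorm (v b' - u n b') * (N b' + 1) \<le> e"
            using pos by (simp add: dist_unorm unorm_minus_commute field_simps)
          then show "unorm (v b' - u n b') * N b' \<le> e"
            using unorm_nonneg[of "v b' - u n b'"] unfolding distrib_left by linarith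
        qed
      qed
      then have "eventually (\<lambda>n. \<forall>b'\<in>S. unorm (v b' - u n b') * N b' \<le> e) sequentially"
        using insert.hyps(1) by (simp add: eventually_ball_finite)
      moreover have "eventually (\<lambda>n. inverse (real (Suc n)) < e) sequentially"
        using LIMSEQ_inverse_real_of_nat \<open>e > 0\<close> by (metis order_tendstoD(2))
      ultimately have "eventually (\<lambda>n. (\<forall>b'\<in>S. unorm (v b' - u n b') * N b' \<le> e) \<and>
          inverse (real (Suc n)) < e) sequentially"
        by (rule eventually_conj)
      from eventually_happens'[OF sequentially_bot this]
      obtain n where n: "\<And>b'. b' \<in> S \<Longrightarrow> unorm (v b' - u n b') * N b' \<le> e"
        "inverse (real (Suc n)) < e"
        by blast
      have "N (\<Sum>b\<in>S. scale (v b - u n b) b) \<le> e"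
        using n(1) \<open>e > 0\<close> by (intro ultra_norm_sum) (auto simp: ultra_norm_scale)
      moreover have "N (b + (\<Sum>b\<in>S. scale (u n b) b)) \<le> e"
        using u[of n] n(2) by linarith
      moreover have "b + (\<Sum>b\<in>S. scale (v b) b) =
          (b + (\<Sum>b\<in>S. scale (u n b) b)) + (\<Sum>b\<in>S. scale (v b - u n b) b)"
        by (simp add: scale_left_diff_distrib sum_subtractf)
      ultimately show ?thesis
        by (simp only: ultra_norm_add)
    qed
    then have "N (b + (\<Sum>b\<in>S. scale (v b) b)) \<le> 0"
      by (rule dense_ge)
    then have "N (b + (\<Sum>b\<in>S. scale (v b) b)) = 0"
      using ultra_norm_nonneg by (rule antisym)
    then have "b = - (\<Sum>b\<in>S. scale (v b) b)"
      by (simp add: ultra_norm_eq_0 eq_neg_iff_add_eq_0)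
    then have "b \<in> span S"
      by (rule ssubst) (intro span_neg span_sum span_scale span_base)
    with b show False by blast
  qed
  then obtain d where "d > 0" and d: "\<And>u. d \<le> N (b + (\<Sum>b\<in>S. scale (u b) b))"
    by blast
  show ?case
  \<comment> \<open>The coefficient of \<open>b\<close> is at most \<open>N x / d\<close>; removing
    its term leaves a vector of norm at most \<open>N x * (1 + N b / d)\<close>, to which the
    induction hypothesis applies. The constant adds both bounds.\<close>
  proof (intro exI[of _ "1 / d + C * (1 + N b / d)"] conjI allI ballI)
    have nb: "0 \<le> N b / d"
      using ultra_norm_nonneg \<open>d > 0\<close> by simp
    show "0 < 1 / d + C * (1 + N b / d)"
      using \<open>d > 0\<close> \<open>C > 0\<close> nb by (simp add: add_pos_nonneg)
    fix u b' assume b': "b' \<in> insert b S"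
    define x where "x = (\<Sum>b\<in>insert b S. scale (u b) b)"
    define y where "y = (\<Sum>b\<in>S. scale (u b) b)"
    have xy: "x = scale (u b) b + y"
      using insert.hyps by (simp add: x_def y_def)
    have ub: "unorm (u b) \<le> N x / d"
    proof (cases "u b = 0")
      case False
      have "x = scale (u b) (b + (\<Sum>b'\<in>S. scale (u b' / u b) b'))"
        using False by (simp add: xy y_def scale_right_distrib scale_sum_right)
      then have "unorm (u b) * d \<le> N x"
        using d[of "\<lambda>b'. u b' / u b"] by (simp add: ultra_norm_scale mult_left_mono)
      then show ?thesis
        using \<open>d > 0\<close> by (simp add: field_simps)
    qed (use \<open>d > 0\<close> ultra_norm_nonneg in simp)
    have "N y \<le> N x * (1 + N b / d)"
    proof -
      have y: "y = x - scale (u b) b"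
        by (simp add: xy)
      have "N x * 1 \<le> N x * (1 + N b / d)"
        using nb ultra_norm_nonneg by (intro mult_left_mono) auto
      moreover have "unorm (u b) * N b \<le> N x / d * N b"
        using ub ultra_norm_nonneg by (intro mult_right_mono)
      then have "unorm (u b) * N b \<le> N x * (1 + N b / d)"
        using ultra_norm_nonneg[of x] by (simp add: distrib_left)
      ultimately show ?thesis
        unfolding y by (intro ultra_norm_diff) (auto simp: ultra_norm_scale)
    qed
    then have Cy: "C * N y \<le> C * (1 + N b / d) * N x"
      using \<open>C > 0\<close> by (simp add: mult_ac)
    show "unorm (u b') \<le> (1 / d + C * (1 + N b / d)) * N x"
    proof (cases "b' = b")
      case True
      have "0 \<le> C * (1 + N b / d) * N x"
        using nb \<open>C > 0\<close> ultra_norm_nonneg by (intro mult_nonneg_nonneg) auto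
      then show ?thesis
        using ub True by (simp add: distrib_right)
    next
      case False
      then have "unorm (u b') \<le> C * N y"
        using b' C[of b' u] by (simp add: y_def)
      moreover have "0 \<le> 1 / d * N x"
        using \<open>d > 0\<close> ultra_norm_nonneg by simp
      ultimately show ?thesis
        using Cy by (simp add: distrib_right)
    qed
  qed
qed

text \<open>A substitute for Gram-Schmidt. A nearest point of a subspace need not exist, so the new
  vector is corrected only until its norm is within a factor \<open>1 / s\<close> of its distance
  from the span.\<close>

lemma almost_orthogonal_basis_span:
  assumes "finite B" "independent B" "0 < t" "t < 1"
  shows "\<exists>S. finite S \<and> 0 \<notin> S \<and> span S = span B \<and>
    (\<forall>u. \<forall>b\<in>S. t * (unorm (u b) * N b) \<le> N (\<Sum>b\<in>S. scale (u b) b))"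
  using assms
proof (induction B arbitrary: t rule: finite_induct)
  case empty
  then show ?case by (intro exI[of _ "{}"]) auto
next
  case (insert b B)
  \<comment> \<open>One factor \<open>s\<close> is lost in the induction hypothesis and one in
    adjoining the new vector; together they give \<open>t\<close>.\<close>
  define s where "s = sqrt t"
  have s: "0 < s" "s < 1" "s * s = t"
    using insert.prems by (auto simp: s_def real_sqrt_lt_1_iff)
  have b: "b \<notin> span B" and "independent B"
    using insert.prems insert.hyps by (auto simp: independent_insert)
  then obtain S where S: "finite S" "0 \<notin> S" "span S = span B"
    "\<And>u b. b \<in> S \<Longrightarrow> s * (unorm (u b) * N b) \<le> N (\<Sum>b\<in>S. scale (u b) b)"
    using insert.IH[OF _ s(1,2)] by blast
  obtain C where "C > 0"
    and C: "\<And>u b'. b' \<in> insert b B \<Longrightarrow> unorm (u b') \<le> C * N (\<Sum>b\<in>insert b B. scale (u b) b)"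
    using coefficients_bounded[of "insert b B"] insert.hyps insert.prems by blast
  define d where "d = (INF f\<in>span B. N (b + f))"
  have bdd: "bdd_below ((\<lambda>f. N (b + f)) ` span B)"
    by (rule bdd_belowI[of _ 0]) (use ultra_norm_nonneg in auto)
  have "1 / C \<le> N (b + f)" if "f \<in> span B" for f
  proof -
    obtain u where "f = (\<Sum>a\<in>B. scale (u a) a)"
      using \<open>f \<in> span B\<close> insert.hyps(1) by (auto simp: span_finite)
    then have "b + f = (\<Sum>a\<in>insert b B. scale ((u(b := 1)) a) a)"
      using insert.hyps by (simp add: sum.insert) (intro sum.cong, auto)
    then show ?thesis
      using C[of b "u(b := 1)"] \<open>C > 0\<close> by (simp add: field_simps)
  qed
  then have "1 / C \<le> d"
    unfolding d_def by (intro cINF_greatest) (use span_zero in auto)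
  moreover have "0 < 1 / C"
    using \<open>C > 0\<close> by simp
  ultimately have "d > 0" by linarith
  then have "d < d / s"
    using s by (simp add: field_simps)
  \<comment> \<open>The distance is positive and \<open>s < 1\<close>, so an almost minimising
    \<open>f\<close> exists even if the infimum is not attained.\<close>
  then obtain f where f: "f \<in> span B" "N (b + f) < d / s"
    unfolding d_def using bdd span_zero by (subst (asm) cINF_less_iff) auto
  define v where "v = b + f"
  have v: "v \<notin> span S"
    using b f(1) S(3) span_diff[of v B f] by (auto simp: v_def)
  have d_le: "d \<le> N (v + g)" if "g \<in> span B" for g
  proof -
    have "d \<le> N (b + (f + g))"
      unfolding d_def using bdd f(1) that by (intro cINF_lower) (auto intro: span_add)
    then show ?thesis by (simp add: v_def add.assoc)
  qed
  show ?case
  proof (intro exI[of _ "insert v S"] conjI allI ballI)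
    show "finite (insert v S)"
      using S by simp
    show "0 \<notin> insert v S"
      using S v span_zero by auto
    show "span (insert v S) = span (insert b B)"
    proof (rule equalityI; rule span_minimal[OF _ subspace_span])
      have "S \<subseteq> span (insert b B)"
        using S(3) span_superset[of S] span_mono[of B "insert b B"] by auto
      moreover have "v \<in> span (insert b B)"
        unfolding v_def using f(1) span_mono[of B "insert b B"]
        by (intro span_add) (auto intro: span_base)
      ultimately show "insert v S \<subseteq> span (insert b B)" by blast
      have B: "span B \<subseteq> span (insert v S)"
        using S(3) span_mono[of S "insert v S"] by auto
      then have "B \<subseteq> span (insert v S)"
        using span_superset by blast
      moreover have "v - f \<in> span (insert v S)"
        using f(1) B by (intro span_diff) (auto intro: span_base)
      ultimately show "insert b B \<subseteq> span (insert v S)"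
        by (simp add: v_def)
    qed
    fix u a assume a: "a \<in> insert v S"
    have vS: "v \<notin> S"
      using v span_base by blast
    define x where "x = (\<Sum>b\<in>insert v S. scale (u b) b)"
    define y where "y = (\<Sum>b\<in>S. scale (u b) b)"
    have xy: "x = scale (u v) v + y"
      using S vS by (simp add: x_def y_def)
    have yB: "y \<in> span B"
      unfolding y_def S(3)[symmetric] by (intro span_sum span_scale span_base)
    have uv: "s * (unorm (u v) * N v) \<le> N x"
    proof (cases "u v = 0")
      case False
      have "x = scale (u v) (v + scale (inverse (u v)) y)"
        using False by (simp add: xy scale_right_distrib)
      then have "unorm (u v) * d \<le> N x"
        using d_le[OF span_scale[OF yB, of "inverse (u v)"]] by (simp add: ultra_norm_scale mult_left_mono)
      moreover have "s * N v \<le> d"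
        using f(2) s(1) by (simp add: v_def field_simps)
      then have "unorm (u v) * (s * N v) \<le> unorm (u v) * d"
        by (intro mult_left_mono) auto
      ultimately show ?thesis
        by (simp add: mult_ac)
    qed (use ultra_norm_nonneg in simp)
    \<comment> \<open>Removing the \<open>v\<close>-component from \<open>x\<close> can enlarge the
      norm only by the factor \<open>1 / s\<close>, since that component is already
      controlled.\<close>
    have "s * N y \<le> N x"
    proof -
      have y: "y = x - scale (u v) v"
        by (simp add: xy)
      have "s * N x \<le> 1 * N x"
        using s ultra_norm_nonneg by (intro mult_right_mono) auto
      then have "N x \<le> N x / s" "unorm (u v) * N v \<le> N x / s"
        using uv s by (auto simp: field_simps)
      then have "N y \<le> N x / s"
        unfolding y by (intro ultra_norm_diff) (auto simp: ultra_norm_scale)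
      then show ?thesis
        using s by (simp add: field_simps)
    qed
    show "t * (unorm (u a) * N a) \<le> N x"
    proof (cases "a = v")
      case True
      have "t \<le> s"
        using s mult_left_mono[of s 1 s] by simp
      then have "t * (unorm (u a) * N a) \<le> s * (unorm (u a) * N a)"
        using ultra_norm_nonneg by (intro mult_right_mono) auto
      then show ?thesis
        using uv True by simp
    next
      case False
      then have "s * (unorm (u a) * N a) \<le> N y"
        using S(4)[of a u] a by (simp add: y_def)
      then have "s * (s * (unorm (u a) * N a)) \<le> s * N y"
        using s by (intro mult_left_mono) auto
      then show ?thesis
        using \<open>s * N y \<le> N x\<close> s(3) by (simp add: mult.assoc[symmetric])
    qed
  qed
qed

text \<open>Independence follows from the inequality itself: if the combination vanishes, each
  \<open>unorm (u b) * N b\<close> is 0, and \<open>N b > 0\<close> because 0 is not in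
  \<open>S\<close>.\<close>

lemma almost_orthogonal_basis:
  assumes "subspace F" "0 < t" "t < 1"
  obtains S where "finite S" "independent S" "span S = F"
    "\<And>u b. b \<in> S \<Longrightarrow> t * (unorm (u b) * N b) \<le> N (\<Sum>b\<in>S. scale (u b) b)"
proof -
  obtain B where B: "B \<subseteq> F" "independent B" "F \<subseteq> span B"
    using basis_exists[of F] by metis
  then have "span B = F"
    using span_minimal[OF B(1) assms(1)] by blast
  moreover have "finite B"
    using B(2) finiteI_independent by blast
  ultimately obtain S where S: "finite S" "0 \<notin> S" "span S = F"
    "\<And>u b. b \<in> S \<Longrightarrow> t * (unorm (u b) * N b) \<le> N (\<Sum>b\<in>S. scale (u b) b)"
    using almost_orthogonal_basis_span[of B t] B assms by metis
  have "independent S"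
    unfolding independent_explicit_finite_subsets
  proof safe
    fix A u v assume A: "A \<subseteq> S" "finite A" "(\<Sum>v\<in>A. scale (u v) v) = 0" "v \<in> A"
    define u' where "u' b = (if b \<in> A then u b else 0)" for b
    have "(\<Sum>b\<in>S. scale (u' b) b) = (\<Sum>b\<in>A. scale (u b) b)"
      using A S(1) by (intro sum.mono_neutral_cong_right) (auto simp: u'_def)
    then have "t * (unorm (u' v) * N v) \<le> 0"
      using S(4)[of v u'] A ultra_norm_eq_0[of 0] by auto
    moreover have "0 < N v"
      using A S(2) ultra_norm_nonneg[of v] ultra_norm_eq_0[of v] by fastforce
    ultimately have "unorm (u' v) \<le> 0"
      using \<open>0 < t\<close> by (simp add: mult_le_0_iff)
    then have "unorm (u' v) = 0"
      using unorm_nonneg[of "u' v"] by linarith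
    then show "u v = 0"
      using A by (simp add: u'_def)
  qed
  then show thesis
    using that S by blast
qed

end

text \<open>Linearity is required on \<open>F\<close> only, because the inverse of \<alpha> on the
  unstable subspace, given by \<open>the_inv_into\<close>, is meaningful only there.\<close>

lemma linear_on_subspace_sum:
  assumes F: "subspace F" and add: "\<And>x y. x \<in> F \<Longrightarrow> y \<in> F \<Longrightarrow> g (x + y) = g x + g y"
    and hom: "\<And>c x. x \<in> F \<Longrightarrow> g (scale c x) = scale c (g x)" and v: "\<And>k. k \<in> I \<Longrightarrow> v k \<in> F"
  shows "g (\<Sum>k\<in>I. scale (u k) (v k)) = (\<Sum>k\<in>I. scale (u k) (g (v k)))"
proof -
  have "g 0 = 0"
    using hom[of 0 0] F subspace_0 by simp
  then show ?thesis
    using v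
  proof (induction I rule: infinite_finite_induct)
    case (insert k I)
    then have "(\<Sum>k\<in>I. scale (u k) (v k)) \<in> F" "scale (u k) (v k) \<in> F"
      using F by (auto intro!: subspace_sum subspace_scale)
    then show ?case
      using insert add hom by simp
  qed auto
qed

lemma linear_on_subspace_bounded:
  assumes F: "subspace F" and add: "\<And>x y. x \<in> F \<Longrightarrow> y \<in> F \<Longrightarrow> g (x + y) = g x + g y"
    and hom: "\<And>c x. x \<in> F \<Longrightarrow> g (scale c x) = scale c (g x)"
    and N: "ultra_norm N" and N': "ultra_norm N'"
  obtains C where "C > 0" "\<And>x. x \<in> F \<Longrightarrow> N' (g x) \<le> C * N x"
proof -
  obtain B where B: "B \<subseteq> F" "independent B" "F \<subseteq> span B"
    using basis_exists[of F] by metis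
  have fin: "finite B"
    using B(2) finiteI_independent by blast
  obtain C where "C > 0" and C: "\<And>u b. b \<in> B \<Longrightarrow> unorm (u b) \<le> C * N (\<Sum>b\<in>B. scale (u b) b)"
    using coefficients_bounded[OF N fin B(2)] by blast
  define K where "K = C * (1 + (\<Sum>b\<in>B. N' (g b)))"
  have sum_nonneg': "0 \<le> (\<Sum>b\<in>B. N' (g b))"
    by (intro sum_nonneg ultra_norm_nonneg[OF N'])
  show thesis
  proof (rule that)
    show "K > 0"
      unfolding K_def using \<open>C > 0\<close> sum_nonneg' by (intro mult_pos_pos) auto
    fix x assume "x \<in> F"
    then obtain u where x: "x = (\<Sum>b\<in>B. scale (u b) b)"
      using B(3) fin span_finite by auto
    have "g x = (\<Sum>b\<in>B. scale (u b) (g b))"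
      unfolding x using B(1) by (intro linear_on_subspace_sum[OF F add hom]) auto
    moreover have "N' (\<Sum>b\<in>B. scale (u b) (g b)) \<le> K * N x"
    proof (rule ultra_norm_sum[OF N'])
      show "0 \<le> K * N x"
        using \<open>K > 0\<close> ultra_norm_nonneg[OF N] by simp
      fix b assume b: "b \<in> B"
      have "N' (g b) \<le> (\<Sum>b\<in>B. N' (g b))"
        using fin b ultra_norm_nonneg[OF N'] by (intro member_le_sum) auto
      then have "N' (g b) \<le> 1 + (\<Sum>b\<in>B. N' (g b))" by linarith
      moreover have "unorm (u b) \<le> C * N x"
        using C[OF b, of u] x by simp
      ultimately have "unorm (u b) * N' (g b) \<le> (C * N x) * (1 + (\<Sum>b\<in>B. N' (g b)))"
        using ultra_norm_nonneg[OF N'] \<open>C > 0\<close> ultra_norm_nonneg[OF N]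
        by (intro mult_mono) (auto intro: mult_nonneg_nonneg less_imp_le)
      then show "N' (scale (u b) (g b)) \<le> K * N x"
        by (simp add: ultra_norm_scale[OF N'] K_def mult_ac)
    qed
    ultimately show "N' (g x) \<le> K * N x" by simp
  qed
qed

lemma ultra_norms_equivalent:
  assumes "ultra_norm N" "ultra_norm N'"
  obtains C where "C > 0" "\<And>x. N' x \<le> C * N x"
  using linear_on_subspace_bounded[of UNIV "\<lambda>x. x" N N'] assms by auto

section \<open>Coordinates with respect to the fixed basis\<close>

abbreviation crd :: "'e \<Rightarrow> 'e \<Rightarrow> 'k" where
  "crd \<equiv> representation Basis"

definition of_crd :: "('e \<Rightarrow> 'k) \<Rightarrow> 'e" where
  "of_crd z = (\<Sum>b\<in>Basis. scale (z b) b)"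

lemma crd_add: "crd (x + y) b = crd x b + crd y b"
  and crd_diff: "crd (x - y) b = crd x b - crd y b"
  and crd_minus: "crd (- x) b = - crd x b"
  and crd_zero [simp]: "crd 0 b = 0"
  and crd_scale: "crd (scale c x) b = c * crd x b"
  using independent_Basis span_Basis
  by (simp_all add: representation_add representation_diff representation_neg
      representation_scale representation_zero)

lemma crd_sum: "crd (sum f A) b = (\<Sum>i\<in>A. crd (f i) b)"
  by (induction A rule: infinite_finite_induct) (auto simp: crd_add)

lemma crd_basis: "b' \<in> Basis \<Longrightarrow> crd b' b = (if b = b' then 1 else 0)"
  using representation_basis[OF independent_Basis] by auto

lemma of_crd_crd [simp]: "of_crd (crd x) = x"
  unfolding of_crd_def
  using sum_representation_eq[OF independent_Basis, of x Basis] finite_Basis span_Basis by auto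

lemma crd_of_crd [simp]:
  assumes "b \<in> Basis" shows "crd (of_crd z) b = z b"
proof -
  have "crd (of_crd z) b = (\<Sum>b'\<in>Basis. if b = b' then z b' else 0)"
    unfolding of_crd_def crd_sum by (intro sum.cong) (auto simp: crd_scale crd_basis)
  then show ?thesis
    using finite_Basis assms by simp
qed

lemma of_crd_cong: "(\<And>b. b \<in> Basis \<Longrightarrow> z b = z' b) \<Longrightarrow> of_crd z = of_crd z'"
  by (simp add: of_crd_def)

lemma crd_eqI: "(\<And>b. b \<in> Basis \<Longrightarrow> crd x b = crd y b) \<Longrightarrow> x = y"
  using of_crd_cong[of "crd x" "crd y"] by simp

lemma of_crd_add: "of_crd (\<lambda>b. y b + z b) = of_crd y + of_crd z"
  by (simp add: of_crd_def scale_left_distrib sum.distrib)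

lemma crd_bounded:
  obtains C where "C > 0" "\<And>x b. b \<in> Basis \<Longrightarrow> unorm (crd x b) \<le> C * unorm x"
proof -
  obtain C where C: "C > 0"
    "\<And>u b. b \<in> Basis \<Longrightarrow> unorm (u b) \<le> C * unorm (\<Sum>b\<in>Basis. scale (u b) b)"
    using coefficients_bounded[OF ultra_norm_unorm finite_Basis independent_Basis] by blast
  have "unorm (crd x b) \<le> C * unorm x" if "b \<in> Basis" for x b
    using C(2)[OF that, of "crd x"] of_crd_crd[of x] by (simp add: of_crd_def)
  with C(1) show thesis by (rule that)
qed

lemma unorm_le_crd:
  obtains C where "C > 0"
    "\<And>x M. 0 \<le> M \<Longrightarrow> (\<And>b. b \<in> Basis \<Longrightarrow> unorm (crd x b) \<le> M) \<Longrightarrow> unorm x \<le> C * M"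
proof -
  define C where "C = 1 + (\<Sum>b\<in>Basis. unorm b)"
  have nonneg: "0 \<le> (\<Sum>b\<in>Basis. unorm b)"
    by (intro sum_nonneg) auto
  then have "C > 0"
    by (simp add: C_def)
  moreover have "unorm x \<le> C * M"
    if "0 \<le> M" "\<And>b. b \<in> Basis \<Longrightarrow> unorm (crd x b) \<le> M" for x M
  proof -
    have "unorm (of_crd (crd x)) \<le> C * M"
      unfolding of_crd_def
    proof (rule unorm_sum_le)
      fix b assume b: "b \<in> Basis"
      have "unorm b \<le> C"
        using member_le_sum[of b Basis unorm] b finite_Basis by (simp add: C_def)
      then have "unorm (crd x b) * unorm b \<le> M * C"
        using that b by (intro mult_mono) auto
      then show "unorm (scale (crd x b) b) \<le> C * M"
        by (simp add: unorm_scale mult.commute)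
    qed (use \<open>C > 0\<close> that in auto)
    then show ?thesis by simp
  qed
  ultimately show thesis by (rule that)
qed

end

subsection \<open>Analytic maps\<close>

lemma has_sum_finite_sum:
  fixes f :: "'b \<Rightarrow> 'c \<Rightarrow> 'a::topological_comm_monoid_add"
  assumes "finite B" "\<And>b. b \<in> B \<Longrightarrow> (f b has_sum s b) A"
  shows "((\<lambda>i. \<Sum>b\<in>B. f b i) has_sum (\<Sum>b\<in>B. s b)) A"
  using assms by (induction B rule: finite_induct) (auto intro: has_sum_add)

lemma null_fam_bounded:
  assumes "null_fam A f"
  obtains C where "0 \<le> C" "\<And>a. a \<in> A \<Longrightarrow> f a \<le> C"
proof -
  define Z where "Z = {a\<in>A. 1 \<le> f a}"
  have fin: "finite Z"
    using assms by (simp add: Z_def null_fam_def)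
  have nonneg: "0 \<le> sum f Z"
    by (intro sum_nonneg) (auto simp: Z_def)
  show thesis
  proof (rule that[of "1 + sum f Z"])
    show "f a \<le> 1 + sum f Z" if "a \<in> A" for a
    proof (cases "a \<in> Z")
      case True
      have "f a \<le> sum f Z"
        by (rule member_le_sum[OF True _ fin]) (auto simp: Z_def)
      then show ?thesis by simp
    qed (use that nonneg in \<open>auto simp: Z_def\<close>)
  qed (use nonneg in simp)
qed

lemma small_scalar:
  assumes "0 < e"
  obtains k :: "'k::complete_ultrametric_field" where "k \<noteq> 0" "unorm k < e"
  using perfect_choose_dist[OF assms, of "0::'k"] by (auto simp: unorm_eq_dist)

context ultrametric_space
begin

text \<open>Turns one vector-valued series into scalar Tate series with a common radius and
  bound.\<close>

lemma analytic_atE: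
  assumes "analytic_at f x"
  obtains \<rho> C where "0 < \<rho>"
    "\<And>b. b \<in> Basis \<Longrightarrow> tate Basis (\<lambda>_. \<rho>) C (\<lambda>z. crd (f (x + of_crd z)) b)"
proof -
  obtain r c where "r > 0" and c: "\<And>h. unorm h < r \<Longrightarrow>
      ((\<lambda>\<nu>. scale (mpow Basis (crd h) \<nu>) (c \<nu>)) has_sum f (x + h)) (midx Basis)"
    using assms unfolding analytic_at_def mpow_def midx_def by blast
  obtain D where "D > 0" and D: "\<And>x M. 0 \<le> M \<Longrightarrow> (\<And>b. b \<in> Basis \<Longrightarrow> unorm (crd x b) \<le> M) \<Longrightarrow> unorm x \<le> D * M"
    by (rule unorm_le_crd) blast
  obtain K where "K > 0" and K: "\<And>x b. b \<in> Basis \<Longrightarrow> unorm (crd x b) \<le> K * unorm x"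
    by (rule crd_bounded) blast
  have "0 < r / D"
    using \<open>r > 0\<close> \<open>D > 0\<close> by simp
  then obtain k :: 'k where k: "k \<noteq> 0" "unorm k < r / D"
    by (rule small_scalar)
  define \<rho> where "\<rho> = unorm k"
  have "\<rho> > 0" and \<rho>: "D * \<rho> < r"
    using k \<open>D > 0\<close> by (auto simp: \<rho>_def field_simps)
  have small: "unorm (of_crd z) < r" if "\<forall>b\<in>Basis. unorm (z b) \<le> \<rho>" for z
    using D[of \<rho> "of_crd z"] that \<rho> \<open>\<rho> > 0\<close> by auto
  have mp: "mpow Basis (crd (of_crd z)) \<nu> = mpow Basis z \<nu>" for z \<nu>
    unfolding mpow_def by (intro prod.cong) auto
  \<comment> \<open>At the point all of whose coordinates equal \<open>k\<close>, the norms of the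
    terms are exactly the Gauss weights for the radius \<open>unorm k\<close>. Summability at this
    one point therefore gives nullness of the weights; this is why the radius is taken among the
    values of the field.\<close>
  have "((\<lambda>\<nu>. scale (mpow Basis (crd (of_crd (\<lambda>_. k))) \<nu>) (c \<nu>)) has_sum
      f (x + of_crd (\<lambda>_. k))) (midx Basis)"
    by (intro c small) (auto simp: \<rho>_def)
  then have "null_fam (midx Basis) (\<lambda>\<nu>. unorm (scale (mpow Basis (crd (of_crd (\<lambda>_. k))) \<nu>) (c \<nu>)))"
    by (rule has_sum_imp_null)
  moreover have "unorm (scale (mpow Basis (crd (of_crd (\<lambda>_. k))) \<nu>) (c \<nu>)) =
      unorm (c \<nu>) * mpow Basis (\<lambda>_. \<rho>) \<nu>" for \<nu>
    by (simp add: mp unorm_scale mpow_def unorm_prod unorm_power \<rho>_def mult.commute)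
  ultimately have "null_fam (midx Basis) (\<lambda>\<nu>. unorm (c \<nu>) * mpow Basis (\<lambda>_. \<rho>) \<nu>)"
    by simp
  then have null: "null_fam (midx Basis) (\<lambda>\<nu>. K * (unorm (c \<nu>) * mpow Basis (\<lambda>_. \<rho>) \<nu>))"
    using \<open>K > 0\<close> by (intro null_fam_cmult) auto
  then obtain C where "0 \<le> C"
    and C: "\<And>\<nu>. \<nu> \<in> midx Basis \<Longrightarrow> K * (unorm (c \<nu>) * mpow Basis (\<lambda>_. \<rho>) \<nu>) \<le> C"
    by (rule null_fam_bounded) blast
  show thesis
  proof (rule that[OF \<open>\<rho> > 0\<close>])
    fix b assume b: "b \<in> Basis"
    have le: "unorm (crd (c \<nu>) b) * mpow Basis (\<lambda>_. \<rho>) \<nu> \<le> K * (unorm (c \<nu>) * mpow Basis (\<lambda>_. \<rho>) \<nu>)" for \<nu>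
      unfolding mult.assoc[symmetric] using \<open>\<rho> > 0\<close> by (intro mult_right_mono K b mpow_nonneg) auto
    show "tate Basis (\<lambda>_. \<rho>) C (\<lambda>z. crd (f (x + of_crd z)) b)"
      unfolding tate_def
    proof (intro exI[of _ "\<lambda>\<nu>. crd (c \<nu>) b"] conjI ballI allI impI)
      show "unorm (crd (c \<nu>) b) * mpow Basis (\<lambda>_. \<rho>) \<nu> \<le> C" if "\<nu> \<in> midx Basis" for \<nu>
        using le[of \<nu>] C[OF that] by linarith
      show "null_fam (midx Basis) (\<lambda>\<nu>. unorm (crd (c \<nu>) b) * mpow Basis (\<lambda>_. \<rho>) \<nu>)"
        using null le by (rule null_fam_mono)
      show "((\<lambda>\<nu>. crd (c \<nu>) b * mpow Basis z \<nu>) has_sum crd (f (x + of_crd z)) b) (midx Basis)"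
        if "\<forall>b\<in>Basis. unorm (z b) \<le> \<rho>" for z
        using has_sum_bounded_additive[where f = "\<lambda>x. crd x b", OF crd_add K[OF b] c[OF small[OF that]]]
        by (simp add: mp crd_scale mult.commute)
    qed
  qed
qed

text \<open>The coordinate series are assembled into one series with coefficient vectors
  \<open>of_crd (\<lambda>b. c b \<nu>)\<close>; finiteness of the basis allows the sum over
  coordinates to pass inside \<open>has_sum\<close>.\<close>

lemma analytic_atI:
  assumes "0 < \<rho>" and t: "\<And>b. b \<in> Basis \<Longrightarrow> tate Basis (\<lambda>_. \<rho>) (C b) (\<lambda>z. crd (f (x + of_crd z)) b)"
  shows "analytic_at f x"
proof -
  have "\<forall>b. \<exists>c. b \<in> Basis \<longrightarrow> (\<forall>z. (\<forall>b\<in>Basis. unorm (z b) \<le> \<rho>) \<longrightarrow>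
        ((\<lambda>\<nu>. c \<nu> * mpow Basis z \<nu>) has_sum crd (f (x + of_crd z)) b) (midx Basis))"
    using t unfolding tate_def by blast
  from choice[OF this] obtain c where c: "\<And>b z. b \<in> Basis \<Longrightarrow> (\<forall>b\<in>Basis. unorm (z b) \<le> \<rho>) \<Longrightarrow>
        ((\<lambda>\<nu>. c b \<nu> * mpow Basis z \<nu>) has_sum crd (f (x + of_crd z)) b) (midx Basis)"
    by blast
  obtain K where "K > 0" and K: "\<And>x b. b \<in> Basis \<Longrightarrow> unorm (crd x b) \<le> K * unorm x"
    by (rule crd_bounded) blast
  show ?thesis
    unfolding analytic_at_def midx_def[symmetric] mpow_def[symmetric]
  proof (intro exI[of _ "\<rho> / K"] exI[of _ "\<lambda>\<nu>. of_crd (\<lambda>b. c b \<nu>)"] conjI allI impI)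
    show "\<rho> / K > 0"
      using \<open>\<rho> > 0\<close> \<open>K > 0\<close> by simp
    fix h :: 'e assume h: "unorm h < \<rho> / K"
    have "unorm (crd h b) \<le> \<rho>" if "b \<in> Basis" for b
      using K[OF that, of h] h \<open>K > 0\<close> by (simp add: field_simps)
    then have "((\<lambda>\<nu>. c b \<nu> * mpow Basis (crd h) \<nu>) has_sum crd (f (x + h)) b) (midx Basis)"
      if "b \<in> Basis" for b
      using c[of b "crd h"] that by simp
    then have "((\<lambda>\<nu>. scale (c b \<nu> * mpow Basis (crd h) \<nu>) b) has_sum scale (crd (f (x + h)) b) b) (midx Basis)"
      if "b \<in> Basis" for b
      using that
      by (intro has_sum_bounded_additive[where f = "\<lambda>k. scale k b" and C = "unorm b"])
         (auto simp: scale_left_distrib unorm_scale)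
    then have "((\<lambda>\<nu>. \<Sum>b\<in>Basis. scale (c b \<nu> * mpow Basis (crd h) \<nu>) b) has_sum
        (\<Sum>b\<in>Basis. scale (crd (f (x + h)) b) b)) (midx Basis)"
      by (intro has_sum_finite_sum finite_Basis)
    moreover have "(\<Sum>b\<in>Basis. scale (crd (f (x + h)) b) b) = f (x + h)"
      using of_crd_crd[of "f (x + h)"] by (simp add: of_crd_def)
    moreover have "(\<Sum>b\<in>Basis. scale (c b \<nu> * mpow Basis (crd h) \<nu>) b) =
        scale (mpow Basis (crd h) \<nu>) (of_crd (\<lambda>b. c b \<nu>))" for \<nu>
      by (simp add: of_crd_def scale_sum_right mult.commute)
    ultimately show "((\<lambda>\<nu>. scale (mpow Basis (crd h) \<nu>) (of_crd (\<lambda>b. c b \<nu>))) has_sum f (x + h)) (midx Basis)"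
      by simp
  qed
qed

lemma analytic_at_cong:
  assumes f: "analytic_at f x" and U: "open U" "x \<in> U" and eq: "\<And>y. y \<in> U \<Longrightarrow> f y = g y"
  shows "analytic_at g x"
proof -
  obtain r c where r: "r > 0" and c: "\<And>h. unorm h < r \<Longrightarrow>
      ((\<lambda>\<nu>. scale (mpow Basis (crd h) \<nu>) (c \<nu>)) has_sum f (x + h)) (midx Basis)"
    using f unfolding analytic_at_def mpow_def midx_def by blast
  obtain e where e: "e > 0" "\<And>y. dist y x < e \<Longrightarrow> y \<in> U"
    using U by (auto simp: open_dist)
  show ?thesis
    unfolding analytic_at_def midx_def[symmetric] mpow_def[symmetric]
  proof (intro exI[of _ "min r e"] exI[of _ c] conjI allI impI)
    show "min r e > 0"
      using r e by simp
    fix h :: 'e assume "unorm h < min r e"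
    then show "((\<lambda>\<nu>. scale (mpow Basis (crd h) \<nu>) (c \<nu>)) has_sum g (x + h)) (midx Basis)"
      using c[of h] e(2)[of "x + h"] eq[of "x + h"] by (simp add: dist_unorm)
  qed
qed

lemma analytic_at_compose:
  assumes f: "analytic_at f x" and g: "analytic_at g (f x)"
  shows "analytic_at (\<lambda>y. g (f y)) x"
proof -
  obtain \<rho> C where "\<rho> > 0" and
    F: "\<And>b. b \<in> Basis \<Longrightarrow> tate Basis (\<lambda>_. \<rho>) C (\<lambda>z. crd (f (x + of_crd z)) b)"
    using analytic_atE[OF f] by blast
  obtain \<rho>' C' where "\<rho>' > 0" and
    G: "\<And>b. b \<in> Basis \<Longrightarrow> tate Basis (\<lambda>_. \<rho>') C' (\<lambda>z. crd (g (f x + of_crd z)) b)"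
    using analytic_atE[OF g] by blast
  \<comment> \<open>Shrinking by \<open>l\<close> gives \<open>l * C \<le> \<rho>'\<close>, so the
    increment of \<open>f\<close> lands in the polydisc on which \<open>g\<close> is a Tate series.
    The added 1 avoids division by zero.\<close>
  define l where "l = min 1 (\<rho>' / (\<bar>C\<bar> + 1))"
  have l: "0 < l" "l \<le> 1"
    using \<open>\<rho>' > 0\<close> by (auto simp: l_def)
  have "l * C \<le> l * (\<bar>C\<bar> + 1)"
    using l by (intro mult_left_mono) auto
  also have "\<dots> \<le> \<rho>' / (\<bar>C\<bar> + 1) * (\<bar>C\<bar> + 1)"
    by (intro mult_right_mono) (auto simp: l_def)
  finally have lC: "l * C \<le> \<rho>'"
    using abs_ge_zero[of C] by (simp add: divide_simps split: if_splits)
  have F': "tate Basis (\<lambda>_. l * \<rho>) \<rho>' (\<lambda>z. crd (f (x + of_crd z) - f x) b)" if "b \<in> Basis" for b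
    using tate_mono[OF tate_scaled_weights[OF F[OF that] finite_Basis _ l] lC] \<open>\<rho> > 0\<close>
    by (simp add: crd_diff of_crd_def)
  have "tate Basis (\<lambda>_. l * \<rho>) C' (\<lambda>z. crd (g (f (x + of_crd z))) b)" if "b \<in> Basis" for b
    using tate_compose[where H = "\<lambda>b z. crd (f (x + of_crd z) - f x) b", OF G[OF that] F']
      \<open>\<rho> > 0\<close> l by simp
  then show ?thesis
    using \<open>\<rho> > 0\<close> l by (intro analytic_atI[of "l * \<rho>" "\<lambda>_. C'"]) auto
qed

lemma linear_at_0: "Vector_Spaces.linear scale scale g \<Longrightarrow> g 0 = 0"
  unfolding Vector_Spaces.linear_iff by (metis scale_zero_left)

lemma linear_sum_Basis:
  assumes "Vector_Spaces.linear scale scale g"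
  shows "g (of_crd z) = (\<Sum>b\<in>Basis. scale (z b) (g b))"
  unfolding of_crd_def
  using linear_on_subspace_sum[OF subspace_UNIV, of g Basis "\<lambda>b. b" z] assms
  by (simp add: Vector_Spaces.linear_iff)

lemma analytic_at_linear:
  assumes g: "Vector_Spaces.linear scale scale g"
  shows "analytic_at g x"
proof (rule analytic_atI[of 1])
  fix b assume "b \<in> Basis"
  define C where "C = unorm (crd (g x) b) + (\<Sum>b'\<in>Basis. unorm (crd (g b') b))"
  have nonneg: "0 \<le> (\<Sum>b'\<in>Basis. unorm (crd (g b') b))"
    by (intro sum_nonneg) auto
  have le: "unorm (crd (g b') b) \<le> C" if "b' \<in> Basis" for b'
  proof -
    have "unorm (crd (g b') b) \<le> (\<Sum>b'\<in>Basis. unorm (crd (g b') b))"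
      using that finite_Basis by (intro member_le_sum) auto
    then show ?thesis
      using unorm_nonneg[of "crd (g x) b"] unfolding C_def by linarith
  qed
  have "tate Basis (\<lambda>_. 1) C (\<lambda>z. crd (g x) b + (\<Sum>b'\<in>Basis. crd (g b') b * z b'))"
  proof (intro tate_add tate_sum finite_Basis)
    show "tate Basis (\<lambda>_. 1) C (\<lambda>z. crd (g x) b)"
      using nonneg by (intro tate_mono[OF tate_const]) (auto simp: C_def)
    show "tate Basis (\<lambda>_. 1) C (\<lambda>z. crd (g b') b * z b')" if "b' \<in> Basis" for b'
      using tate_mono[OF tate_cmult[OF tate_var[OF finite_Basis that, of "\<lambda>_. 1"]] ] le[OF that] by simp
    show "0 \<le> C"
      using nonneg by (simp add: C_def)
  qed auto
  moreover have "crd (g (x + of_crd z)) b = crd (g x) b + (\<Sum>b'\<in>Basis. crd (g b') b * z b')" for z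
  proof -
    have "g (x + of_crd z) = g x + g (of_crd z)"
      using g by (simp add: Vector_Spaces.linear_iff)
    then show ?thesis
      by (simp add: linear_sum_Basis[OF g] crd_add crd_sum crd_scale mult.commute)
  qed
  ultimately show "tate Basis (\<lambda>_. 1) C (\<lambda>z. crd (g (x + of_crd z)) b)"
    by simp
qed auto

lemma analytic_at_ident: "analytic_at (\<lambda>y. y) x"
  using analytic_at_linear[OF linear_ident] by (simp add: id_def)

lemma analytic_at_const: "analytic_at (\<lambda>y. c) x"
  by (rule analytic_atI[of 1 "\<lambda>b. unorm (crd c b)"]) (auto intro: tate_const)

lemma analytic_at_add:
  assumes "analytic_at f x" "analytic_at g x"
  shows "analytic_at (\<lambda>y. f y + g y) x"
proof -
  obtain \<rho> C where "\<rho> > 0" and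
    F: "\<And>b. b \<in> Basis \<Longrightarrow> tate Basis (\<lambda>_. \<rho>) C (\<lambda>z. crd (f (x + of_crd z)) b)"
    using analytic_atE[OF assms(1)] by blast
  obtain \<rho>' C' where "\<rho>' > 0" and
    G: "\<And>b. b \<in> Basis \<Longrightarrow> tate Basis (\<lambda>_. \<rho>') C' (\<lambda>z. crd (g (x + of_crd z)) b)"
    using analytic_atE[OF assms(2)] by blast
  have "tate Basis (\<lambda>_. min \<rho> \<rho>') (max C C') (\<lambda>z. crd (f (x + of_crd z)) b + crd (g (x + of_crd z)) b)"
    if "b \<in> Basis" for b
    using \<open>\<rho> > 0\<close> \<open>\<rho>' > 0\<close>
    by (intro tate_add tate_mono[OF tate_weights[OF F[OF that]]] tate_mono[OF tate_weights[OF G[OF that]]]) auto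
  then show ?thesis
    using \<open>\<rho> > 0\<close> \<open>\<rho>' > 0\<close> by (intro analytic_atI[of "min \<rho> \<rho>'" "\<lambda>_. max C C'"]) (auto simp: crd_add)
qed

lemma analytic_at_translate: "analytic_at (\<lambda>y. y + c) x"
  by (intro analytic_at_add analytic_at_ident analytic_at_const)

lemma analytic_at_Lipschitz:
  assumes "analytic_at f x"
  obtains d K where "d > 0" "K > 0" "\<And>h. unorm h < d \<Longrightarrow> unorm (f (x + h) - f x) \<le> K * unorm h"
proof -
  obtain \<rho> C where "\<rho> > 0" and
    F: "\<And>b. b \<in> Basis \<Longrightarrow> tate Basis (\<lambda>_. \<rho>) C (\<lambda>z. crd (f (x + of_crd z)) b)"
    using analytic_atE[OF assms] by blast
  obtain K where "K > 0" and K: "\<And>x b. b \<in> Basis \<Longrightarrow> unorm (crd x b) \<le> K * unorm x"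
    by (rule crd_bounded) blast
  obtain D where "D > 0" and D: "\<And>x M. 0 \<le> M \<Longrightarrow> (\<And>b. b \<in> Basis \<Longrightarrow> unorm (crd x b) \<le> M) \<Longrightarrow> unorm x \<le> D * M"
    by (rule unorm_le_crd) blast
  show thesis
  proof (rule that)
    show "\<rho> / K > 0" "D * (K / \<rho> * (\<bar>C\<bar> + 1)) > 0"
      using \<open>\<rho> > 0\<close> \<open>K > 0\<close> \<open>D > 0\<close> by (auto intro!: mult_pos_pos add_nonneg_pos)
    fix h :: 'e assume h: "unorm h < \<rho> / K"
    show "unorm (f (x + h) - f x) \<le> D * (K / \<rho> * (\<bar>C\<bar> + 1)) * unorm h"
    proof (cases "h = 0")
      case False
      \<comment> \<open>Chosen so that the coordinates of \<open>h\<close> are at most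
        \<open>l * \<rho>\<close>; the scale follows the size of \<open>h\<close>, which turns the
        factor \<open>l\<close> into a linear bound.\<close>
      define l where "l = K * unorm h / \<rho>"
      have l: "0 < l" "l \<le> 1"
        using \<open>\<rho> > 0\<close> \<open>K > 0\<close> False h by (auto simp: l_def field_simps)
      have "unorm (f (x + h) - f x) \<le> D * (l * (\<bar>C\<bar> + 1))"
      proof (rule D)
        show "0 \<le> l * (\<bar>C\<bar> + 1)"
          using l by simp
        fix b assume b: "b \<in> Basis"
        have "unorm (crd (f (x + of_crd (crd h))) b - crd (f (x + of_crd (\<lambda>_. 0))) b) \<le> l * C"
          using tate_bound[OF tate_scaled_weights[OF F[OF b] finite_Basis _ l], of "crd h"]
            \<open>\<rho> > 0\<close> K[of _ h] by (simp add: l_def)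
        also have "\<dots> \<le> l * (\<bar>C\<bar> + 1)"
          using l by (intro mult_left_mono) auto
        finally show "unorm (crd (f (x + h) - f x) b) \<le> l * (\<bar>C\<bar> + 1)"
          by (simp add: crd_diff of_crd_def[of "\<lambda>_. 0"])
      qed
      then show ?thesis
        by (simp add: l_def mult_ac)
    qed simp
  qed
qed

lemma analytic_at_imp_isCont:
  assumes "analytic_at f x"
  shows "isCont f x"
proof -
  obtain d K where d: "d > 0" "K > 0" "\<And>h. unorm h < d \<Longrightarrow> unorm (f (x + h) - f x) \<le> K * unorm h"
    using analytic_at_Lipschitz[OF assms] by blast
  show ?thesis
    unfolding isCont_def
  proof (rule metric_LIM_I)
    fix r :: real assume "0 < r"
    show "\<exists>s>0. \<forall>y. y \<noteq> x \<and> dist y x < s \<longrightarrow> dist (f y) (f x) < r"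
    proof (intro exI[of _ "min d (r / K)"] conjI allI impI)
      show "0 < min d (r / K)"
        using d \<open>0 < r\<close> by simp
      fix y assume y: "y \<noteq> x \<and> dist y x < min d (r / K)"
      then have "unorm (f (x + (y - x)) - f x) \<le> K * unorm (y - x)"
        by (intro d(3)) (simp add: dist_unorm)
      also have "\<dots> < r"
        using y d(2) by (simp add: dist_unorm field_simps)
      finally show "dist (f y) (f x) < r"
        by (simp add: dist_unorm)
    qed
  qed
qed

section \<open>Frechet derivatives and first-order expansion\<close>

lemma linear_bounded:
  assumes "Vector_Spaces.linear scale scale g"
  obtains C where "C > 0" "\<And>x. unorm (g x) \<le> C * unorm x"
  using linear_on_subspace_bounded[OF subspace_UNIV, of g unorm unorm] assms ultra_norm_unorm
  by (auto simp: Vector_Spaces.linear_iff)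

text \<open>The quotient becomes an inequality that also makes sense at \<open>h = 0\<close>, and
  continuity of \<open>D\<close> is absorbed because linear maps in finite dimension are
  continuous.\<close>

lemma has_frechet_derivative_iff:
  "has_frechet_derivative f D x \<longleftrightarrow> Vector_Spaces.linear scale scale D \<and>
    (\<forall>e>0. \<exists>d>0. \<forall>h. unorm h < d \<longrightarrow> unorm (f (x + h) - f x - D h) \<le> e * unorm h)"
  (is "?L \<longleftrightarrow> ?R")
proof (cases "Vector_Spaces.linear scale scale D")
  case lin: True
  have "continuous_on UNIV D"
    unfolding continuous_on_eq_continuous_at[OF open_UNIV]
    using analytic_at_imp_isCont[OF analytic_at_linear[OF lin]] by blast
  then have "?L \<longleftrightarrow> ((\<lambda>h. unorm (f (x + h) - f x - D h) / unorm h) \<longlongrightarrow> 0) (at 0)"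
    using lin by (simp add: has_frechet_derivative_def)
  also have "\<dots> \<longleftrightarrow> (\<forall>e>0. \<exists>d>0. \<forall>h. h \<noteq> 0 \<and> unorm h < d \<longrightarrow>
      unorm (f (x + h) - f x - D h) / unorm h < e)"
    by (simp add: LIM_def dist_unorm)
  also have "\<dots> \<longleftrightarrow> (\<forall>e>0. \<exists>d>0. \<forall>h. unorm h < d \<longrightarrow> unorm (f (x + h) - f x - D h) \<le> e * unorm h)"
  proof safe
    fix e :: real assume "e > 0" and
      *: "\<forall>e>0. \<exists>d>0. \<forall>h. h \<noteq> 0 \<and> unorm h < d \<longrightarrow> unorm (f (x + h) - f x - D h) / unorm h < e"
    then obtain d where d: "d > 0"
      "\<And>h. h \<noteq> 0 \<and> unorm h < d \<Longrightarrow> unorm (f (x + h) - f x - D h) / unorm h < e"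
      by blast
    have "D 0 = 0"
      by (rule linear_at_0[OF lin])
    then have "unorm (f (x + h) - f x - D h) \<le> e * unorm h" if "unorm h < d" for h
      using d(2)[of h] that unorm_pos_iff[of h] by (cases "h = 0") (auto simp: field_simps)
    then show "\<exists>d>0. \<forall>h. unorm h < d \<longrightarrow> unorm (f (x + h) - f x - D h) \<le> e * unorm h"
      using d(1) by blast
  next
    fix e :: real assume "e > 0" and
      *: "\<forall>e>0. \<exists>d>0. \<forall>h. unorm h < d \<longrightarrow> unorm (f (x + h) - f x - D h) \<le> e * unorm h"
    \<comment> \<open>The bound is requested for \<open>e / 2\<close> to recover the strict
      inequality in the limit.\<close>
    then obtain d where d: "d > 0"
      "\<And>h. unorm h < d \<Longrightarrow> unorm (f (x + h) - f x - D h) \<le> e / 2 * unorm h"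
      using half_gt_zero by blast
    have "unorm (f (x + h) - f x - D h) / unorm h < e" if "h \<noteq> 0" "unorm h < d" for h
    proof -
      have "unorm (f (x + h) - f x - D h) / unorm h \<le> e / 2"
        using d(2)[OF that(2)] unorm_pos_iff[of h] that(1) by (simp add: field_simps)
      then show ?thesis
        using \<open>e > 0\<close> by linarith
    qed
    then show "\<exists>d>0. \<forall>h. h \<noteq> 0 \<and> unorm h < d \<longrightarrow> unorm (f (x + h) - f x - D h) / unorm h < e"
      using d(1) by blast
  qed
  finally show ?thesis
    using lin by blast
qed (auto simp: has_frechet_derivative_def)

text \<open>Non-discreteness provides nonzero scalars \<open>k\<close> with \<open>scale k h\<close>
  arbitrarily small; dividing the estimate at \<open>scale k h\<close> by \<open>unorm k\<close>
  bounds \<open>D h - D' h\<close> by any positive number.\<close>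

lemma has_frechet_derivative_unique:
  assumes D: "has_frechet_derivative f D x" and D': "has_frechet_derivative f D' x"
  shows "D = D'"
proof
  fix h
  have lin: "Vector_Spaces.linear scale scale D" "Vector_Spaces.linear scale scale D'"
    using assms by (auto simp: has_frechet_derivative_iff)
  have "unorm (D h - D' h) \<le> e" if "e > 0" for e
  proof -
    define e' where "e' = e / (unorm h + 1)"
    have pos: "0 < unorm h + 1"
      using unorm_nonneg[of h] by linarith
    then have "e' > 0"
      using \<open>e > 0\<close> by (simp add: e'_def)
    then obtain d d' where d: "d > 0" "\<And>h. unorm h < d \<Longrightarrow> unorm (f (x + h) - f x - D h) \<le> e' * unorm h"
      and d': "d' > 0" "\<And>h. unorm h < d' \<Longrightarrow> unorm (f (x + h) - f x - D' h) \<le> e' * unorm h"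
      using assms unfolding has_frechet_derivative_iff by blast
    have "0 < min d d' / (unorm h + 1)"
      using d d' pos by simp
    then obtain k :: 'k where k: "k \<noteq> 0" "unorm k < min d d' / (unorm h + 1)"
      by (rule small_scalar)
    have "unorm k * unorm h \<le> unorm k * (unorm h + 1)"
      by (intro mult_left_mono) auto
    also have "\<dots> < min d d'"
      using k(2) pos by (simp add: field_simps)
    finally have small: "unorm (scale k h) < d" "unorm (scale k h) < d'"
      by (auto simp: unorm_scale)
    have "unorm ((f (x + scale k h) - f x - D' (scale k h)) - (f (x + scale k h) - f x - D (scale k h)))
        \<le> e' * unorm (scale k h)"
      by (intro unorm_diff_le d d' small)
    moreover have "(f (x + scale k h) - f x - D' (scale k h)) - (f (x + scale k h) - f x - D (scale k h)) =
        scale k (D h - D' h)"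
      using lin by (simp add: Vector_Spaces.linear_iff scale_right_diff_distrib)
    ultimately have "unorm k * unorm (D h - D' h) \<le> unorm k * (e' * unorm h)"
      by (simp add: unorm_scale mult_ac)
    then have "unorm (D h - D' h) \<le> e' * unorm h"
      using k(1) by simp
    also have "\<dots> \<le> e' * (unorm h + 1)"
      using \<open>e' > 0\<close> by (intro mult_left_mono) auto
    also have "\<dots> = e"
      using pos by (simp add: e'_def)
    finally show ?thesis .
  qed
  then have "unorm (D h - D' h) \<le> 0"
    by (rule dense_ge)
  then have "unorm (D h - D' h) = 0"
    using unorm_nonneg by (rule antisym)
  then show "D h = D' h" by simp
qed

lemma frechet_derivative_at_eqI:
  "has_frechet_derivative f D x \<Longrightarrow> frechet_derivative_at f x = D"
  unfolding frechet_derivative_at_def using has_frechet_derivative_unique by blast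

text \<open>The linear coefficients of the coordinate series form the derivative. The quadratic gain
  in \<open>l\<close>, against radii linear in \<open>l\<close>, later makes the nonlinear part as
  small as desired relative to the polydisc.\<close>

lemma analytic_at_expansion:
  assumes "analytic_at f x"
  obtains D \<rho> C where "has_frechet_derivative f D x" "0 < \<rho>"
    "\<And>l b. 0 < l \<Longrightarrow> l \<le> 1 \<Longrightarrow> b \<in> Basis \<Longrightarrow>
      tate Basis (\<lambda>_. l * \<rho>) (l\<^sup>2 * C) (\<lambda>z. crd (f (x + of_crd z) - f x - D (of_crd z)) b)"
proof -
  obtain \<rho> C where "\<rho> > 0" and
    F: "\<And>b. b \<in> Basis \<Longrightarrow> tate Basis (\<lambda>_. \<rho>) C (\<lambda>z. crd (f (x + of_crd z)) b)"
    using analytic_atE[OF assms] by blast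
  have "\<forall>b. \<exists>A. b \<in> Basis \<longrightarrow> (\<forall>l. 0 < l \<longrightarrow> l \<le> 1 \<longrightarrow> tate Basis (\<lambda>_. l * \<rho>) (l\<^sup>2 * C)
      (\<lambda>z. crd (f (x + of_crd z)) b - crd (f (x + of_crd (\<lambda>_. 0))) b - (\<Sum>b'\<in>Basis. A b' * z b')))"
  proof (intro allI)
    fix b
    show "\<exists>A. b \<in> Basis \<longrightarrow> (\<forall>l. 0 < l \<longrightarrow> l \<le> 1 \<longrightarrow> tate Basis (\<lambda>_. l * \<rho>) (l\<^sup>2 * C)
      (\<lambda>z. crd (f (x + of_crd z)) b - crd (f (x + of_crd (\<lambda>_. 0))) b - (\<Sum>b'\<in>Basis. A b' * z b')))"
    proof (cases "b \<in> Basis")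
      case True
      show ?thesis
        by (rule tate_remainder[OF F[OF True] finite_Basis \<open>\<rho> > 0\<close>]) blast
    qed blast
  qed
  from choice[OF this] obtain A where
    A: "\<And>b l. b \<in> Basis \<Longrightarrow> 0 < l \<Longrightarrow> l \<le> 1 \<Longrightarrow> tate Basis (\<lambda>_. l * \<rho>) (l\<^sup>2 * C)
      (\<lambda>z. crd (f (x + of_crd z)) b - crd (f (x + of_crd (\<lambda>_. 0))) b - (\<Sum>b'\<in>Basis. A b b' * z b'))"
    by blast
  define D where "D h = of_crd (\<lambda>b. \<Sum>b'\<in>Basis. A b b' * crd h b')" for h
  have lin: "Vector_Spaces.linear scale scale D"
    unfolding Vector_Spaces.linear_iff
  proof (intro conjI allI)
    show "D (x + y) = D x + D y" for x y
      by (simp add: D_def crd_add distrib_left sum.distrib of_crd_add)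
    show "D (scale c x) = scale c (D x)" for c x
      by (rule crd_eqI) (simp add: D_def crd_scale sum_distrib_left mult_ac)
  qed (rule vector_space_axioms)+
  have R: "tate Basis (\<lambda>_. l * \<rho>) (l\<^sup>2 * C) (\<lambda>z. crd (f (x + of_crd z) - f x - D (of_crd z)) b)"
    if "0 < l" "l \<le> 1" "b \<in> Basis" for l b
    using A[OF that(3,1,2)] that(3) by (simp add: D_def crd_diff of_crd_def[of "\<lambda>_. 0"])
  obtain K where "K > 0" and K: "\<And>x b. b \<in> Basis \<Longrightarrow> unorm (crd x b) \<le> K * unorm x"
    by (rule crd_bounded) blast
  obtain M where "M > 0" and M: "\<And>x B. 0 \<le> B \<Longrightarrow> (\<And>b. b \<in> Basis \<Longrightarrow> unorm (crd x b) \<le> B) \<Longrightarrow> unorm x \<le> M * B"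
    by (rule unorm_le_crd) blast
  have "has_frechet_derivative f D x"
    unfolding has_frechet_derivative_iff
  proof (intro conjI lin allI impI)
    fix e :: real assume "e > 0"
    \<comment> \<open>With this constant the remainder is at most
      \<open>L * unorm h * unorm h\<close>, so radius \<open>e / L\<close> suffices.\<close>
    define L where "L = M * ((K / \<rho>)\<^sup>2 * (\<bar>C\<bar> + 1))"
    have "L > 0"
      unfolding L_def using \<open>M > 0\<close> \<open>K > 0\<close> \<open>\<rho> > 0\<close> by (intro mult_pos_pos) (auto intro: add_nonneg_pos)
    show "\<exists>d>0. \<forall>h. unorm h < d \<longrightarrow> unorm (f (x + h) - f x - D h) \<le> e * unorm h"
    proof (intro exI[of _ "min (\<rho> / K) (e / L)"] conjI allI impI)
      show "0 < min (\<rho> / K) (e / L)"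
        using \<open>\<rho> > 0\<close> \<open>K > 0\<close> \<open>e > 0\<close> \<open>L > 0\<close> by simp
      fix h :: 'e assume h: "unorm h < min (\<rho> / K) (e / L)"
      show "unorm (f (x + h) - f x - D h) \<le> e * unorm h"
      proof (cases "h = 0")
        case True
        then show ?thesis
          using linear_at_0[OF lin] by simp
      next
        case False
        define l where "l = K * unorm h / \<rho>"
        have l: "0 < l" "l \<le> 1"
          using \<open>\<rho> > 0\<close> \<open>K > 0\<close> False h by (auto simp: l_def field_simps)
        have "unorm (f (x + h) - f x - D h) \<le> M * (l\<^sup>2 * (\<bar>C\<bar> + 1))"
        proof (rule M)
          show "0 \<le> l\<^sup>2 * (\<bar>C\<bar> + 1)"
            by simp
          fix b assume b: "b \<in> Basis"
          have "unorm (crd (f (x + h) - f x - D h) b) \<le> l\<^sup>2 * C"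
            using tate_bound[OF R[OF l b], of "crd h"] \<open>\<rho> > 0\<close> K[of _ h] by (simp add: l_def)
          also have "\<dots> \<le> l\<^sup>2 * (\<bar>C\<bar> + 1)"
            by (intro mult_left_mono) auto
          finally show "unorm (crd (f (x + h) - f x - D h) b) \<le> l\<^sup>2 * (\<bar>C\<bar> + 1)" .
        qed
        also have "\<dots> = L * unorm h * unorm h"
          by (simp add: L_def l_def power2_eq_square mult_ac)
        also have "\<dots> \<le> e * unorm h"
          using h \<open>L > 0\<close> by (intro mult_right_mono) (auto simp: field_simps)
        finally show ?thesis .
      qed
    qed
  qed
  then show thesis
    using \<open>\<rho> > 0\<close> R by (rule that)
qed

end

subsection \<open>Invariant graphs\<close>

lemma mult_le_weight: "0 \<le> w \<Longrightarrow> d \<le> 1 \<Longrightarrow> d * w \<le> (w::real)"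
  using mult_right_mono[of d 1 w] by simp

text \<open>A Schwarz lemma: comparing \<open>H\<close> with the zero map yields the gain \<delta>,
  which a nonzero constant term of \<open>F\<close> would destroy.\<close>

lemma tate_compose_vanishing:
  assumes F: "tate A W C F" "F (\<lambda>_. 0) = 0" and w: "\<And>b. b \<in> I \<Longrightarrow> 0 < w b"
    and W: "\<And>b. b \<in> A \<Longrightarrow> 0 \<le> W b" and \<delta>: "0 \<le> \<delta>" "\<delta> \<le> 1"
    and H: "\<And>b. b \<in> A \<Longrightarrow> tate I w (\<delta> * W b) (\<lambda>x. H x b)"
  shows "tate I w (\<delta> * C) (\<lambda>x. F (H x))"
proof -
  have "tate I w (\<delta> * C) (\<lambda>x. F (\<lambda>b. H x b) - F (\<lambda>b. 0))"
  proof (rule tate_compose_diff[where H = "\<lambda>b x. H x b" and H' = "\<lambda>b x. 0", OF F(1) w \<delta>(1)])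
    show "tate I w (W b) (\<lambda>x. H x b)" if "b \<in> A" for b
      by (rule tate_mono[OF H[OF that] mult_le_weight[OF W[OF that] \<delta>(2)]])
    show "tate I w (W b) (\<lambda>x. 0)" if "b \<in> A" for b
      using w W[OF that] by (intro tate_zero) (auto simp: less_imp_le)
  qed (use H in auto)
  then show ?thesis
    by (simp add: F(2))
qed

text \<open>Points are regarded as constant maps, so the estimate for substitutions specialises to
  values.\<close>

lemma tate_pointwise_Lipschitz:
  assumes F: "tate A w C F" and w: "\<And>b. b \<in> A \<Longrightarrow> 0 < w b" and "0 \<le> \<delta>"
    and x: "\<And>b. b \<in> A \<Longrightarrow> unorm (x b) \<le> w b" and y: "\<And>b. b \<in> A \<Longrightarrow> unorm (y b) \<le> w b"
    and diff: "\<And>b. b \<in> A \<Longrightarrow> unorm (x b - y b) \<le> \<delta> * w b"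
  shows "unorm (F x - F y) \<le> \<delta> * C"
proof -
  have const: "tate A w c (\<lambda>_. k)" if "unorm k \<le> c" for k :: 'b and c
    using tate_mono[OF tate_const that, of A w] w by (simp add: less_imp_le)
  have "tate A w (\<delta> * C) (\<lambda>_. F (\<lambda>b. x b) - F (\<lambda>b. y b))"
    by (rule tate_compose_diff[where H = "\<lambda>b _. x b" and H' = "\<lambda>b _. y b", OF F w \<open>0 \<le> \<delta>\<close>])
       (auto intro!: const x y diff)
  then show ?thesis
    using tate_bound[of A w "\<delta> * C" "\<lambda>_. F x - F y" x] x by simp
qed

lemma tate_pointwise_vanishing:
  assumes F: "tate A w C F" "F (\<lambda>_. 0) = 0" and w: "\<And>b. b \<in> A \<Longrightarrow> 0 < w b"
    and \<delta>: "0 \<le> \<delta>" "\<delta> \<le> 1" and x: "\<And>b. b \<in> A \<Longrightarrow> unorm (x b) \<le> \<delta> * w b"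
  shows "unorm (F x) \<le> \<delta> * C"
proof -
  have "unorm (x b) \<le> w b" if "b \<in> A" for b
    using x[OF that] mult_le_weight[OF less_imp_le[OF w[OF that]] \<delta>(2)] by linarith
  then have "unorm (F x - F (\<lambda>_. 0)) \<le> \<delta> * C"
    using w x by (intro tate_pointwise_Lipschitz[OF F(1) w \<delta>(1)]) (auto simp: less_imp_le)
  then show ?thesis
    using F(2) by simp
qed

text \<open>The weighted maximum norm together with an index attaining it. The alternative
  \<open>m = 0\<close> covers an empty index set, that is, the absence of unstable
  directions.\<close>

lemma finite_weighted_max:
  fixes v w :: "'i \<Rightarrow> real"
  assumes "finite U" "\<And>i. i \<in> U \<Longrightarrow> 0 < w i" "\<And>i. i \<in> U \<Longrightarrow> 0 \<le> v i"
  obtains m where "0 \<le> m" "\<And>i. i \<in> U \<Longrightarrow> v i \<le> m * w i" "m = 0 \<or> (\<exists>i\<in>U. v i = m * w i)"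
proof (cases "U = {}")
  case True
  then show thesis by (intro that[of 0]) auto
next
  case False
  define m where "m = Max ((\<lambda>i. v i / w i) ` U)"
  have "m \<in> (\<lambda>i. v i / w i) ` U"
    unfolding m_def using assms(1) False by (intro Max_in) auto
  then obtain i where i: "i \<in> U" "m = v i / w i" by blast
  have le: "v j / w j \<le> m" if "j \<in> U" for j
    unfolding m_def using assms(1) that by (intro Max_ge) auto
  show thesis
  proof (rule that[of m])
    show "0 \<le> m"
      using i assms by (simp add: less_imp_le)
    show "v j \<le> m * w j" if "j \<in> U" for j
      using le[OF that] assms(2)[OF that] by (simp add: field_simps)
    show "m = 0 \<or> (\<exists>i\<in>U. v i = m * w i)"
      using i assms(2)[OF i(1)] by (intro disjI2 bexI[of _ i]) auto
  qed
qed

text \<open>A map in coordinates, split into a part \<open>A\<close> contracting by \<open>\<theta>\<close> and a part \<open>B\<close> whose inverse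
  \<open>D\<close> has norm at most \<open>\<beta>\<close>, perturbed by a higher order term \<open>R\<close> with Lipschitz constant \<open>\<epsilon>\<close>. The
  norm is \<open>x \<mapsto> max |x b| / w b\<close>, so its unit ball is the polydisc with radii \<open>w\<close>.\<close>

locale hyperbolic_germ =
  fixes S U :: "'i set" and w :: "'i \<Rightarrow> real" and A B D :: "'i \<Rightarrow> 'i \<Rightarrow> 'k::complete_ultrametric_field"
    and R :: "'i \<Rightarrow> ('i \<Rightarrow> 'k) \<Rightarrow> 'k" and F :: "('i \<Rightarrow> 'k) \<Rightarrow> 'i \<Rightarrow> 'k"
    and \<theta> \<beta> \<epsilon> :: real
  assumes fin: "finite S" "finite U" and disjoint: "S \<inter> U = {}"
    and w: "\<And>b. b \<in> S \<union> U \<Longrightarrow> 0 < w b"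
    and \<theta>: "0 < \<theta>" "\<theta> \<le> 1" and \<epsilon>: "0 \<le> \<epsilon>" "\<epsilon> \<le> \<theta>" and \<beta>: "0 \<le> \<beta>" "\<beta> * \<theta> < 1"
    and A: "\<And>i j. i \<in> S \<Longrightarrow> j \<in> S \<Longrightarrow> unorm (A i j) * w j \<le> \<theta> * w i"
    and D: "\<And>i j. i \<in> U \<Longrightarrow> j \<in> U \<Longrightarrow> unorm (D i j) * w j \<le> \<beta> * w i"
    and BD: "\<And>i y. i \<in> U \<Longrightarrow> (\<Sum>j\<in>U. B i j * (\<Sum>k\<in>U. D j k * y k)) = y i"
    and DB: "\<And>i y. i \<in> U \<Longrightarrow> (\<Sum>j\<in>U. D i j * (\<Sum>k\<in>U. B j k * y k)) = y i"
    and R: "\<And>i. i \<in> S \<union> U \<Longrightarrow> tate (S \<union> U) w (\<epsilon> * w i) (R i)"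
    and R0: "\<And>i. i \<in> S \<union> U \<Longrightarrow> R i (\<lambda>_. 0) = 0"
    and F_S: "\<And>i z. i \<in> S \<Longrightarrow> F z i = (\<Sum>j\<in>S. A i j * z j) + R i z"
    and F_U: "\<And>i z. i \<in> U \<Longrightarrow> F z i = (\<Sum>j\<in>U. B i j * z j) + R i z"
begin

text \<open>The value 0 off \<open>S\<close> and \<open>U\<close> makes the point over the origin
  literally the zero function.\<close>

definition graph_point :: "('i \<Rightarrow> ('i \<Rightarrow> 'k) \<Rightarrow> 'k) \<Rightarrow> ('i \<Rightarrow> 'k) \<Rightarrow> 'i \<Rightarrow> 'k" where
  "graph_point g x i = (if i \<in> S then x i else if i \<in> U then g i x else 0)"

text \<open>The stable components of \<open>F\<close> along the graph, that is, the dynamics induced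
  on the base of the graph. The value 0 off \<open>S\<close> makes the origin literally
  fixed.\<close>

definition base_map :: "('i \<Rightarrow> ('i \<Rightarrow> 'k) \<Rightarrow> 'k) \<Rightarrow> ('i \<Rightarrow> 'k) \<Rightarrow> 'i \<Rightarrow> 'k" where
  "base_map g x i = (if i \<in> S then (\<Sum>j\<in>S. A i j * x j) + R i (graph_point g x) else 0)"

text \<open>The graph of \<open>g\<close> is invariant if and only if \<open>g\<close> is a fixed point of this operator.\<close>

definition graph_op :: "('i \<Rightarrow> ('i \<Rightarrow> 'k) \<Rightarrow> 'k) \<Rightarrow> 'i \<Rightarrow> ('i \<Rightarrow> 'k) \<Rightarrow> 'k" where
  "graph_op g i x = (\<Sum>j\<in>U. D i j * (g j (base_map g x) - R j (graph_point g x)))"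

text \<open>The closed unit ball, for the norm weighted by \<open>w\<close>, among analytic graphs
  through the origin. The bound keeps the graph inside the polydisc; vanishing at 0 is what the
  contraction estimate uses.\<close>

definition admissible :: "('i \<Rightarrow> ('i \<Rightarrow> 'k) \<Rightarrow> 'k) \<Rightarrow> bool" where
  "admissible g \<longleftrightarrow> (\<forall>i\<in>U. tate S w (w i) (g i) \<and> g i (\<lambda>_. 0) = 0)"

lemma w_S: "b \<in> S \<Longrightarrow> 0 < w b" and w_U: "b \<in> U \<Longrightarrow> 0 < w b"
  using w by auto

lemma graph_point_tate:
  assumes "admissible g" "i \<in> S \<union> U"
  shows "tate S w (w i) (\<lambda>x. graph_point g x i)"
proof (cases "i \<in> S")
  case True
  then show ?thesis
    using tate_var[OF fin(1) True w_S] by (simp add: graph_point_def)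
next
  case False
  then show ?thesis
    using assms by (simp add: graph_point_def admissible_def)
qed

lemma graph_point_0: "admissible g \<Longrightarrow> graph_point g (\<lambda>_. 0) = (\<lambda>_. 0)"
  by (auto simp: graph_point_def admissible_def)

lemma base_map_0: "admissible g \<Longrightarrow> base_map g (\<lambda>_. 0) = (\<lambda>_. 0)"
  using R0 by (auto simp: base_map_def graph_point_0)

lemma R_graph_point_tate:
  assumes "admissible g" "i \<in> S \<union> U"
  shows "tate S w (\<theta> * w i) (\<lambda>x. R i (graph_point g x))"
proof -
  have "tate S w (\<epsilon> * w i) (\<lambda>x. R i (graph_point g x))"
    using tate_compose[where H = "\<lambda>b x. graph_point g x b", OF R[OF assms(2)] graph_point_tate[OF assms(1)] w_S]
    by simp
  moreover have "\<epsilon> * w i \<le> \<theta> * w i"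
    using \<epsilon> w[OF assms(2)] by (intro mult_right_mono) auto
  ultimately show ?thesis by (rule tate_mono)
qed

lemma base_map_tate:
  assumes "admissible g" "i \<in> S"
  shows "tate S w (\<theta> * w i) (\<lambda>x. base_map g x i)"
proof -
  have "tate S w (\<theta> * w i) (\<lambda>x. (\<Sum>j\<in>S. A i j * x j) + R i (graph_point g x))"
  proof (intro tate_add tate_sum fin w_S)
    show "tate S w (\<theta> * w i) (\<lambda>x. A i j * x j)" if "j \<in> S" for j
    proof -
      have "tate S w (w j) (\<lambda>x. x j :: 'k)"
        by (rule tate_var[OF fin(1) that w_S])
      then show ?thesis
        by (rule tate_mono[OF tate_cmult A[OF assms(2) that]])
    qed
    show "tate S w (\<theta> * w i) (\<lambda>x. R i (graph_point g x))"
      using R_graph_point_tate assms by blast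
    show "0 \<le> \<theta> * w i"
      using \<theta> w_S[OF assms(2)] by simp
  qed
  then show ?thesis
    using assms(2) by (simp add: base_map_def)
qed

lemma D_sum_tate:
  assumes "\<And>j. j \<in> U \<Longrightarrow> tate S w (\<delta> * w j) (Y j)" "i \<in> U" "0 \<le> \<delta>"
  shows "tate S w (\<beta> * \<delta> * w i) (\<lambda>x. \<Sum>j\<in>U. D i j * Y j x)"
proof (intro tate_sum fin w_S)
  show "tate S w (\<beta> * \<delta> * w i) (\<lambda>x. D i j * Y j x)" if "j \<in> U" for j
  proof (rule tate_mono[OF tate_cmult[OF assms(1)[OF that]]])
    show "unorm (D i j) * (\<delta> * w j) \<le> \<beta> * \<delta> * w i"
      using mult_left_mono[OF D[OF assms(2) that] assms(3)] by (simp add: mult_ac)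
  qed
  show "0 \<le> \<beta> * \<delta> * w i"
    using \<beta> assms(3) w_U[OF assms(2)] by simp
qed

text \<open>The base map contracts by \<theta> and \<open>g\<close> vanishes at 0, so
  \<open>g\<close> along the base map has bound \<theta>; the remainder is bounded by \<epsilon>
  \<le> \<theta>; applying \<open>D\<close> costs the factor \<beta>.\<close>

lemma graph_op_tate:
  assumes g: "admissible g" and i: "i \<in> U"
  shows "tate S w (\<beta> * \<theta> * w i) (graph_op g i)"
proof -
  have "tate S w (\<beta> * \<theta> * w i) (\<lambda>x. \<Sum>j\<in>U. D i j * (g j (base_map g x) - R j (graph_point g x)))"
  proof (rule D_sum_tate[where Y = "\<lambda>j x. g j (base_map g x) - R j (graph_point g x)", OF _ i])
    fix j assume j: "j \<in> U"
    have gj: "tate S w (w j) (g j)" "g j (\<lambda>_. 0) = 0"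
      using g j by (auto simp: admissible_def)
    have "tate S w (\<theta> * w j) (\<lambda>x. g j (base_map g x))"
      by (rule tate_compose_vanishing[where F = "g j" and H = "base_map g",
            OF gj w_S less_imp_le[OF w_S] less_imp_le[OF \<theta>(1)] \<theta>(2) base_map_tate[OF g]])
    then show "tate S w (\<theta> * w j) (\<lambda>x. g j (base_map g x) - R j (graph_point g x))"
      by (rule tate_diff[OF _ R_graph_point_tate[OF g] w_S]) (use j in simp)
  qed (use \<theta> in simp)
  then show ?thesis
    unfolding graph_op_def[abs_def] .
qed

lemma graph_op_admissible:
  assumes g: "admissible g"
  shows "admissible (graph_op g)"
  unfolding admissible_def
proof (intro ballI conjI)
  fix i assume i: "i \<in> U"
  have "\<beta> * \<theta> * w i \<le> 1 * w i"
    using \<beta> w_U[OF i] by (intro mult_right_mono) auto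
  then show "tate S w (w i) (graph_op g i)"
    using tate_mono[OF graph_op_tate[OF g i]] by simp
  show "graph_op g i (\<lambda>_. 0) = 0"
    using g R0 unfolding graph_op_def base_map_0[OF g] graph_point_0[OF g]
    by (intro sum.neutral) (auto simp: admissible_def)
qed

text \<open>The difference splits into \<open>g - g'\<close> along one base map, which gains
  \<theta> since it vanishes at 0, the variation of \<open>g'\<close> between the two base maps, and
  the variation of \<open>R\<close>. The last two are bounded through \<epsilon> \<le> \<theta>, and
  the ultrametric inequality takes the maximum of the three.\<close>

lemma graph_op_contraction:
  assumes g: "admissible g" and g': "admissible g'" and \<delta>: "0 \<le> \<delta>"
    and diff: "\<And>j. j \<in> U \<Longrightarrow> tate S w (\<delta> * w j) (\<lambda>x. g j x - g' j x)" and i: "i \<in> U"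
  shows "tate S w (\<beta> * \<theta> * \<delta> * w i) (\<lambda>x. graph_op g i x - graph_op g' i x)"
proof -
  have gp: "tate S w (\<delta> * w j) (\<lambda>x. graph_point g x j - graph_point g' x j)" if "j \<in> S \<union> U" for j
  proof (cases "j \<in> S")
    case True
    then show ?thesis
      using \<delta> w_S tate_zero[of "\<delta> * w j" S w] by (simp add: graph_point_def less_imp_le)
  next
    case False
    then show ?thesis
      using diff that by (simp add: graph_point_def)
  qed
  have \<delta>\<epsilon>: "0 \<le> \<delta> * \<epsilon>"
    using \<delta> \<epsilon> by simp
  have le: "\<delta> * \<epsilon> * w j \<le> \<theta> * \<delta> * w j" if "j \<in> S \<union> U" for j
    using \<delta> mult_left_mono[OF \<epsilon>(2) \<delta>] w[OF that] by (intro mult_right_mono) (auto simp: mult.commute)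
  have Rd: "tate S w (\<delta> * \<epsilon> * w j) (\<lambda>x. R j (graph_point g x) - R j (graph_point g' x))"
    if "j \<in> S \<union> U" for j
    using tate_compose_diff[where H = "\<lambda>b x. graph_point g x b" and H' = "\<lambda>b x. graph_point g' x b",
        OF R[OF that] w_S \<delta> graph_point_tate[OF g] graph_point_tate[OF g'] gp]
    by (simp add: mult.assoc)
  have bm: "tate S w (\<delta> * \<epsilon> * w j) (\<lambda>x. base_map g x j - base_map g' x j)" if "j \<in> S" for j
    using Rd[of j] that by (simp add: base_map_def)
  have bm1: "tate S w (w j) (\<lambda>x. base_map g x j)" if "admissible g" "j \<in> S" for g j
    by (rule tate_mono[OF base_map_tate[OF that] mult_le_weight[OF less_imp_le[OF w_S[OF that(2)]] \<theta>(2)]])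
  have "tate S w (\<beta> * (\<theta> * \<delta>) * w i) (\<lambda>x. \<Sum>j\<in>U. D i j *
     ((g j (base_map g x) - R j (graph_point g x)) - (g' j (base_map g' x) - R j (graph_point g' x))))"
  proof (rule D_sum_tate[where Y = "\<lambda>j x. (g j (base_map g x) - R j (graph_point g x)) -
      (g' j (base_map g' x) - R j (graph_point g' x))", OF _ i])
    fix j assume j: "j \<in> U"
    have "g j (\<lambda>_. 0) - g' j (\<lambda>_. 0) = 0"
      using g g' j by (simp add: admissible_def)
    from tate_compose_vanishing[where F = "\<lambda>x. g j x - g' j x" and H = "base_map g",
        OF diff[OF j] this w_S less_imp_le[OF w_S] less_imp_le[OF \<theta>(1)] \<theta>(2) base_map_tate[OF g]]
    have 1: "tate S w (\<theta> * \<delta> * w j) (\<lambda>x. g j (base_map g x) - g' j (base_map g x))"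
      by (simp add: mult.assoc)
    have "tate S w (w j) (g' j)"
      using g' j by (simp add: admissible_def)
    from tate_compose_diff[where H = "\<lambda>b x. base_map g x b" and H' = "\<lambda>b x. base_map g' x b",
        OF this w_S \<delta>\<epsilon> bm1[OF g] bm1[OF g'] bm]
    have "tate S w (\<delta> * \<epsilon> * w j) (\<lambda>x. g' j (base_map g x) - g' j (base_map g' x))"
      by simp
    then have 2: "tate S w (\<theta> * \<delta> * w j) (\<lambda>x. g' j (base_map g x) - g' j (base_map g' x))"
      by (rule tate_mono) (use le j in blast)
    have 3: "tate S w (\<theta> * \<delta> * w j) (\<lambda>x. R j (graph_point g x) - R j (graph_point g' x))"
      using j by (intro tate_mono[OF Rd le]) auto
    have "tate S w (\<theta> * \<delta> * w j) (\<lambda>x. ((g j (base_map g x) - g' j (base_map g x)) +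
        (g' j (base_map g x) - g' j (base_map g' x))) - (R j (graph_point g x) - R j (graph_point g' x)))"
      by (rule tate_diff[OF tate_add[OF 1 2 w_S] 3 w_S])
    then show "tate S w (\<theta> * \<delta> * w j) (\<lambda>x. (g j (base_map g x) - R j (graph_point g x)) -
        (g' j (base_map g' x) - R j (graph_point g' x)))"
      by (simp add: algebra_simps)
  qed (use \<theta> \<delta> in simp)
  then show ?thesis
    by (simp add: graph_op_def sum_subtractf right_diff_distrib mult.assoc)
qed

section \<open>The fixed point of the graph operator\<close>

definition approx :: "nat \<Rightarrow> 'i \<Rightarrow> ('i \<Rightarrow> 'k) \<Rightarrow> 'k" where
  "approx n = (graph_op ^^ n) (\<lambda>_ _. 0)"

lemma approx_admissible: "admissible (approx n)"
proof (induction n)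
  case 0
  then show ?case
    using w_U w_S by (auto simp: approx_def admissible_def intro!: tate_zero less_imp_le)
qed (simp add: approx_def graph_op_admissible)

lemma approx_step: "i \<in> U \<Longrightarrow> tate S w ((\<beta> * \<theta>) ^ n * w i) (\<lambda>x. approx (Suc n) i x - approx n i x)"
proof (induction n arbitrary: i)
  case 0
  then show ?case
    using approx_admissible[of 1] by (simp add: approx_def admissible_def)
next
  case (Suc n)
  have "tate S w (\<beta> * \<theta> * (\<beta> * \<theta>) ^ n * w i) (\<lambda>x. graph_op (approx (Suc n)) i x - graph_op (approx n) i x)"
    using Suc \<beta> \<theta> by (intro graph_op_contraction approx_admissible) auto
  then show ?case
    by (simp add: approx_def)
qed

text \<open>The limit of the iteration, written as a telescoping series starting from
  \<open>approx 0 = 0\<close>, so that \<open>tate_has_sum\<close> gives analyticity. The value is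
  significant only on the polydisc, where the series is known to converge.\<close>

definition graph_fun :: "'i \<Rightarrow> ('i \<Rightarrow> 'k) \<Rightarrow> 'k" where
  "graph_fun i x = infsum (\<lambda>n. approx (Suc n) i x - approx n i x) UNIV"

lemma null_fam_geometric: "null_fam J (\<lambda>n. (\<beta> * \<theta>) ^ n * c)"
proof -
  have "(\<lambda>n. (\<beta> * \<theta>) ^ n * c) \<longlonglongrightarrow> 0 * c"
    using \<beta> \<theta> by (intro tendsto_mult_right LIMSEQ_power_zero) simp
  then have "null_fam UNIV (\<lambda>n. (\<beta> * \<theta>) ^ n * c)"
    by (intro null_fam_seq) simp
  then show ?thesis
    unfolding null_fam_def by (auto elim!: rev_finite_subset)
qed

lemma graph_fun_has_sum:
  assumes "i \<in> U" "\<And>b. b \<in> S \<Longrightarrow> unorm (x b) \<le> w b"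
  shows "((\<lambda>n. approx (Suc n) i x - approx n i x) has_sum graph_fun i x) UNIV"
proof -
  have "null_fam UNIV (\<lambda>n. unorm (approx (Suc n) i x - approx n i x))"
    using null_fam_geometric[of UNIV "w i"] by (rule null_fam_mono) (rule tate_bound[OF approx_step[OF assms(1)] assms(2)])
  then obtain s where "((\<lambda>n. approx (Suc n) i x - approx n i x) has_sum s) UNIV"
    by (rule null_imp_has_sum)
  then have "(\<lambda>n. approx (Suc n) i x - approx n i x) summable_on UNIV"
    unfolding summable_on_def by (rule exI)
  then show ?thesis
    unfolding graph_fun_def by (rule has_sum_infsum)
qed

text \<open>The difference is the tail of the telescoping series from index \<open>n\<close>, whose
  Gauss bounds are largest at its first term. The case \<open>n = 0\<close> bounds the limit
  itself.\<close>

lemma graph_fun_approx: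
  assumes i: "i \<in> U"
  shows "tate S w ((\<beta> * \<theta>) ^ n * w i) (\<lambda>x. graph_fun i x - approx n i x)"
proof (rule tate_has_sum[where J = "{n..}" and C = "\<lambda>m. (\<beta> * \<theta>) ^ m * w i"
      and F = "\<lambda>m x. approx (Suc m) i x - approx m i x"])
  show "(\<beta> * \<theta>) ^ j * w i \<le> (\<beta> * \<theta>) ^ n * w i" if "j \<in> {n..}" for j
    using \<beta> \<theta> w_U[OF i] that by (intro mult_right_mono power_decreasing) auto
  show "0 \<le> (\<beta> * \<theta>) ^ n * w i"
    using \<beta> \<theta> w_U[OF i] by simp
  show "((\<lambda>m. approx (Suc m) i x - approx m i x) has_sum graph_fun i x - approx n i x) {n..}"
    if "\<And>b. b \<in> S \<Longrightarrow> unorm (x b) \<le> w b" for x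
  proof -
    have "(\<Sum>m<n. approx (Suc m) i x - approx m i x) = approx n i x - approx 0 i x"
      by (rule sum_lessThan_telescope)
    moreover have "approx 0 i x = 0"
      by (simp add: approx_def)
    ultimately have "(\<Sum>m<n. approx (Suc m) i x - approx m i x) = approx n i x"
      by simp
    then have "((\<lambda>m. approx (Suc m) i x - approx m i x) has_sum graph_fun i x - approx n i x) (UNIV - {..<n})"
      by (intro has_sum_Diff[OF graph_fun_has_sum[OF i that] has_sum_finiteI]) auto
    moreover have "UNIV - {..<n} = {n..}" by auto
    ultimately show ?thesis by simp
  qed
qed (use approx_step[OF i] null_fam_geometric w_S in auto)

lemma graph_fun_admissible: "admissible graph_fun"
  unfolding admissible_def
proof (intro ballI conjI)
  fix i assume i: "i \<in> U"
  show "tate S w (w i) (graph_fun i)"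
    using graph_fun_approx[OF i, of 0] by (simp add: approx_def)
  have "approx (Suc n) i (\<lambda>_. 0) - approx n i (\<lambda>_. 0) = 0" for n
    using approx_admissible[of n] approx_admissible[of "Suc n"] i by (simp add: admissible_def)
  then show "graph_fun i (\<lambda>_. 0) = 0"
    by (simp add: graph_fun_def)
qed

text \<open>Both sides are compared with \<open>approx (Suc n)\<close>: one by the contraction
  estimate, the other by the tail bound.\<close>

lemma graph_fun_fixed_point:
  assumes i: "i \<in> U" and x: "\<And>b. b \<in> S \<Longrightarrow> unorm (x b) \<le> w b"
  shows "graph_op graph_fun i x = graph_fun i x"
proof -
  have le: "unorm (graph_op graph_fun i x - graph_fun i x) \<le> (\<beta> * \<theta>) ^ Suc n * w i" for n
  proof -
    have "tate S w (\<beta> * \<theta> * (\<beta> * \<theta>) ^ n * w i) (\<lambda>x. graph_op graph_fun i x - graph_op (approx n) i x)"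
      using graph_fun_approx \<beta> \<theta> i
      by (intro graph_op_contraction graph_fun_admissible approx_admissible) auto
    from tate_bound[OF this x]
    have "unorm (graph_op graph_fun i x - approx (Suc n) i x) \<le> (\<beta> * \<theta>) ^ Suc n * w i"
      by (simp add: approx_def)
    from unorm_diff_le[OF this tate_bound[OF graph_fun_approx[OF i] x]]
    show ?thesis by simp
  qed
  have "(\<lambda>n. (\<beta> * \<theta>) ^ Suc n * w i) \<longlonglongrightarrow> 0 * w i"
    using \<beta> \<theta> by (intro tendsto_mult_right LIMSEQ_Suc[OF LIMSEQ_power_zero]) simp
  then have "unorm (graph_op graph_fun i x - graph_fun i x) \<le> 0"
    by (intro LIMSEQ_le_const) (use le in auto)
  then have "unorm (graph_op graph_fun i x - graph_fun i x) = 0"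
    using unorm_nonneg by (rule antisym)
  then show ?thesis by simp
qed

lemma graph_fun_tate: "i \<in> U \<Longrightarrow> tate S w (w i) (graph_fun i)"
  and graph_fun_0: "i \<in> U \<Longrightarrow> graph_fun i (\<lambda>_. 0) = 0"
  using graph_fun_admissible by (auto simp: admissible_def)

lemma graph_fun_depends:
  "i \<in> U \<Longrightarrow> (\<And>b. b \<in> S \<Longrightarrow> x b = y b) \<Longrightarrow> (\<And>b. b \<in> S \<Longrightarrow> unorm (x b) \<le> w b) \<Longrightarrow>
    graph_fun i x = graph_fun i y"
  using tate_depends[OF graph_fun_tate] by blast

text \<open>Applying \<open>B\<close> to the fixed point equation cancels \<open>D\<close>. Moving
  \<open>R\<close> to the left, this says that the image of a graph point has unstable components
  given by \<open>graph_fun\<close>.\<close>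

lemma graph_fun_invariance:
  assumes i: "i \<in> U" and x: "\<And>b. b \<in> S \<Longrightarrow> unorm (x b) \<le> w b"
  shows "(\<Sum>j\<in>U. B i j * graph_fun j x) = graph_fun i (base_map graph_fun x) - R i (graph_point graph_fun x)"
proof -
  have "(\<Sum>j\<in>U. B i j * graph_fun j x) = (\<Sum>j\<in>U. B i j * graph_op graph_fun j x)"
    using graph_fun_fixed_point[OF _ x] by (intro sum.cong) auto
  also have "\<dots> = graph_fun i (base_map graph_fun x) - R i (graph_point graph_fun x)"
    unfolding graph_op_def by (rule BD[OF i])
  finally show ?thesis .
qed

section \<open>Dynamics on the graph and away from it\<close>

lemma graph_point_polydisc:
  assumes "b \<in> S \<union> U" and x: "\<And>b. b \<in> S \<Longrightarrow> unorm (x b) \<le> w b"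
  shows "unorm (graph_point graph_fun x b) \<le> w b"
  using tate_bound[OF graph_point_tate[OF graph_fun_admissible assms(1)] x] .

lemma base_map_bound:
  assumes "b \<in> S" "0 \<le> \<delta>" "\<delta> \<le> 1" and x: "\<And>b. b \<in> S \<Longrightarrow> unorm (x b) \<le> \<delta> * w b"
  shows "unorm (base_map graph_fun x b) \<le> \<delta> * (\<theta> * w b)"
  using base_map_0[OF graph_fun_admissible] w_S assms
  by (intro tate_pointwise_vanishing[OF base_map_tate[OF graph_fun_admissible assms(1)]]) auto

text \<open>The scale \<delta> is kept free so that an induction can use it with
  \<open>\<delta> = \<theta> ^ n\<close>.\<close>

lemma graph_step:
  assumes z: "\<And>b. b \<in> S \<union> U \<Longrightarrow> unorm (z b) \<le> \<delta> * w b" and \<delta>: "0 \<le> \<delta>" "\<delta> \<le> 1"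
    and graph: "\<And>i. i \<in> U \<Longrightarrow> z i = graph_fun i z"
  shows "\<And>b. b \<in> S \<union> U \<Longrightarrow> unorm (F z b) \<le> \<theta> * \<delta> * w b"
    and "\<And>i. i \<in> U \<Longrightarrow> F z i = graph_fun i (F z)"
proof -
  have zw: "unorm (z b) \<le> w b" if "b \<in> S \<union> U" for b
    using z[OF that] mult_le_weight[OF less_imp_le[OF w[OF that]] \<delta>(2)] by linarith
  \<comment> \<open>A point of the graph agrees with \<open>graph_point graph_fun z\<close> on
    \<open>S\<close> and \<open>U\<close>, the only coordinates that \<open>R\<close> sees.\<close>
  have Req: "R i (graph_point graph_fun z) = R i z" if "i \<in> S \<union> U" for i
    using graph by (intro tate_depends[OF R[OF that]] graph_point_polydisc zw) (auto simp: graph_point_def)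
  have FS: "F z i = base_map graph_fun z i" if "i \<in> S" for i
    using that by (simp add: F_S base_map_def Req)
  have FSw: "unorm (F z b) \<le> \<theta> * \<delta> * w b" if "b \<in> S" for b
    using base_map_bound[OF that \<delta>, of z] z by (simp add: FS[OF that] mult_ac)
  have \<theta>\<delta>: "0 \<le> \<theta> * \<delta>" "\<theta> * \<delta> \<le> 1"
    using \<theta> \<delta> mult_mono[of \<theta> 1 \<delta> 1] by auto
  have FSw1: "unorm (F z b) \<le> w b" if "b \<in> S" for b
    using FSw[OF that] mult_le_weight[OF less_imp_le[OF w_S[OF that]] \<theta>\<delta>(2)] by linarith
  have FU: "F z i = graph_fun i (F z)" if "i \<in> U" for i
  proof -
    have "F z i = (\<Sum>j\<in>U. B i j * graph_fun j z) + R i z"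
      using graph by (simp add: F_U[OF that])
    also have "\<dots> = graph_fun i (base_map graph_fun z)"
      using graph_fun_invariance[OF that, of z] zw Req[of i] that by simp
    also have "\<dots> = graph_fun i (F z)"
      using FS FSw1 by (intro graph_fun_depends[OF that, symmetric])
    finally show ?thesis .
  qed
  then show "\<And>i. i \<in> U \<Longrightarrow> F z i = graph_fun i (F z)" .
  show "unorm (F z b) \<le> \<theta> * \<delta> * w b" if "b \<in> S \<union> U" for b
  proof (cases "b \<in> S")
    case False
    then have b: "b \<in> U"
      using that by blast
    have "unorm (graph_fun b (F z)) \<le> \<theta> * \<delta> * w b"
      by (rule tate_pointwise_vanishing[OF graph_fun_tate[OF b] graph_fun_0[OF b] w_S \<theta>\<delta> FSw])
    then show ?thesis
      using FU[OF b] by simp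
  qed (rule FSw)
qed

lemma graph_iterates:
  assumes z: "\<And>b. b \<in> S \<union> U \<Longrightarrow> unorm (z b) \<le> w b" and graph: "\<And>i. i \<in> U \<Longrightarrow> z i = graph_fun i z"
  shows "b \<in> S \<union> U \<Longrightarrow> unorm ((F ^^ n) z b) \<le> \<theta> ^ n * w b"
proof -
  have "(\<forall>b\<in>S \<union> U. unorm ((F ^^ n) z b) \<le> \<theta> ^ n * w b) \<and> (\<forall>i\<in>U. (F ^^ n) z i = graph_fun i ((F ^^ n) z))"
  proof (induction n)
    case (Suc n)
    then show ?case
      using graph_step[of "(F ^^ n) z" "\<theta> ^ n"] \<theta> by (simp add: power_le_one)
  qed (use z graph in simp)
  then show "b \<in> S \<union> U \<Longrightarrow> unorm ((F ^^ n) z b) \<le> \<theta> ^ n * w b" by blast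
qed

text \<open>In other words, \<open>F\<close> increases the distance from the graph, measured along the expanding
  directions, by a factor of at least \<open>1 / \<beta>\<close>.\<close>

lemma distance_step:
  assumes z: "\<And>b. b \<in> S \<union> U \<Longrightarrow> unorm (z b) \<le> w b"
    and Fz: "\<And>b. b \<in> S \<union> U \<Longrightarrow> unorm (F z b) \<le> w b"
    and \<tau>: "\<And>i. i \<in> U \<Longrightarrow> unorm (F z i - graph_fun i (F z)) \<le> \<tau> * w i" "0 \<le> \<tau>" and i: "i \<in> U"
  shows "unorm (z i - graph_fun i z) \<le> \<beta> * \<tau> * w i"
proof -
  \<comment> \<open>\<open>m\<close> is the weighted distance from \<open>z\<close> to the point of
    the graph with the same stable coordinates.\<close>
  obtain m where "0 \<le> m" and m: "\<And>i. i \<in> U \<Longrightarrow> unorm (z i - graph_fun i z) \<le> m * w i"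
    and m_eq: "m = 0 \<or> (\<exists>i\<in>U. unorm (z i - graph_fun i z) = m * w i)"
    using finite_weighted_max[OF fin(2), of w "\<lambda>i. unorm (z i - graph_fun i z)"] w_U by auto
  define z' where "z' = graph_point graph_fun z"
  have z': "unorm (z' b) \<le> w b" if "b \<in> S \<union> U" for b
    unfolding z'_def using that z by (intro graph_point_polydisc) auto
  have zz': "unorm (z b - z' b) \<le> m * w b" if "b \<in> S \<union> U" for b
  proof (cases "b \<in> S")
    case True
    then show ?thesis
      using \<open>0 \<le> m\<close> w_S[OF True] by (simp add: z'_def graph_point_def)
  next
    case False
    then show ?thesis
      using m that by (simp add: z'_def graph_point_def)
  qed
  have Rd: "unorm (R j z - R j z') \<le> m * (\<epsilon> * w j)" if "j \<in> S \<union> U" for j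
    by (rule tate_pointwise_Lipschitz[OF R[OF that] w \<open>0 \<le> m\<close> z z' zz'])
  have bm: "unorm (base_map graph_fun z b) \<le> w b" if "b \<in> S" for b
  proof -
    have "unorm (base_map graph_fun z b) \<le> \<theta> * w b"
      using base_map_bound[OF that, of 1 z] z by simp
    also have "\<dots> \<le> 1 * w b"
      using \<theta> w_S[OF that] by (intro mult_right_mono) auto
    finally show ?thesis by simp
  qed
  have Fb: "unorm (F z b - base_map graph_fun z b) \<le> m * \<epsilon> * w b" if "b \<in> S" for b
    using Rd[of b] that by (simp add: F_S base_map_def z'_def mult.assoc)
  have Gd: "unorm (graph_fun j (F z) - graph_fun j (base_map graph_fun z)) \<le> m * \<epsilon> * w j" if "j \<in> U" for j
    using Fz \<open>0 \<le> m\<close> \<epsilon> by (intro tate_pointwise_Lipschitz[OF graph_fun_tate[OF that] w_S _ _ bm Fb]) auto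
  \<comment> \<open>The error made when the deviation from the graph is propagated by
    \<open>B\<close> alone: the variation of \<open>R\<close>, and the change of the graph between
    the true and the induced base point.\<close>
  define e where "e j = (R j z - R j z') - (graph_fun j (F z) - graph_fun j (base_map graph_fun z))" for j
  have e: "unorm (e j) \<le> m * \<epsilon> * w j" if "j \<in> U" for j
    unfolding e_def by (rule unorm_diff_le[OF _ Gd[OF that]]) (use Rd[of j] that in \<open>simp add: mult.assoc\<close>)
  have "F z j - graph_fun j (F z) = (\<Sum>k\<in>U. B j k * (z k - graph_fun k z)) + e j" if "j \<in> U" for j
    using graph_fun_invariance[OF that, of z] z
    by (simp add: F_U[OF that] e_def z'_def right_diff_distrib sum_subtractf)
  then have Bz: "(\<Sum>k\<in>U. B j k * (z k - graph_fun k z)) = (F z j - graph_fun j (F z)) - e j" if "j \<in> U" for j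
    using that by (simp add: algebra_simps)
  have z_eq: "z i - graph_fun i z = (\<Sum>j\<in>U. D i j * ((F z j - graph_fun j (F z)) - e j))" if "i \<in> U" for i
  proof -
    have "(\<Sum>j\<in>U. D i j * (\<Sum>k\<in>U. B j k * (z k - graph_fun k z))) = z i - graph_fun i z"
      by (rule DB[OF that, of "\<lambda>k. z k - graph_fun k z"])
    then show ?thesis
      using Bz by simp
  qed
  define \<mu> where "\<mu> = max \<tau> (m * \<epsilon>)"
  have \<mu>: "0 \<le> \<mu>"
    using \<tau> by (simp add: \<mu>_def)
  have bound: "unorm (z i - graph_fun i z) \<le> \<beta> * \<mu> * w i" if i: "i \<in> U" for i
    unfolding z_eq[OF i]
  proof (rule unorm_sum_le)
    fix j assume j: "j \<in> U"
    have "\<tau> * w j \<le> \<mu> * w j" "m * \<epsilon> * w j \<le> \<mu> * w j"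
      using w_U[OF j] by (auto simp: \<mu>_def intro!: mult_right_mono)
    then have "unorm ((F z j - graph_fun j (F z)) - e j) \<le> \<mu> * w j"
      using \<tau>(1)[OF j] e[OF j] by (rule_tac unorm_diff_le) linarith+
    then have "unorm (D i j) * unorm ((F z j - graph_fun j (F z)) - e j) \<le> unorm (D i j) * (\<mu> * w j)"
      by (intro mult_left_mono) auto
    also have "\<dots> \<le> \<beta> * \<mu> * w i"
      using mult_left_mono[OF D[OF i j] \<mu>] by (simp add: mult_ac)
    finally show "unorm (D i j * ((F z j - graph_fun j (F z)) - e j)) \<le> \<beta> * \<mu> * w i"
      by (simp add: unorm_mult)
  qed (use \<beta> \<mu> w_U[OF i] in simp)
  \<comment> \<open>If the maximum in \<mu> were \<open>m * \<epsilon>\<close>, then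
    \<open>m \<le> \<beta> * \<epsilon> * m < m\<close>, which is impossible for
    \<open>m > 0\<close>; so \<mu> may be replaced by \<tau>.\<close>
  have "m \<le> \<beta> * \<tau>"
  proof (cases "m = 0")
    case True
    then show ?thesis
      using \<beta> \<tau> by simp
  next
    case False
    then obtain j where j: "j \<in> U" "unorm (z j - graph_fun j z) = m * w j"
      using m_eq by blast
    then have "m * w j \<le> \<beta> * \<mu> * w j"
      using bound[OF j(1)] by simp
    then have m_le: "m \<le> \<beta> * \<mu>"
      using w_U[OF j(1)] by simp
    have "\<beta> * \<epsilon> \<le> \<beta> * \<theta>"
      using \<beta> \<epsilon> by (intro mult_left_mono)
    then have "m * (\<beta> * \<epsilon>) < m * 1"
      using \<beta> False \<open>0 \<le> m\<close> by (intro mult_strict_left_mono) auto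
    then have "\<beta> * (m * \<epsilon>) < m"
      by (simp add: mult_ac)
    then show ?thesis
      using m_le by (auto simp: \<mu>_def max_def split: if_splits)
  qed
  then have "m * w i \<le> \<beta> * \<tau> * w i"
    using w_U[OF i] by (intro mult_right_mono) auto
  then show ?thesis
    using m[OF i] by linarith
qed

text \<open>The deviation from the graph is traced backwards: it is at most
  \<open>\<beta> ^ n\<close> times the deviation at time \<open>n\<close>. At a time when the orbit
  is within \<open>e * a ^ n\<close>, this is at most \<open>e * (\<beta> * a) ^ n\<close>, hence at
  most \<open>e\<close>. A single such time for each \<open>e\<close> is enough.\<close>

lemma graph_characterization:
  assumes orbit: "\<And>n b. b \<in> S \<union> U \<Longrightarrow> unorm ((F ^^ n) z b) \<le> w b"
    and a: "0 < a" "a \<le> 1" "\<beta> * a \<le> 1"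
    and small: "\<And>e. 0 < e \<Longrightarrow> \<exists>n. \<forall>b\<in>S \<union> U. unorm ((F ^^ n) z b) \<le> e * a ^ n * w b"
    and i: "i \<in> U"
  shows "z i = graph_fun i z"
proof -
  \<comment> \<open>The point is generalised because the induction step passes from \<open>z\<close>
    to \<open>F z\<close>.\<close>
  have *: "unorm (z i - graph_fun i z) \<le> \<beta> ^ n * \<tau> * w i"
    if "\<And>n b. b \<in> S \<union> U \<Longrightarrow> unorm ((F ^^ n) z b) \<le> w b" "0 \<le> \<tau>" "i \<in> U"
      "\<And>i. i \<in> U \<Longrightarrow> unorm ((F ^^ n) z i - graph_fun i ((F ^^ n) z)) \<le> \<tau> * w i" for n z \<tau> i
    using that
  proof (induction n arbitrary: z i)
    case (Suc n)
    have "unorm (F z j - graph_fun j (F z)) \<le> \<beta> ^ n * \<tau> * w j" if "j \<in> U" for j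
    proof (rule Suc.IH)
      show "unorm ((F ^^ m) (F z) b) \<le> w b" if "b \<in> S \<union> U" for m b
        using Suc.prems(1)[OF that, of "Suc m"] by (simp only: funpow_Suc_right o_def)
      show "unorm ((F ^^ n) (F z) i - graph_fun i ((F ^^ n) (F z))) \<le> \<tau> * w i" if "i \<in> U" for i
        using Suc.prems(4)[OF that] by (simp only: funpow_Suc_right o_def)
    qed (use Suc.prems that in auto)
    then have "unorm (z i - graph_fun i z) \<le> \<beta> * (\<beta> ^ n * \<tau>) * w i"
      using Suc.prems(1)[of _ 0] Suc.prems(1)[of _ 1] Suc.prems(2,3) \<beta>
      by (intro distance_step) auto
    then show ?case
      by (simp add: mult_ac)
  qed auto
  have "unorm (z i - graph_fun i z) \<le> e * w i" if "0 < e" "e \<le> 1" for e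
  proof -
    obtain n where n: "\<And>b. b \<in> S \<union> U \<Longrightarrow> unorm ((F ^^ n) z b) \<le> e * a ^ n * w b"
      using small[OF \<open>0 < e\<close>] by blast
    have ea: "0 \<le> e * a ^ n" "e * a ^ n \<le> 1"
      using that a mult_mono[of e 1 "a ^ n" 1] by (auto simp: power_le_one)
    have "unorm ((F ^^ n) z j - graph_fun j ((F ^^ n) z)) \<le> e * a ^ n * w j" if j: "j \<in> U" for j
    proof (rule unorm_diff_le)
      show "unorm (graph_fun j ((F ^^ n) z)) \<le> e * a ^ n * w j"
        by (rule tate_pointwise_vanishing[OF graph_fun_tate[OF j] graph_fun_0[OF j] w_S ea]) (use n in auto)
    qed (use n j in auto)
    then have "unorm (z i - graph_fun i z) \<le> \<beta> ^ n * (e * a ^ n) * w i"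
      using orbit i ea by (intro *) auto
    also have "\<dots> = e * (\<beta> * a) ^ n * w i"
      by (simp add: power_mult_distrib mult_ac)
    also have "\<dots> \<le> e * 1 * w i"
      using a \<beta> that w_U[OF i] by (intro mult_right_mono mult_left_mono power_le_one) auto
    finally show ?thesis by simp
  qed
  \<comment> \<open>The estimate is available only for \<open>e \<le> 1\<close>, so the limit is
    taken over the bounded interval from 0 to 1.\<close>
  then have "unorm (z i - graph_fun i z) / w i \<le> e" if "0 < e" "e < 1" for e
    using that w_U[OF i] by (simp add: field_simps)
  then have "unorm (z i - graph_fun i z) / w i \<le> 0"
    by (intro dense_ge_bounded[of 0 1]) auto
  then have "unorm (z i - graph_fun i z) \<le> 0"
    using w_U[OF i] by (simp add: divide_le_0_iff)
  then have "unorm (z i - graph_fun i z) = 0"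
    using unorm_nonneg by (rule antisym)
  then show ?thesis by simp
qed

end

subsection \<open>Powers of a map with integral eigenvalues\<close>

lemma absolute_value_extension_sum_le:
  assumes v: "absolute_value_extension v" and "\<And>i. i \<in> A \<Longrightarrow> v (f i) \<le> C" "0 \<le> C"
  shows "v (sum f A) \<le> C"
proof -
  have "v 0 = 0"
    using v unfolding absolute_value_extension_def by blast
  then show ?thesis
    using assms(2,3)
  proof (induction A rule: infinite_finite_induct)
    case (insert i A)
    have "v (f i + sum f A) \<le> max (v (f i)) (v (sum f A))"
      using v unfolding absolute_value_extension_def by blast
    also have "\<dots> \<le> C"
      using insert by simp
    finally show ?case
      using insert.hyps by simp
  qed auto
qed

lemma absolute_value_extension_minus:
  assumes v: "absolute_value_extension v"
  shows "v (- x) = v x"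
proof -
  have mult: "v (x * y) = v x * v y" and ac: "v (to_ac c) = unorm c" for x y c
    using v unfolding absolute_value_extension_def by blast+
  have "v (- x) = v (to_ac (-1) * x)"
    by simp
  also have "\<dots> = v x"
    by (simp only: mult ac unorm_minus unorm_one mult_1)
  finally show ?thesis .
qed

lemma coeff_linear_mult:
  fixes q :: "'a::comm_ring_1 poly"
  shows "poly.coeff ([:- \<mu>, 1:] * q) i = (case i of 0 \<Rightarrow> 0 | Suc j \<Rightarrow> poly.coeff q j) - \<mu> * poly.coeff q i"
  by (simp add: coeff_pCons split: nat.split)

text \<open>Algebraic closedness splits off a linear factor. The coefficients of
  \<open>[:- \<mu>, 1:] * q\<close> are differences of a coefficient of \<open>q\<close> and \<mu>
  times another, so the ultrametric inequality preserves the bound.\<close>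

lemma coeff_le_1_if_roots_le_1:
  fixes v :: "'k::complete_ultrametric_field alg_closure \<Rightarrow> real"
  assumes v: "absolute_value_extension v"
  shows "Polynomial.degree p = n \<Longrightarrow> Polynomial.lead_coeff p = 1 \<Longrightarrow> (\<And>\<mu>. poly p \<mu> = 0 \<Longrightarrow> v \<mu> \<le> 1) \<Longrightarrow> v (poly.coeff p i) \<le> 1"
proof (induction n arbitrary: p i)
  have v1: "v 1 = 1" and v0: "v 0 = 0"
    using v unfolding absolute_value_extension_def by (metis to_ac_1 unorm_one, blast)
  {
    case 0
    then have "p = 1"
      by (metis degree_0_id degree_eq_zeroE lead_coeff_pCons(2) one_pCons)
    then show ?case
      using v1 v0 by (simp add: coeff_1)
  next
    case (Suc n)
    then obtain \<mu> where \<mu>: "poly p \<mu> = 0"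
      using alg_closed_imp_poly_has_root[of p] by auto
    then have "[:- \<mu>, 1:] dvd p"
      by (simp only: poly_eq_0_iff_dvd)
    then obtain q where p: "p = [:- \<mu>, 1:] * q"
      by (rule dvdE)
    have "q \<noteq> 0"
      using Suc.prems p by auto
    then have "Polynomial.degree p = Suc (Polynomial.degree q)"
      unfolding p by (subst degree_mult_eq) auto
    then have "Polynomial.degree q = n"
      using Suc.prems(1) by simp
    moreover have "Polynomial.lead_coeff q = 1"
      using Suc.prems(2) unfolding p lead_coeff_mult by simp
    ultimately have q: "v (poly.coeff q j) \<le> 1" for j
      using Suc.prems(3) by (intro Suc.IH) (auto simp: p)
    have "v (\<mu> * poly.coeff q i) \<le> 1"
    proof -
      have "v (\<mu> * poly.coeff q i) = v \<mu> * v (poly.coeff q i)"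
        using v unfolding absolute_value_extension_def by blast
      also have "\<dots> \<le> 1 * 1"
        using q[of i] Suc.prems(3)[OF \<mu>] v
        by (intro mult_mono) (auto simp: absolute_value_extension_def)
      finally show ?thesis by simp
    qed
    moreover have "v (case i of 0 \<Rightarrow> 0 | Suc j \<Rightarrow> poly.coeff q j) \<le> 1"
      using q v0 by (simp split: nat.split)
    moreover have "v (x + - y) \<le> max (v x) (v (- y))" for x y
      using v unfolding absolute_value_extension_def by blast
    ultimately show ?case
      unfolding p coeff_linear_mult
      by (metis absolute_value_extension_minus[OF v] diff_conv_add_uminus max.bounded_iff order_trans)
  }
qed

context ultrametric_space
begin

text \<open>The coordinate form of \<alpha> tensored with the identity of the algebraic closure; it
  is the left-hand side of the eigenvalue equation in \<open>eigenvalue_ac\<close>.\<close>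

definition scalar_ext :: "('e \<Rightarrow> 'e) \<Rightarrow> ('e \<Rightarrow> 'k alg_closure) \<Rightarrow> 'e \<Rightarrow> 'k alg_closure" where
  "scalar_ext \<alpha> w b = (\<Sum>c\<in>Basis. to_ac (crd (\<alpha> c) b) * w c)"

text \<open>The vector obtained by applying the polynomial \<open>p\<close>, evaluated at the
  extended map, to \<open>w\<close>.\<close>

definition poly_ext :: "('e \<Rightarrow> 'e) \<Rightarrow> 'k alg_closure poly \<Rightarrow> ('e \<Rightarrow> 'k alg_closure) \<Rightarrow> 'e \<Rightarrow> 'k alg_closure" where
  "poly_ext \<alpha> p w b = (\<Sum>i\<le>Polynomial.degree p. poly.coeff p i * (scalar_ext \<alpha> ^^ i) w b)"

lemma scalar_ext_sum:
  "scalar_ext \<alpha> (\<lambda>b. \<Sum>i\<in>A. k i * u i b) b = (\<Sum>i\<in>A. k i * scalar_ext \<alpha> (u i) b)"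
  unfolding scalar_ext_def sum_distrib_left by (subst sum.swap) (simp add: mult.left_commute)

lemma scalar_ext_power_sum:
  "(scalar_ext \<alpha> ^^ n) (\<lambda>b. \<Sum>i\<in>A. k i * u i b) b = (\<Sum>i\<in>A. k i * (scalar_ext \<alpha> ^^ n) (u i) b)"
proof (induction n arbitrary: b)
  case (Suc n)
  then have "(scalar_ext \<alpha> ^^ n) (\<lambda>b. \<Sum>i\<in>A. k i * u i b) = (\<lambda>b. \<Sum>i\<in>A. k i * (scalar_ext \<alpha> ^^ n) (u i) b)"
    by blast
  then show ?case
    by (simp add: scalar_ext_sum)
qed simp

lemma scalar_ext_crd:
  assumes "Vector_Spaces.linear scale scale \<alpha>"
  shows "scalar_ext \<alpha> (\<lambda>b. to_ac (crd x b)) = (\<lambda>b. to_ac (crd (\<alpha> x) b))"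
proof
  fix b
  have "crd (\<alpha> x) b = (\<Sum>c\<in>Basis. crd (\<alpha> c) b * crd x c)"
    using linear_sum_Basis[OF assms, of "crd x"] by (simp add: crd_sum crd_scale mult.commute)
  then show "scalar_ext \<alpha> (\<lambda>b. to_ac (crd x b)) b = to_ac (crd (\<alpha> x) b)"
    by (simp add: scalar_ext_def to_ac_sum)
qed

lemma scalar_ext_power_crd:
  assumes "Vector_Spaces.linear scale scale \<alpha>"
  shows "(scalar_ext \<alpha> ^^ n) (\<lambda>b. to_ac (crd x b)) = (\<lambda>b. to_ac (crd ((\<alpha> ^^ n) x) b))"
  by (induction n) (simp_all add: scalar_ext_crd[OF assms])

text \<open>Once the product annihilates \<open>w\<close> while \<open>q\<close> does not, the
  vector \<open>poly_ext \<alpha> q w\<close> is an eigenvector for \<mu>.\<close>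

lemma poly_ext_linear_mult:
  "poly_ext \<alpha> ([:- \<mu>, 1:] * q) w b = scalar_ext \<alpha> (poly_ext \<alpha> q w) b - \<mu> * poly_ext \<alpha> q w b"
proof -
  define x where "x i = (scalar_ext \<alpha> ^^ i) w b" for i
  have "Polynomial.degree ([:- \<mu>, 1:] * q) \<le> Suc (Polynomial.degree q)"
    using degree_mult_le[of "[:- \<mu>, 1:]" q] by simp
  then have "poly_ext \<alpha> ([:- \<mu>, 1:] * q) w b = (\<Sum>i\<le>Suc (Polynomial.degree q). poly.coeff ([:- \<mu>, 1:] * q) i * x i)"
    unfolding poly_ext_def x_def
    by (intro sum.mono_neutral_left) (auto simp: coeff_eq_0 simp del: mult_pCons_left)
  also have "\<dots> = (\<Sum>i\<le>Suc (Polynomial.degree q). (case i of 0 \<Rightarrow> 0 | Suc j \<Rightarrow> poly.coeff q j) * x i) -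
      (\<Sum>i\<le>Suc (Polynomial.degree q). \<mu> * (poly.coeff q i * x i))"
    by (simp only: coeff_linear_mult left_diff_distrib sum_subtractf mult.assoc)
  also have "(\<Sum>i\<le>Suc (Polynomial.degree q). (case i of 0 \<Rightarrow> 0 | Suc j \<Rightarrow> poly.coeff q j) * x i) =
      (\<Sum>i\<le>Polynomial.degree q. poly.coeff q i * x (Suc i))"
    by (subst sum.atMost_Suc_shift) simp
  also have "\<dots> = scalar_ext \<alpha> (poly_ext \<alpha> q w) b"
    unfolding poly_ext_def[abs_def] scalar_ext_sum by (simp add: x_def)
  also have "(\<Sum>i\<le>Suc (Polynomial.degree q). \<mu> * (poly.coeff q i * x i)) = \<mu> * poly_ext \<alpha> q w b"
    by (simp add: poly_ext_def x_def sum_distrib_left coeff_eq_0)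
  finally show ?thesis .
qed

text \<open>Linear dependence concerns the set of iterates, so repetitions must be treated apart:
  they give \<open>X^j - X^i\<close>. Without repetition the orbit is infinite, hence dependent in
  finite dimension.\<close>

lemma exists_annihilating_polynomial:
  fixes \<alpha> :: "'e \<Rightarrow> 'e"
  obtains p :: "'k poly" where "p \<noteq> 0" "(\<Sum>i\<le>Polynomial.degree p. scale (poly.coeff p i) ((\<alpha> ^^ i) x)) = 0"
proof (cases "inj (\<lambda>i. (\<alpha> ^^ i) x)")
  case False
  then obtain i j where ij: "i < j" "(\<alpha> ^^ i) x = (\<alpha> ^^ j) x"
    unfolding inj_def by (metis linorder_neqE_nat)
  define p :: "'k poly" where "p = Polynomial.monom 1 j - Polynomial.monom 1 i"
  have deg: "Polynomial.degree p \<le> j"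
    unfolding p_def using ij(1) by (intro degree_diff_le) (auto intro: order_trans[OF degree_monom_le])
  have "(\<Sum>k\<le>Polynomial.degree p. scale (poly.coeff p k) ((\<alpha> ^^ k) x)) =
      (\<Sum>k\<le>j. scale (poly.coeff p k) ((\<alpha> ^^ k) x))"
    using deg by (intro sum.mono_neutral_left) (auto simp: coeff_eq_0)
  also have "\<dots> = (\<Sum>k\<le>j. (if k = j then (\<alpha> ^^ k) x else 0) - (if k = i then (\<alpha> ^^ k) x else 0))"
    by (intro sum.cong) (auto simp: p_def)
  also have "\<dots> = 0"
    using ij by (simp add: sum_subtractf)
  finally have "(\<Sum>k\<le>Polynomial.degree p. scale (poly.coeff p k) ((\<alpha> ^^ k) x)) = 0" .
  moreover have "poly.coeff p j \<noteq> 0"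
    using ij(1) by (simp add: p_def)
  then have "p \<noteq> 0" by auto
  ultimately show thesis
    using that by blast
next
  case True
  define f where "f = (\<lambda>i. (\<alpha> ^^ i) x)"
  have "infinite (range f)"
    using True by (simp add: f_def finite_image_iff)
  then have "dependent (range f)"
    using finiteI_independent by blast
  then obtain t u where t: "finite t" "t \<subseteq> range f" "(\<Sum>v\<in>t. scale (u v) v) = 0" "\<exists>v\<in>t. u v \<noteq> 0"
    unfolding dependent_explicit by blast
  define I where "I = f -` t"
  have inj: "inj f"
    using True by (simp add: f_def)
  have I: "finite I" "t = f ` I"
    using t(1,2) inj by (auto simp: I_def finite_vimageI)
  define p where "p = (\<Sum>i\<in>I. Polynomial.monom (u (f i)) i)"
  have coeff: "poly.coeff p k = (if k \<in> I then u (f k) else 0)" for k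
    using I(1) by (simp add: p_def coeff_sum)
  obtain k where k: "k \<in> I" "u (f k) \<noteq> 0"
    using t(4) I(2) by auto
  have "poly.coeff p k \<noteq> 0"
    using k by (simp add: coeff)
  then have "p \<noteq> 0" by auto
  have zero: "u (f k) = 0" if "k \<in> I" "\<not> k \<le> Polynomial.degree p" for k
    using le_degree[of p k] that coeff[of k] by auto
  have "(\<Sum>i\<le>Polynomial.degree p. scale (poly.coeff p i) (f i)) = (\<Sum>i\<in>I. scale (u (f i)) (f i))"
    by (intro sum.mono_neutral_cong I) (auto simp: coeff zero)
  also have "\<dots> = (\<Sum>v\<in>t. scale (u v) v)"
    unfolding I(2) using inj by (subst sum.reindex) (auto intro: inj_on_subset)
  finally have "(\<Sum>i\<le>Polynomial.degree p. scale (poly.coeff p i) ((\<alpha> ^^ i) x)) = 0"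
    using t(3) by (simp add: f_def)
  with \<open>p \<noteq> 0\<close> show thesis
    by (rule that)
qed

text \<open>Over the algebraic closure, each root of the monic polynomial of minimal degree annihilating a
  vector is an eigenvalue. If these have modulus at most 1, the polynomial has integral
  coefficients, so the orbit of the vector stays in the lattice spanned by finitely many iterates.\<close>

lemma orbit_bounded:
  assumes v: "absolute_value_extension v" and lin: "Vector_Spaces.linear scale scale \<alpha>"
    and eig: "eigenvalue_moduli v \<alpha> \<subseteq> {..1}"
  obtains C where "\<And>n b. b \<in> Basis \<Longrightarrow> unorm (crd ((\<alpha> ^^ n) x) b) \<le> C"
proof -
  define w where "w = (\<lambda>b. to_ac (crd x b))"
  define ann where "ann p \<longleftrightarrow> p \<noteq> 0 \<and> (\<forall>b\<in>Basis. poly_ext \<alpha> p w b = 0)" for p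
  have "\<exists>p. ann p"
  proof -
    obtain p :: "'k poly" where p: "p \<noteq> 0" "(\<Sum>i\<le>Polynomial.degree p. scale (poly.coeff p i) ((\<alpha> ^^ i) x)) = 0"
      by (rule exists_annihilating_polynomial)
    have "Polynomial.degree (map_poly to_ac p) = Polynomial.degree p"
      using p(1) by (simp add: degree_map_poly)
    then have "poly_ext \<alpha> (map_poly to_ac p) w b =
        to_ac (crd (\<Sum>i\<le>Polynomial.degree p. scale (poly.coeff p i) ((\<alpha> ^^ i) x)) b)" for b
      by (simp add: poly_ext_def w_def scalar_ext_power_crd[OF lin] coeff_map_poly crd_sum crd_scale to_ac_sum)
    moreover have "map_poly to_ac p \<noteq> 0"
      using p(1) by (simp add: map_poly_eq_0_iff)
    ultimately show ?thesis
      using p(2) by (auto simp: ann_def)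
  qed
  then obtain p0 where p0: "ann p0" and min: "\<And>q. ann q \<Longrightarrow> Polynomial.degree p0 \<le> Polynomial.degree q"
    using ex_has_least_nat[of ann _ Polynomial.degree] by blast
  define p where "p = Polynomial.smult (inverse (Polynomial.lead_coeff p0)) p0"
  have "Polynomial.lead_coeff p0 \<noteq> 0"
    using p0 by (simp add: ann_def)
  then have deg: "Polynomial.degree p = Polynomial.degree p0" and monic: "Polynomial.lead_coeff p = 1" and "p \<noteq> 0"
    by (auto simp: p_def)
  have p: "poly_ext \<alpha> p w b = 0" if "b \<in> Basis" for b
  proof -
    have "poly_ext \<alpha> p w b = inverse (Polynomial.lead_coeff p0) * poly_ext \<alpha> p0 w b"
      unfolding poly_ext_def deg by (simp add: p_def sum_distrib_left mult.assoc)
    then show ?thesis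
      using p0 that by (simp add: ann_def)
  qed
  have root: "v \<mu> \<le> 1" if "poly p \<mu> = 0" for \<mu>
  proof -
    have "[:- \<mu>, 1:] dvd p"
      using that by (simp only: poly_eq_0_iff_dvd)
    then obtain q where pq: "p = [:- \<mu>, 1:] * q"
      by (rule dvdE)
    have "q \<noteq> 0"
      using \<open>p \<noteq> 0\<close> pq by auto
    then have "Polynomial.degree p = Suc (Polynomial.degree q)"
      unfolding pq by (subst degree_mult_eq) auto
    \<comment> \<open>The degree of \<open>q\<close> is too small for it to annihilate
      \<open>w\<close>, so its value at \<open>w\<close> is a nonzero eigenvector.\<close>
    then have "\<not> ann q"
      using min[of q] deg by auto
    then have "\<exists>b\<in>Basis. poly_ext \<alpha> q w b \<noteq> 0"
      using \<open>q \<noteq> 0\<close> by (auto simp: ann_def)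
    moreover have "\<forall>b\<in>Basis. scalar_ext \<alpha> (poly_ext \<alpha> q w) b = \<mu> * poly_ext \<alpha> q w b"
      using p poly_ext_linear_mult[of \<alpha> \<mu> q w] by (simp add: pq)
    ultimately have "eigenvalue_ac \<alpha> \<mu>"
      unfolding eigenvalue_ac_def scalar_ext_def by blast
    then show ?thesis
      using eig by (auto simp: eigenvalue_moduli_def)
  qed
  define m where "m = Polynomial.degree p"
  have coeff: "v (poly.coeff p i) \<le> 1" for i
    using coeff_le_1_if_roots_le_1[OF v refl monic root] .
  \<comment> \<open>The recursion has to be an equality of functions, also off the basis, before
    further iterates can be applied to both sides.\<close>
  have zero_outside: "(scalar_ext \<alpha> ^^ i) w b = 0" if "b \<notin> Basis" for i b
    using that unfolding w_def scalar_ext_power_crd[OF lin]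
    by (metis representation_ne_zero to_ac_eq_0_iff)
  have "(scalar_ext \<alpha> ^^ m) w b = (\<Sum>i<m. - poly.coeff p i * (scalar_ext \<alpha> ^^ i) w b)" for b
  proof (cases "b \<in> Basis")
    case True
    have "(\<Sum>i<m. poly.coeff p i * (scalar_ext \<alpha> ^^ i) w b) + (scalar_ext \<alpha> ^^ m) w b = 0"
      using p[OF True] monic by (simp add: poly_ext_def m_def lessThan_Suc_atMost[symmetric])
    then show ?thesis
      by (simp add: sum_negf eq_neg_iff_add_eq_0 add.commute)
  qed (simp add: zero_outside)
  then have "(scalar_ext \<alpha> ^^ m) w = (\<lambda>b. \<Sum>i<m. - poly.coeff p i * (scalar_ext \<alpha> ^^ i) w b)"
    by blast
  then have rec: "(scalar_ext \<alpha> ^^ (k + m)) w b = (\<Sum>i<m. - poly.coeff p i * (scalar_ext \<alpha> ^^ (k + i)) w b)" for k b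
    by (simp only: funpow_add o_def scalar_ext_power_sum)
  have v0: "0 \<le> v y" for y
    using v unfolding absolute_value_extension_def by blast
  \<comment> \<open>A bound for the first \<open>m\<close> iterates. Every later one is a
    combination of the \<open>m\<close> preceding iterates with coefficients of modulus at most 1,
    so it obeys the same bound.\<close>
  define C where "C = (\<Sum>i<m. \<Sum>b\<in>Basis. v ((scalar_ext \<alpha> ^^ i) w b))"
  have "0 \<le> C"
    unfolding C_def by (intro sum_nonneg v0)
  have bound: "v ((scalar_ext \<alpha> ^^ n) w b) \<le> C" if "b \<in> Basis" for n b
  proof (induction n rule: less_induct)
    case (less n)
    show ?case
    proof (cases "n < m")
      case True
      have "v ((scalar_ext \<alpha> ^^ n) w b) \<le> (\<Sum>b\<in>Basis. v ((scalar_ext \<alpha> ^^ n) w b))"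
        using that finite_Basis v0 by (intro member_le_sum) auto
      also have "\<dots> \<le> C"
        unfolding C_def using True v0
        by (intro member_le_sum[where f = "\<lambda>i. \<Sum>b\<in>Basis. v ((scalar_ext \<alpha> ^^ i) w b)"] sum_nonneg) auto
      finally show ?thesis .
    next
      case False
      then obtain k where k: "n = k + m"
        by (metis add.commute le_Suc_ex not_le)
      have "v (- poly.coeff p i * (scalar_ext \<alpha> ^^ (k + i)) w b) \<le> C" if "i < m" for i
      proof -
        have "v (- poly.coeff p i * (scalar_ext \<alpha> ^^ (k + i)) w b) =
            v (- poly.coeff p i) * v ((scalar_ext \<alpha> ^^ (k + i)) w b)"
          using v unfolding absolute_value_extension_def by blast
        also have "\<dots> \<le> 1 * C"
          using less[of "k + i"] that k coeff[of i] v0 \<open>0 \<le> C\<close>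
          by (intro mult_mono) (auto simp: absolute_value_extension_minus[OF v])
        finally show ?thesis by simp
      qed
      then show ?thesis
        unfolding k rec using \<open>0 \<le> C\<close> by (intro absolute_value_extension_sum_le[OF v]) auto
    qed
  qed
  have "unorm (crd ((\<alpha> ^^ n) x) b) \<le> C" if "b \<in> Basis" for n b
  proof -
    have "unorm (crd ((\<alpha> ^^ n) x) b) = v (to_ac (crd ((\<alpha> ^^ n) x) b))"
      using v unfolding absolute_value_extension_def by simp
    then show ?thesis
      using bound[OF that, of n] by (simp add: w_def scalar_ext_power_crd[OF lin])
  qed
  then show thesis
    by (rule that)
qed

lemma linear_funpow:
  "Vector_Spaces.linear scale scale \<alpha> \<Longrightarrow> Vector_Spaces.linear scale scale (\<alpha> ^^ n)"
  by (induction n) (auto simp: Vector_Spaces.linear_iff)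

text \<open>Orbit bounds for individual vectors become uniform because only the finitely many basis
  vectors have to be considered.\<close>

lemma power_bounded:
  assumes v: "absolute_value_extension v" and lin: "Vector_Spaces.linear scale scale \<alpha>"
    and eig: "eigenvalue_moduli v \<alpha> \<subseteq> {..1}"
  obtains C where "C > 0" "\<And>n x. unorm ((\<alpha> ^^ n) x) \<le> C * unorm x"
proof -
  have "\<forall>x. \<exists>C. \<forall>n. \<forall>b\<in>Basis. unorm (crd ((\<alpha> ^^ n) x) b) \<le> C"
  proof
    fix x
    show "\<exists>C. \<forall>n. \<forall>b\<in>Basis. unorm (crd ((\<alpha> ^^ n) x) b) \<le> C"
      by (rule orbit_bounded[OF assms, of x]) blast
  qed
  from choice[OF this] obtain C where C: "\<And>x n b. b \<in> Basis \<Longrightarrow> unorm (crd ((\<alpha> ^^ n) x) b) \<le> C x"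
    by blast
  define M where "M = 1 + (\<Sum>e\<in>Basis. \<bar>C e\<bar>)"
  have M: "\<bar>C e\<bar> \<le> M" if "e \<in> Basis" for e
  proof -
    have "\<bar>C e\<bar> \<le> (\<Sum>e\<in>Basis. \<bar>C e\<bar>)"
      using that finite_Basis by (intro member_le_sum) auto
    then show ?thesis by (simp add: M_def)
  qed
  have "M > 0"
    unfolding M_def by (intro add_pos_nonneg sum_nonneg) auto
  obtain K where "K > 0" and K: "\<And>x b. b \<in> Basis \<Longrightarrow> unorm (crd x b) \<le> K * unorm x"
    by (rule crd_bounded) blast
  obtain L where "L > 0" and L: "\<And>x B. 0 \<le> B \<Longrightarrow> (\<And>b. b \<in> Basis \<Longrightarrow> unorm (crd x b) \<le> B) \<Longrightarrow> unorm x \<le> L * B"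
    by (rule unorm_le_crd) blast
  show thesis
  proof (rule that)
    show "L * (K * M) > 0"
      using \<open>K > 0\<close> \<open>L > 0\<close> \<open>M > 0\<close> by simp
    fix n x
    have "unorm ((\<alpha> ^^ n) x) \<le> L * (K * unorm x * M)"
    proof (rule L)
      show "0 \<le> K * unorm x * M"
        using \<open>K > 0\<close> \<open>M > 0\<close> by simp
      fix b assume b: "b \<in> Basis"
      have "crd ((\<alpha> ^^ n) x) b = (\<Sum>e\<in>Basis. crd x e * crd ((\<alpha> ^^ n) e) b)"
        using linear_sum_Basis[OF linear_funpow[OF lin], of n "crd x"] by (simp add: crd_sum crd_scale)
      also have "unorm \<dots> \<le> K * unorm x * M"
      proof (rule unorm_sum_le)
        fix e assume e: "e \<in> Basis"
        have "unorm (crd ((\<alpha> ^^ n) e) b) \<le> M"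
          using C[OF b, of n e] M[OF e] by linarith
        then show "unorm (crd x e * crd ((\<alpha> ^^ n) e) b) \<le> K * unorm x * M"
          unfolding unorm_mult using K[OF e, of x] \<open>K > 0\<close> by (intro mult_mono) auto
      qed (use \<open>K > 0\<close> \<open>M > 0\<close> in simp)
      finally show "unorm (crd ((\<alpha> ^^ n) x) b) \<le> K * unorm x * M" .
    qed
    then show "unorm ((\<alpha> ^^ n) x) \<le> L * (K * M) * unorm x"
      by (simp add: mult_ac)
  qed
qed

subsection \<open>Adapted coordinates\<close>

lemma linear_diff_eq:
  "Vector_Spaces.linear scale scale g \<Longrightarrow> g (x - y) = g x - g y"
  unfolding Vector_Spaces.linear_iff by (metis add_diff_cancel_right' diff_add_cancel)

lemma linear_continuous_at: "Vector_Spaces.linear scale scale g \<Longrightarrow> isCont g x"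
  by (intro analytic_at_imp_isCont analytic_at_linear)

lemma adapted_coordinates:
  assumes sub: "subspace Es" "subspace Eu" and int: "Es \<inter> Eu = {0}"
    and sum: "{x + y | x y. x \<in> Es \<and> y \<in> Eu} = UNIV"
    and N: "ultra_norm N" and t: "0 < t" "t < 1"
  obtains S U L L' where "S \<union> U = Basis" "S \<inter> U = {}"
    "Vector_Spaces.linear scale scale L" "Vector_Spaces.linear scale scale L'"
    "\<And>x. L' (L x) = x" "\<And>x. L (L' x) = x"
    "\<And>b. b \<in> S \<Longrightarrow> L b \<in> Es" "\<And>b. b \<in> U \<Longrightarrow> L b \<in> Eu"
    "\<And>x b. x \<in> Es \<Longrightarrow> b \<in> U \<Longrightarrow> crd (L' x) b = 0" "\<And>x b. x \<in> Eu \<Longrightarrow> b \<in> S \<Longrightarrow> crd (L' x) b = 0"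
    "\<And>x b. x \<in> Es \<Longrightarrow> b \<in> S \<Longrightarrow> t * (unorm (crd (L' x) b) * N (L b)) \<le> N x"
    "\<And>x b. x \<in> Eu \<Longrightarrow> b \<in> U \<Longrightarrow> t * (unorm (crd (L' x) b) * N (L b)) \<le> N x"
proof -
  obtain Bs where Bs: "finite Bs" "independent Bs" "span Bs = Es"
    "\<And>u b. b \<in> Bs \<Longrightarrow> t * (unorm (u b) * N b) \<le> N (\<Sum>b\<in>Bs. scale (u b) b)"
    by (rule almost_orthogonal_basis[OF N sub(1) t]) blast
  obtain Bu where Bu: "finite Bu" "independent Bu" "span Bu = Eu"
    "\<And>u b. b \<in> Bu \<Longrightarrow> t * (unorm (u b) * N b) \<le> N (\<Sum>b\<in>Bu. scale (u b) b)"
    by (rule almost_orthogonal_basis[OF N sub(2) t]) blast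
  define B where "B = Bs \<union> Bu"
  have zero: "0 \<notin> Bs"
    using Bs(2) dependent_zero by blast
  have sup: "Bs \<subseteq> Es" "Bu \<subseteq> Eu"
    using span_superset[of Bs] span_superset[of Bu] Bs(3) Bu(3) by auto
  then have "Bs \<inter> Bu \<subseteq> {0}"
    unfolding int[symmetric] by (rule Int_mono)
  then have disj: "Bs \<inter> Bu = {}"
    using zero by auto
  have finB: "finite B"
    using Bs(1) Bu(1) by (simp add: B_def)
  have ind: "independent B"
  proof
    assume "dependent B"
    then obtain u where u: "\<exists>v\<in>B. u v \<noteq> 0" "(\<Sum>v\<in>B. scale (u v) v) = 0"
      unfolding dependent_finite[OF finB] by blast
    define x where "x = (\<Sum>v\<in>Bs. scale (u v) v)"
    define y where "y = (\<Sum>v\<in>Bu. scale (u v) v)"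
    have "x \<in> Es" "y \<in> Eu"
      unfolding x_def y_def using sup sub by (auto intro!: subspace_sum subspace_scale)
    moreover have xy: "x + y = 0"
      using u(2) disj Bs(1) Bu(1) by (simp add: B_def x_def y_def sum.union_disjoint)
    then have "x = - y"
      by (simp add: eq_neg_iff_add_eq_0)
    ultimately have "x \<in> Es \<inter> Eu"
      using subspace_neg[OF sub(2)] by auto
    then have "x = 0"
      unfolding int by simp
    then have "y = 0"
      using xy by simp
    have "u v = 0" if "v \<in> Bs" for v
      using independentD[OF Bs(2,1) order_refl _ that] \<open>x = 0\<close> by (simp add: x_def)
    moreover have "u v = 0" if "v \<in> Bu" for v
      using independentD[OF Bu(2,1) order_refl _ that] \<open>y = 0\<close> by (simp add: y_def)
    ultimately show False
      using u(1) by (auto simp: B_def)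
  qed
  have span: "span B = UNIV"
    unfolding B_def span_Un Bs(3) Bu(3) using sum by auto
  \<comment> \<open>Equal cardinality yields the matching \<sigma> that defines \<open>L\<close>;
    \<open>S\<close> and \<open>U\<close> record to which subspace a basis vector is sent.\<close>
  have "card Basis = card B"
    using dim_eq_card[of B UNIV] span ind by simp
  then obtain \<sigma> where \<sigma>: "bij_betw \<sigma> Basis B"
    using finite_same_card_bij[OF finite_Basis finB] by blast
  define S where "S = {b\<in>Basis. \<sigma> b \<in> Bs}"
  define U where "U = {b\<in>Basis. \<sigma> b \<in> Bu}"
  have \<sigma>B: "\<sigma> b \<in> B" if "b \<in> Basis" for b
    using \<sigma> that by (auto simp: bij_betw_def)
  have SU: "S \<union> U = Basis" "S \<inter> U = {}"
    using \<sigma>B disj by (auto simp: S_def U_def B_def)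
  define L where "L x = (\<Sum>b\<in>Basis. scale (crd x b) (\<sigma> b))" for x
  define L' where "L' y = of_crd (\<lambda>b. representation B y (\<sigma> b))" for y
  have L_basis: "L b = \<sigma> b" if "b \<in> Basis" for b
  proof -
    have "L b = (\<Sum>b'\<in>Basis. if b' = b then \<sigma> b' else 0)"
      unfolding L_def using that by (intro sum.cong) (auto simp: crd_basis)
    then show ?thesis
      using that finite_Basis by simp
  qed
  have lin: "Vector_Spaces.linear scale scale L"
    unfolding Vector_Spaces.linear_iff
    by (auto simp: L_def crd_add crd_scale scale_left_distrib sum.distrib scale_sum_right vector_space_axioms)
  have lin': "Vector_Spaces.linear scale scale L'"
    unfolding Vector_Spaces.linear_iff
  proof (intro conjI allI)
    show "L' (x + y) = L' x + L' y" for x y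
      using ind span by (simp add: L'_def representation_add of_crd_add)
    show "L' (scale c x) = scale c (L' x)" for c x
      using ind span by (simp add: L'_def representation_scale of_crd_def scale_sum_right)
  qed (rule vector_space_axioms)+
  have crd_L': "crd (L' x) b = representation B x (\<sigma> b)" if "b \<in> Basis" for x b
    using that by (simp add: L'_def)
  have LL': "L (L' x) = x" for x
  proof -
    have "L (L' x) = (\<Sum>b\<in>Basis. scale (representation B x (\<sigma> b)) (\<sigma> b))"
      unfolding L_def using crd_L' by (intro sum.cong) auto
    also have "\<dots> = (\<Sum>v\<in>B. scale (representation B x v) v)"
      by (rule sum.reindex_bij_betw[OF \<sigma>])
    also have "\<dots> = x"
      using sum_representation_eq[OF ind _ finB] span by auto
    finally show ?thesis .
  qed
  have "inj_on L UNIV"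
  proof (rule inj_onI)
    fix x y assume "L x = L y"
    then have "L (x - y) = 0"
      by (simp add: linear_diff_eq[OF lin])
    then have "(\<Sum>b\<in>Basis. scale (crd (x - y) b) (\<sigma> b)) = 0"
      by (simp add: L_def)
    then have "(\<Sum>v\<in>B. scale (crd (x - y) (inv_into Basis \<sigma> v)) v) = 0"
      using sum.reindex_bij_betw[OF \<sigma>, of "\<lambda>v. scale (crd (x - y) (inv_into Basis \<sigma> v)) v"] \<sigma>
      by (simp add: bij_betw_def inv_into_f_f cong: sum.cong)
    then have *: "crd (x - y) (inv_into Basis \<sigma> v) = 0" if "v \<in> B" for v
      by (rule independentD[OF ind finB order_refl _ that])
    have "crd (x - y) b = 0" if "b \<in> Basis" for b
      using *[OF \<sigma>B[OF that]] bij_betw_inv_into_left[OF \<sigma> that] by simp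
    then have "x - y = 0"
      by (intro crd_eqI) simp
    then show "x = y" by simp
  qed
  then have L'L: "L' (L x) = x" for x
    using LL'[of "L x"] by (auto dest: inj_onD)
  have reps: "representation B x v = representation Bs x v" if "x \<in> Es" for x v
    using representation_extend[OF ind, of x Bs] that Bs(3) by (simp add: B_def)
  have repu: "representation B x v = representation Bu x v" if "x \<in> Eu" for x v
    using representation_extend[OF ind, of x Bu] that Bu(3) by (simp add: B_def)
  show thesis
  proof (rule that[OF SU lin lin' L'L LL'])
    show "L b \<in> Es" if "b \<in> S" for b
      using that Bs(3) span_base by (auto simp: S_def L_basis)
    show "L b \<in> Eu" if "b \<in> U" for b
      using that Bu(3) span_base by (auto simp: U_def L_basis)
    show "crd (L' x) b = 0" if "x \<in> Es" "b \<in> U" for x b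
      using that disj representation_ne_zero[of Bs x "\<sigma> b"] by (auto simp: U_def crd_L' reps)
    show "crd (L' x) b = 0" if "x \<in> Eu" "b \<in> S" for x b
      using that disj representation_ne_zero[of Bu x "\<sigma> b"] by (auto simp: S_def crd_L' repu)
    show "t * (unorm (crd (L' x) b) * N (L b)) \<le> N x" if "x \<in> Es" "b \<in> S" for x b
      using Bs(4)[of "\<sigma> b" "representation Bs x"] that sum_representation_eq[OF Bs(2), of x Bs] Bs(1,3)
      by (auto simp: S_def crd_L' reps L_basis)
    show "t * (unorm (crd (L' x) b) * N (L b)) \<le> N x" if "x \<in> Eu" "b \<in> U" for x b
      using Bu(4)[of "\<sigma> b" "representation Bu x"] that sum_representation_eq[OF Bu(2), of x Bu] Bu(1,3)
      by (auto simp: U_def crd_L' repu L_basis)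
  qed
qed

text \<open>A real supremum is informative only over a bounded set; finite dimension bounds the
  quotients, which makes \<open>op_norm\<close> an actual operator bound.\<close>

lemma op_norm_bound:
  assumes F: "subspace F" and add: "\<And>x y. x \<in> F \<Longrightarrow> y \<in> F \<Longrightarrow> g (x + y) = g x + g y"
    and hom: "\<And>c x. x \<in> F \<Longrightarrow> g (scale c x) = scale c (g x)" and N: "ultra_norm N"
  shows "0 \<le> op_norm N F g" and "x \<in> F \<Longrightarrow> N (g x) \<le> op_norm N F g * N x"
proof -
  obtain C where "C > 0" and C: "\<And>x. x \<in> F \<Longrightarrow> N (g x) \<le> C * N x"
    using linear_on_subspace_bounded[OF F add hom N N] by blast
  have bdd: "bdd_above ((\<lambda>x. N (g x) / N x) ` F)"
  proof (rule bdd_aboveI2)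
    fix x assume "x \<in> F"
    then show "N (g x) / N x \<le> C"
      using C[of x] ultra_norm_nonneg[OF N, of x] \<open>C > 0\<close>
      by (cases "N x = 0") (auto simp: divide_le_eq)
  qed
  have upper: "N (g x) / N x \<le> op_norm N F g" if "x \<in> F" for x
    unfolding op_norm_def using bdd that by (rule cSUP_upper2) simp
  show "0 \<le> op_norm N F g"
    using upper[of 0] F subspace_0 ultra_norm_eq_0[OF N, of 0] by simp
  show "N (g x) \<le> op_norm N F g * N x" if "x \<in> F"
  proof (cases "x = 0")
    case True
    have "g 0 = 0"
      using hom[of 0 0] F subspace_0 by simp
    then show ?thesis
      using True ultra_norm_eq_0[OF N, of 0] by simp
  next
    case False
    then have "0 < N x"
      using ultra_norm_nonneg[OF N, of x] ultra_norm_eq_0[OF N, of x] by linarith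
    then show ?thesis
      using upper[OF that] by (simp add: divide_le_eq)
  qed
qed

lemma finite_pos_lower_bound:
  fixes w :: "'a \<Rightarrow> real"
  assumes "finite A" "\<And>b. b \<in> A \<Longrightarrow> 0 < w b"
  obtains m where "0 < m" "\<And>b. b \<in> A \<Longrightarrow> m \<le> w b"
  using assms
proof (induction A arbitrary: thesis rule: finite_induct)
  case empty
  show ?case by (rule empty(1)[of 1]) auto
next
  case (insert b A)
  obtain m where "0 < m" "\<And>b. b \<in> A \<Longrightarrow> m \<le> w b"
    using insert.IH insert.prems(2) by blast
  then show ?case
    using insert.prems(2) by (intro insert.prems(1)[of "min m (w b)"]) (auto intro: min.coboundedI1)
qed

subsection \<open>The local stable manifold\<close>

lemma linear_zero_component:
  assumes lin: "Vector_Spaces.linear scale scale \<alpha>" and "S \<union> U = Basis" "S \<inter> U = {}"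
    and zero: "\<And>j. j \<in> U \<Longrightarrow> crd (\<alpha> j) i = 0"
  shows "crd (\<alpha> (of_crd z)) i = (\<Sum>j\<in>S. crd (\<alpha> j) i * z j)"
proof -
  have "crd (\<alpha> (of_crd z)) i = (\<Sum>j\<in>Basis. crd (\<alpha> j) i * z j)"
    by (simp add: linear_sum_Basis[OF lin] crd_sum crd_scale mult.commute)
  also have "\<dots> = (\<Sum>j\<in>S. crd (\<alpha> j) i * z j)"
    using assms(2,3) zero finite_Basis by (intro sum.mono_neutral_right) auto
  finally show ?thesis .
qed

text \<open>The hypothesis on the powers of \<open>\<alpha>\<close> provides arbitrarily small neighbourhoods of the fixed point
  that \<open>f\<close> maps into themselves, so that an orbit converging to the fixed point never leaves the
  domain of the local stable manifold again.\<close>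

lemma local_stable_manifold_split:
  assumes SU: "S \<union> U = Basis" "S \<inter> U = {}" and om: "\<And>b. b \<in> Basis \<Longrightarrow> 0 < om b"
    and block: "\<And>i j. i \<in> S \<Longrightarrow> j \<in> U \<Longrightarrow> crd (\<alpha> j) i = 0" "\<And>i j. i \<in> U \<Longrightarrow> j \<in> S \<Longrightarrow> crd (\<alpha> j) i = 0"
    and A: "\<And>i j. i \<in> S \<Longrightarrow> j \<in> S \<Longrightarrow> unorm (crd (\<alpha> j) i) * om j \<le> \<theta> * om i"
    and D: "\<And>i j. i \<in> U \<Longrightarrow> j \<in> U \<Longrightarrow> unorm (D i j) * om j \<le> \<beta> * om i"
    and BD: "\<And>i y. i \<in> U \<Longrightarrow> (\<Sum>j\<in>U. crd (\<alpha> j) i * (\<Sum>k\<in>U. D j k * y k)) = y i"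
    and DB: "\<And>i y. i \<in> U \<Longrightarrow> (\<Sum>j\<in>U. D i j * (\<Sum>k\<in>U. crd (\<alpha> k) j * y k)) = y i"
    and \<theta>: "0 < \<theta>" "\<theta> < a" and a: "a \<le> 1" and \<beta>: "0 \<le> \<beta>" "\<beta> * a < 1"
    and pow: "\<And>n x. unorm ((\<alpha> ^^ n) x) \<le> Cp * unorm x" and "0 < Cp"
    and f: "analytic_at f 0" "f 0 = 0" "has_frechet_derivative f \<alpha> 0"
    and V: "open V" "0 \<in> V"
  obtains \<Omega> \<Theta> \<Theta>' where "open \<Omega>" "0 \<in> \<Omega>" "\<Omega> \<subseteq> V" "f ` \<Omega> \<subseteq> \<Omega>"
    "open (\<Theta> ` \<Omega>)" "\<And>x. x \<in> \<Omega> \<Longrightarrow> \<Theta>' (\<Theta> x) = x"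
    "\<And>x. x \<in> \<Omega> \<Longrightarrow> analytic_at \<Theta> x" "\<And>y. y \<in> \<Theta> ` \<Omega> \<Longrightarrow> analytic_at \<Theta>' y"
    "\<And>x. x \<in> \<Omega> \<Longrightarrow> (\<forall>i\<in>U. crd (\<Theta> x) i = 0) \<longleftrightarrow> (\<lambda>n. unorm ((f ^^ n) x) / a ^ n) \<longlonglongrightarrow> 0"
proof -
  have lin: "Vector_Spaces.linear scale scale \<alpha>"
    using f(3) by (simp add: has_frechet_derivative_def)
  have a0: "0 < a"
    using \<theta> by linarith
  obtain \<alpha>' \<rho> C where \<alpha>': "has_frechet_derivative f \<alpha>' 0" and "0 < \<rho>" and
    "\<And>l b. 0 < l \<Longrightarrow> l \<le> 1 \<Longrightarrow> b \<in> Basis \<Longrightarrow>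
      tate Basis (\<lambda>_. l * \<rho>) (l\<^sup>2 * C) (\<lambda>z. crd (f (0 + of_crd z) - f 0 - \<alpha>' (of_crd z)) b)"
    using f(1) by (rule analytic_at_expansion) blast
  then have remainder: "\<And>l b. 0 < l \<Longrightarrow> l \<le> 1 \<Longrightarrow> b \<in> Basis \<Longrightarrow>
      tate Basis (\<lambda>_. l * \<rho>) (l\<^sup>2 * C) (\<lambda>z. crd (f (of_crd z) - \<alpha> (of_crd z)) b)"
    using has_frechet_derivative_unique[OF \<alpha>' f(3)] f(2) by simp
  obtain K where "K > 0" and K: "\<And>x b. b \<in> Basis \<Longrightarrow> unorm (crd x b) \<le> K * unorm x"
    by (rule crd_bounded) blast
  obtain M where "M > 0" and M: "\<And>x B. 0 \<le> B \<Longrightarrow> (\<And>b. b \<in> Basis \<Longrightarrow> unorm (crd x b) \<le> B) \<Longrightarrow> unorm x \<le> M * B"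
    by (rule unorm_le_crd) blast
  obtain m where "0 < m" and m: "\<And>b. b \<in> Basis \<Longrightarrow> m \<le> om b"
    using finite_pos_lower_bound[where A = Basis and w = om] finite_Basis om by metis
  define W where "W = 1 + sum om Basis"
  have om_W: "om b \<le> W" if "b \<in> Basis" for b
    using member_le_sum[of b Basis om] that finite_Basis om by (auto simp: W_def less_imp_le)
  have "W > 0"
    unfolding W_def using om by (intro add_pos_nonneg sum_nonneg) (auto simp: less_imp_le)
  \<comment> \<open>The total loss in passing from weighted coordinates to \<open>unorm\<close>,
    through a power of \<alpha>, and back to weighted coordinates. A vector in the fraction
    \<open>1 / Q\<close> of the polydisc keeps its whole linear orbit in the polydisc.\<close>
  define Q where "Q = K * Cp * M * W / m"
  have "Q > 0"
    using \<open>K > 0\<close> \<open>0 < Cp\<close> \<open>M > 0\<close> \<open>W > 0\<close> \<open>0 < m\<close> by (simp add: Q_def)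
  \<comment> \<open>The bound \<theta> serves the graph transform, the bound \<open>1 / Q\<close>
    the invariance of the neighbourhood.\<close>
  define \<epsilon> where "\<epsilon> = min \<theta> (1 / Q)"
  have \<epsilon>: "0 < \<epsilon>" "\<epsilon> \<le> \<theta>" and \<epsilon>Q: "Q * \<epsilon> \<le> 1"
    using \<theta>(1) \<open>Q > 0\<close> by (auto simp: \<epsilon>_def min_def field_simps)
  obtain r where "0 < r" and r: "\<And>x. unorm x < r \<Longrightarrow> x \<in> V"
    using V by (auto simp: open_dist dist_unorm)
  \<comment> \<open>Three demands on the size of the polydisc: the expansion converges on it, the
    remainder, quadratic in \<kappa>, is at most \<epsilon> times the radii, and the polydisc lies
    in \<open>V\<close>; the factor 2 makes the last one strict.\<close>
  define \<kappa> where "\<kappa> = min (\<rho> / W) (min (\<epsilon> * m / ((W / \<rho>)\<^sup>2 * (\<bar>C\<bar> + 1))) (r / (2 * M * W)))"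
  have posC: "0 < (W / \<rho>)\<^sup>2 * (\<bar>C\<bar> + 1)"
    using \<open>W > 0\<close> \<open>0 < \<rho>\<close> by (intro mult_pos_pos) auto
  have "0 < \<kappa>"
    using \<open>W > 0\<close> \<open>0 < \<rho>\<close> \<open>0 < m\<close> \<epsilon> \<open>0 < r\<close> \<open>M > 0\<close> posC by (simp add: \<kappa>_def)
  have \<kappa>1: "\<kappa> * W / \<rho> \<le> 1"
  proof -
    have "\<kappa> \<le> \<rho> / W" by (simp add: \<kappa>_def)
    then show ?thesis
      using \<open>W > 0\<close> \<open>0 < \<rho>\<close> by (simp add: field_simps)
  qed
  have \<kappa>2: "\<kappa> * ((W / \<rho>)\<^sup>2 * (\<bar>C\<bar> + 1)) \<le> \<epsilon> * m"
  proof -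
    have "\<kappa> \<le> \<epsilon> * m / ((W / \<rho>)\<^sup>2 * (\<bar>C\<bar> + 1))" by (simp add: \<kappa>_def)
    then show ?thesis
      using posC by (simp only: pos_le_divide_eq)
  qed
  have \<kappa>3: "M * (\<kappa> * W) < r"
  proof -
    have "\<kappa> \<le> r / (2 * M * W)" by (simp add: \<kappa>_def)
    then have "M * (\<kappa> * W) \<le> r / 2"
      using \<open>W > 0\<close> \<open>M > 0\<close> by (simp add: field_simps)
    then show ?thesis
      using \<open>0 < r\<close> by linarith
  qed
  \<comment> \<open>Scaling all weights by one constant leaves the estimates for the linear blocks
    unchanged.\<close>
  define w where "w b = \<kappa> * om b" for b
  have w: "0 < w b" if "b \<in> Basis" for b
    using om[OF that] \<open>0 < \<kappa>\<close> by (simp add: w_def)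
  have w_le: "w b \<le> \<kappa> * W" if "b \<in> Basis" for b
    using om_W[OF that] \<open>0 < \<kappa>\<close> by (simp add: w_def)
  have w_ge: "\<kappa> * m \<le> w b" if "b \<in> Basis" for b
    using m[OF that] \<open>0 < \<kappa>\<close> by (simp add: w_def)
  have unorm_le_w: "unorm x \<le> M * (\<delta> * (\<kappa> * W))"
    if "0 \<le> \<delta>" "\<And>b. b \<in> Basis \<Longrightarrow> unorm (crd x b) \<le> \<delta> * w b" for x \<delta>
  proof (rule M)
    show "0 \<le> \<delta> * (\<kappa> * W)"
      using that \<open>0 < \<kappa>\<close> \<open>W > 0\<close> by simp
    show "unorm (crd x b) \<le> \<delta> * (\<kappa> * W)" if "b \<in> Basis" for b
      using \<open>\<And>b. b \<in> Basis \<Longrightarrow> unorm (crd x b) \<le> \<delta> * w b\<close>[OF that]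
        mult_left_mono[OF w_le[OF that] \<open>0 \<le> \<delta>\<close>] by linarith
  qed
  have crd_le_w: "unorm (crd x b) \<le> K * unorm x / (\<kappa> * m) * w b" if "b \<in> Basis" for x b
  proof -
    have "K * unorm x / (\<kappa> * m) * (\<kappa> * m) \<le> K * unorm x / (\<kappa> * m) * w b"
      using w_ge[OF that] \<open>K > 0\<close> \<open>0 < \<kappa>\<close> \<open>0 < m\<close> by (intro mult_left_mono) auto
    then show ?thesis
      using K[OF that, of x] \<open>0 < \<kappa>\<close> \<open>0 < m\<close> by simp
  qed
  define R where "R i z = crd (f (of_crd z) - \<alpha> (of_crd z)) i" for i z
  have R: "tate Basis w (\<epsilon> * w i) (R i)" if i: "i \<in> Basis" for i
  proof -
    \<comment> \<open>The expansion is known for equal radii only;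
      \<open>l * \<rho> = \<kappa> * W\<close> dominates every \<open>w b\<close>, after which the
      radii are reduced to \<open>w\<close>.\<close>
    define l where "l = \<kappa> * W / \<rho>"
    have l: "0 < l" "l \<le> 1"
      using \<open>0 < \<kappa>\<close> \<open>W > 0\<close> \<open>0 < \<rho>\<close> \<kappa>1 by (auto simp: l_def)
    have "l\<^sup>2 * C \<le> l\<^sup>2 * (\<bar>C\<bar> + 1)"
      by (intro mult_left_mono) auto
    also have "\<dots> = \<kappa> * (\<kappa> * ((W / \<rho>)\<^sup>2 * (\<bar>C\<bar> + 1)))"
      by (simp add: l_def power2_eq_square mult_ac)
    also have "\<dots> \<le> \<kappa> * (\<epsilon> * m)"
      using \<kappa>2 \<open>0 < \<kappa>\<close> by (intro mult_left_mono) auto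
    also have "\<dots> \<le> \<epsilon> * w i"
      using mult_left_mono[OF w_ge[OF i] less_imp_le[OF \<epsilon>(1)]] by (simp add: mult_ac)
    finally have "l\<^sup>2 * C \<le> \<epsilon> * w i" .
    then have "tate Basis (\<lambda>_. l * \<rho>) (\<epsilon> * w i) (R i)"
      unfolding R_def by (rule tate_mono[OF remainder[OF l i]])
    then show ?thesis
      by (rule tate_weights) (use w w_le \<open>0 < \<rho>\<close> in \<open>auto simp: l_def less_imp_le\<close>)
  qed
  define F where "F z = crd (f (of_crd z))" for z
  have SB: "S \<subseteq> Basis" "U \<subseteq> Basis"
    using SU by auto
  interpret germ: hyperbolic_germ S U w "\<lambda>i j. crd (\<alpha> j) i" "\<lambda>i j. crd (\<alpha> j) i" D R F \<theta> \<beta> \<epsilon>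
  proof
    show "finite S" "finite U"
      using SB finite_Basis finite_subset by blast+
    show "S \<inter> U = {}"
      by (rule SU)
    show "0 < w b" if "b \<in> S \<union> U" for b
      using w that SU by simp
    show "0 < \<theta>" "\<theta> \<le> 1" "0 \<le> \<epsilon>" "\<epsilon> \<le> \<theta>" "0 \<le> \<beta>"
      using \<theta> a \<epsilon> \<beta> by auto
    have "\<beta> * \<theta> \<le> \<beta> * a"
      using \<beta> \<theta> by (intro mult_left_mono) auto
    then show "\<beta> * \<theta> < 1"
      using \<beta> by linarith
    show "unorm (crd (\<alpha> j) i) * w j \<le> \<theta> * w i" if "i \<in> S" "j \<in> S" for i j
      using mult_left_mono[OF A[OF that] less_imp_le[OF \<open>0 < \<kappa>\<close>]] by (simp add: w_def mult_ac)
    show "unorm (D i j) * w j \<le> \<beta> * w i" if "i \<in> U" "j \<in> U" for i j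
      using mult_left_mono[OF D[OF that] less_imp_le[OF \<open>0 < \<kappa>\<close>]] by (simp add: w_def mult_ac)
    show "tate (S \<union> U) w (\<epsilon> * w i) (R i)" if "i \<in> S \<union> U" for i
      using R that unfolding SU by blast
    show "R i (\<lambda>_. 0) = 0" for i
      using f(2) linear_at_0[OF lin] by (simp add: R_def of_crd_def)
    show "F z i = (\<Sum>j\<in>S. crd (\<alpha> j) i * z j) + R i z" if "i \<in> S" for i z
      using linear_zero_component[OF lin SU block(1)[OF that]] by (simp add: F_def R_def crd_diff)
    show "F z i = (\<Sum>j\<in>U. crd (\<alpha> j) i * z j) + R i z" if "i \<in> U" for i z
      using linear_zero_component[where S = U and U = S, OF lin _ _ block(2)[OF that]] SU
      by (simp add: F_def R_def crd_diff Un_commute Int_commute)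
  qed (fact BD DB)+
  have F_iter: "(F ^^ n) (crd x) = crd ((f ^^ n) x)" for n x
    by (induction n) (simp_all add: F_def)
  define P where "P = {x. \<forall>b\<in>Basis. unorm (crd x b) \<le> w b}"
  \<comment> \<open>The largest subset of the polydisc that \<alpha> maps into itself. It is closed
    under addition like the polydisc, and boundedness of the powers of \<alpha> makes it a
    neighbourhood of 0.\<close>
  define \<Omega> where "\<Omega> = {x. \<forall>n. (\<alpha> ^^ n) x \<in> P}"
  have \<Omega>P: "\<Omega> \<subseteq> P"
    unfolding \<Omega>_def by (auto dest: spec[of _ 0])
  have P_add: "x + y \<in> P" and P_diff: "x - y \<in> P" if "x \<in> P" "y \<in> P" for x y
    using that by (auto simp: P_def crd_add crd_diff intro: unorm_add_le unorm_diff_le)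
  have linn: "Vector_Spaces.linear scale scale (\<alpha> ^^ n)" for n
    by (rule linear_funpow[OF lin])
  have lin_add: "(\<alpha> ^^ n) (x + y) = (\<alpha> ^^ n) x + (\<alpha> ^^ n) y" for n x y
    using linn unfolding Vector_Spaces.linear_iff by blast
  have small_\<Omega>: "x \<in> \<Omega>" if "0 \<le> \<delta>" "Q * \<delta> \<le> 1" "\<And>b. b \<in> Basis \<Longrightarrow> unorm (crd x b) \<le> \<delta> * w b" for x \<delta>
    unfolding \<Omega>_def P_def
  proof (intro CollectI allI ballI)
    fix n b assume b: "b \<in> Basis"
    have "K * unorm ((\<alpha> ^^ n) x) \<le> K * (Cp * (M * (\<delta> * (\<kappa> * W))))"
      using pow[of n x] unorm_le_w[OF that(1,3)] \<open>K > 0\<close> \<open>0 < Cp\<close>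
      by (intro mult_left_mono) (auto intro: order_trans)
    also have "\<dots> = (Q * \<delta>) * (\<kappa> * m)"
      using \<open>0 < m\<close> by (simp add: Q_def)
    also have "\<dots> \<le> 1 * w b"
      using that(1,2) w_ge[OF b] \<open>Q > 0\<close> \<open>0 < \<kappa>\<close> \<open>0 < m\<close> by (intro mult_mono) auto
    finally show "unorm (crd ((\<alpha> ^^ n) x) b) \<le> w b"
      using K[OF b, of "(\<alpha> ^^ n) x"] by simp
  qed
  have \<Omega>_add: "x + y \<in> \<Omega>" if "x \<in> \<Omega>" "y \<in> \<Omega>" for x y
    using that by (auto simp: \<Omega>_def lin_add P_add)
  have ball_\<Omega>: "x \<in> \<Omega>" if "unorm x \<le> \<kappa> * m / (K * Q)" for x
  proof (rule small_\<Omega>[of "K * unorm x / (\<kappa> * m)"])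
    show "0 \<le> K * unorm x / (\<kappa> * m)"
      using \<open>K > 0\<close> \<open>0 < \<kappa>\<close> \<open>0 < m\<close> by simp
    show "Q * (K * unorm x / (\<kappa> * m)) \<le> 1"
      using that \<open>K > 0\<close> \<open>0 < \<kappa>\<close> \<open>0 < m\<close> \<open>Q > 0\<close> by (simp add: field_simps)
  qed (rule crd_le_w)
  \<comment> \<open>Sets stable under adding vectors of one fixed small ball are open; this covers
    both \<open>P\<close> and \<Omega>.\<close>
  have open_nbhd: "open H" if "\<And>x y. x \<in> H \<Longrightarrow> unorm y \<le> \<kappa> * m / (K * Q) \<Longrightarrow> x + y \<in> H" for H
    unfolding open_dist
  proof
    fix x assume x: "x \<in> H"
    have "0 < \<kappa> * m / (K * Q)"
      using \<open>K > 0\<close> \<open>0 < \<kappa>\<close> \<open>0 < m\<close> \<open>Q > 0\<close> by simp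
    moreover have "y \<in> H" if "dist y x < \<kappa> * m / (K * Q)" for y
      using \<open>\<And>x y. x \<in> H \<Longrightarrow> unorm y \<le> \<kappa> * m / (K * Q) \<Longrightarrow> x + y \<in> H\<close>[OF x, of "y - x"] that
      by (simp add: dist_unorm)
    ultimately show "\<exists>e>0. \<forall>y. dist y x < e \<longrightarrow> y \<in> H"
      by blast
  qed
  have open_\<Omega>: "open \<Omega>"
    by (rule open_nbhd, rule \<Omega>_add, assumption, rule ball_\<Omega>)
  have open_P: "open P"
    by (rule open_nbhd, rule P_add, assumption, rule subsetD[OF \<Omega>P ball_\<Omega>])
  have "0 \<in> \<Omega>"
    by (rule ball_\<Omega>) (use \<open>K > 0\<close> \<open>0 < \<kappa>\<close> \<open>0 < m\<close> \<open>Q > 0\<close> in simp)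
  have PV: "x \<in> V" if "x \<in> P" for x
    using unorm_le_w[of 1 x] that \<kappa>3 by (intro r) (auto simp: P_def)
  \<comment> \<open>Both the linear image and the remainder lie in \<Omega>, the latter because
    \<open>Q * \<epsilon> \<le> 1\<close>; additivity of \<Omega> finishes.\<close>
  have f\<Omega>: "f x \<in> \<Omega>" if "x \<in> \<Omega>" for x
  proof -
    have "(\<alpha> ^^ n) (\<alpha> x) = (\<alpha> ^^ Suc n) x" for n
      by (simp only: funpow_Suc_right o_def)
    then have "\<alpha> x \<in> \<Omega>"
      using that by (simp only: \<Omega>_def mem_Collect_eq) blast
    moreover have "f x - \<alpha> x \<in> \<Omega>"
    proof (rule small_\<Omega>[of \<epsilon>])
      show "unorm (crd (f x - \<alpha> x) b) \<le> \<epsilon> * w b" if b: "b \<in> Basis" for b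
      proof -
        have "unorm (R b (crd x)) \<le> \<epsilon> * w b"
          using \<Omega>P \<open>x \<in> \<Omega>\<close> by (intro tate_bound[OF R[OF b]]) (auto simp: P_def)
        then show ?thesis
          by (simp add: R_def)
      qed
    qed (use \<epsilon> \<epsilon>Q in auto)
    ultimately have "\<alpha> x + (f x - \<alpha> x) \<in> \<Omega>"
      by (rule \<Omega>_add)
    then show ?thesis by simp
  qed
  \<comment> \<open>\<open>G\<close> has values in the unstable coordinates and depends on the
    stable ones only, so \<open>x - G x\<close> is a shear with inverse \<open>x + G x\<close>. It
    straightens the graph to a coordinate subspace.\<close>
  define G where "G x = of_crd (\<lambda>i. if i \<in> U then germ.graph_fun i (crd x) else 0)" for x
  define \<Theta> where "\<Theta> x = x + - G x" for x
  define \<Theta>' where "\<Theta>' x = x + G x" for x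
  have crd_G_S: "crd (G x) b = 0" if "b \<in> S" for x b
    using that SU by (subst G_def, subst crd_of_crd) auto
  have crd_G_U: "crd (G x) b = germ.graph_fun b (crd x)" if "b \<in> U" for x b
    using that SU by (subst G_def, subst crd_of_crd) auto
  have G_cong: "G x = G y" if "x \<in> P" "\<And>b. b \<in> S \<Longrightarrow> crd x b = crd y b" for x y
    unfolding G_def using that SB
    by (intro of_crd_cong) (auto simp: P_def intro!: germ.graph_fun_depends)
  have G_P: "G x \<in> P" if "x \<in> P" for x
    unfolding P_def
  proof (intro CollectI ballI)
    fix b assume "b \<in> Basis"
    then consider "b \<in> S" | "b \<in> U"
      using SU by blast
    then show "unorm (crd (G x) b) \<le> w b"
    proof cases
      case 1
      then show ?thesis
        using w SB by (auto simp: crd_G_S less_imp_le)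
    next
      case 2
      then have "unorm (germ.graph_fun b (crd x)) \<le> w b"
        using that SB by (intro tate_bound[OF germ.graph_fun_tate]) (auto simp: P_def)
      then show ?thesis
        using 2 by (simp add: crd_G_U)
    qed
  qed
  have \<Theta>P: "\<Theta> x \<in> P" "\<Theta>' x \<in> P" if "x \<in> P" for x
    using P_diff[OF that G_P[OF that]] P_add[OF that G_P[OF that]] by (auto simp: \<Theta>_def \<Theta>'_def)
  have \<Theta>'\<Theta>: "\<Theta>' (\<Theta> x) = x" if "x \<in> P" for x
  proof -
    have "G (\<Theta> x) = G x"
      using that by (intro G_cong[OF \<Theta>P(1)]) (auto simp: \<Theta>_def crd_diff crd_G_S)
    then show ?thesis
      by (simp add: \<Theta>'_def \<Theta>_def)
  qed
  have \<Theta>\<Theta>': "\<Theta> (\<Theta>' x) = x" if "x \<in> P" for x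
  proof -
    have "G (\<Theta>' x) = G x"
      using that by (intro G_cong[OF \<Theta>P(2)]) (auto simp: \<Theta>'_def crd_add crd_G_S)
    then show ?thesis
      by (simp add: \<Theta>'_def \<Theta>_def)
  qed
  have G_analytic: "analytic_at G x" if x: "x \<in> P" for x
  \<comment> \<open>The radius \<open>\<kappa> * m\<close> is at most every \<open>w b\<close>, so
    moving any point of the polydisc by that much in each coordinate stays inside it.\<close>
  proof (rule analytic_atI[of "\<kappa> * m" w])
    show "0 < \<kappa> * m"
      using \<open>0 < \<kappa>\<close> \<open>0 < m\<close> by simp
    fix b assume b: "b \<in> Basis"
    show "tate Basis (\<lambda>_. \<kappa> * m) (w b) (\<lambda>z. crd (G (x + of_crd z)) b)"
    proof (cases "b \<in> U")
      case False
      then have "crd (G (x + of_crd z)) b = 0" for z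
        using crd_G_S b SU by blast
      then show ?thesis
        using tate_zero[of "w b" Basis "\<lambda>_. \<kappa> * m"] w[OF b] \<open>0 < \<kappa>\<close> \<open>0 < m\<close> by (simp add: less_imp_le)
    next
      case True
      have H: "tate Basis (\<lambda>_. \<kappa> * m) (w c) (\<lambda>z. crd x c + z c)" if "c \<in> S" for c
      proof (rule tate_add)
        have c: "c \<in> Basis"
          using that SB by blast
        show "tate Basis (\<lambda>_. \<kappa> * m) (w c) (\<lambda>z. crd x c)"
          using x c \<open>0 < \<kappa>\<close> \<open>0 < m\<close> by (intro tate_mono[OF tate_const]) (auto simp: P_def)
        have "tate Basis (\<lambda>_. \<kappa> * m) (\<kappa> * m) (\<lambda>z. z c :: 'k)"
          using tate_var[OF finite_Basis c, of "\<lambda>_. \<kappa> * m"] \<open>0 < \<kappa>\<close> \<open>0 < m\<close> by simp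
        then show "tate Basis (\<lambda>_. \<kappa> * m) (w c) (\<lambda>z. z c :: 'k)"
          using w_ge[OF c] by (rule tate_mono)
      qed (use \<open>0 < \<kappa>\<close> \<open>0 < m\<close> in simp)
      have "tate Basis (\<lambda>_. \<kappa> * m) (w b) (\<lambda>z. germ.graph_fun b (\<lambda>c. crd x c + z c))"
        by (rule tate_compose[where H = "\<lambda>c z. crd x c + z c", OF germ.graph_fun_tate[OF True] H])
           (use \<open>0 < \<kappa>\<close> \<open>0 < m\<close> in auto)
      then show ?thesis
      proof (rule tate_cong)
        fix z :: "'e \<Rightarrow> 'k" assume z: "\<And>c. c \<in> Basis \<Longrightarrow> unorm (z c) \<le> \<kappa> * m"
        show "germ.graph_fun b (\<lambda>c. crd x c + z c) = crd (G (x + of_crd z)) b"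
          unfolding crd_G_U[OF True]
        proof (rule germ.graph_fun_depends[OF True])
          fix c assume "c \<in> S"
          then have c: "c \<in> Basis"
            using SB by blast
          show "crd x c + z c = crd (x + of_crd z) c"
            using c by (simp add: crd_add)
          show "unorm (crd x c + z c) \<le> w c"
            using x z[OF c] w_ge[OF c] c by (intro unorm_add_le) (auto simp: P_def)
        qed
      qed
    qed
  qed
  have "Vector_Spaces.linear scale scale (uminus :: 'e \<Rightarrow> 'e)"
    by (simp add: Vector_Spaces.linear_iff vector_space_axioms)
  then have minus: "analytic_at uminus y" for y :: 'e
    by (rule analytic_at_linear)
  have \<Theta>_analytic: "analytic_at \<Theta> x" and \<Theta>'_analytic: "analytic_at \<Theta>' x" if "x \<in> P" for x
    unfolding \<Theta>_def[abs_def] \<Theta>'_def[abs_def]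
    using analytic_at_add[OF analytic_at_ident analytic_at_compose[OF G_analytic[OF that] minus]]
      analytic_at_add[OF analytic_at_ident G_analytic[OF that]] by auto
  \<comment> \<open>Since the shear permutes \<open>P\<close>, the image is a preimage under the
    continuous inverse, hence open.\<close>
  have image: "\<Theta> ` \<Omega> = \<Theta>' -` \<Omega> \<inter> P"
  proof (intro equalityI subsetI)
    show "y \<in> \<Theta>' -` \<Omega> \<inter> P" if "y \<in> \<Theta> ` \<Omega>" for y
      using that \<Omega>P \<Theta>'\<Theta> \<Theta>P(1) by auto
    show "y \<in> \<Theta> ` \<Omega>" if "y \<in> \<Theta>' -` \<Omega> \<inter> P" for y
      using that \<Theta>\<Theta>'[of y] by (auto intro!: image_eqI[of y \<Theta> "\<Theta>' y"])
  qed
  have "continuous_on P \<Theta>'"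
    using \<Theta>'_analytic analytic_at_imp_isCont continuous_at_imp_continuous_on by blast
  then have open_image: "open (\<Theta> ` \<Omega>)"
    unfolding image using open_P open_\<Omega> continuous_on_open_vimage by blast
  have f_iter: "(f ^^ n) x \<in> \<Omega>" if "x \<in> \<Omega>" for n x
    using that by (induction n) (auto intro: f\<Omega>)
  have char: "(\<forall>i\<in>U. crd (\<Theta> x) i = 0) \<longleftrightarrow> (\<lambda>n. unorm ((f ^^ n) x) / a ^ n) \<longlonglongrightarrow> 0" if x: "x \<in> \<Omega>" for x
  proof -
    have "crd (\<Theta> x) i = crd x i - germ.graph_fun i (crd x)" if "i \<in> U" for i
      using that by (simp add: \<Theta>_def crd_diff crd_G_U)
    then have "(\<forall>i\<in>U. crd (\<Theta> x) i = 0) \<longleftrightarrow> (\<forall>i\<in>U. crd x i = germ.graph_fun i (crd x))"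
      by simp
    also have "\<dots> \<longleftrightarrow> (\<lambda>n. unorm ((f ^^ n) x) / a ^ n) \<longlonglongrightarrow> 0"
    proof
      assume graph: "\<forall>i\<in>U. crd x i = germ.graph_fun i (crd x)"
      have "unorm (crd ((f ^^ n) x) b) \<le> \<theta> ^ n * w b" if "b \<in> Basis" for n b
        using germ.graph_iterates[of "crd x" b n] graph x \<Omega>P that SU by (auto simp: F_iter P_def)
      then have le: "unorm ((f ^^ n) x) \<le> M * (\<theta> ^ n * (\<kappa> * W))" for n
        using \<theta> by (intro unorm_le_w) auto
      \<comment> \<open>On the graph the orbit decays like \<open>\<theta> ^ n\<close>, and
        \<open>\<theta> < a\<close> leaves a geometric sequence after division by
        \<open>a ^ n\<close>.\<close>
      have "(\<lambda>n. (M * (\<kappa> * W)) * (\<theta> / a) ^ n) \<longlonglongrightarrow> (M * (\<kappa> * W)) * 0"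
        using \<theta> a0 by (intro tendsto_mult_left LIMSEQ_power_zero) simp
      then have lim: "(\<lambda>n. (M * (\<kappa> * W)) * (\<theta> / a) ^ n) \<longlonglongrightarrow> 0"
        by simp
      show "(\<lambda>n. unorm ((f ^^ n) x) / a ^ n) \<longlonglongrightarrow> 0"
      proof (rule tendsto_sandwich[OF _ _ tendsto_const lim])
        show "\<forall>\<^sub>F n in sequentially. 0 \<le> unorm ((f ^^ n) x) / a ^ n"
          using a0 by simp
        have "unorm ((f ^^ n) x) / a ^ n \<le> (M * (\<kappa> * W)) * (\<theta> / a) ^ n" for n
          using le[of n] a0 by (simp add: power_divide field_simps)
        then show "\<forall>\<^sub>F n in sequentially. unorm ((f ^^ n) x) / a ^ n \<le> (M * (\<kappa> * W)) * (\<theta> / a) ^ n"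
          by simp
      qed
    next
      assume lim: "(\<lambda>n. unorm ((f ^^ n) x) / a ^ n) \<longlonglongrightarrow> 0"
      show "\<forall>i\<in>U. crd x i = germ.graph_fun i (crd x)"
      proof
        fix i assume i: "i \<in> U"
        show "crd x i = germ.graph_fun i (crd x)"
        proof (rule germ.graph_characterization[OF _ a0 a less_imp_le[OF \<beta>(2)] _ i])
          show "unorm ((F ^^ n) (crd x) b) \<le> w b" if "b \<in> S \<union> U" for n b
            using f_iter[OF x, of n] \<Omega>P that SU by (auto simp: F_iter P_def)
          fix e :: real assume "0 < e"
          \<comment> \<open>The threshold converts smallness of \<open>unorm\<close> into smallness
            of the coordinates relative to the radii, by \<open>crd_le_w\<close>.\<close>
          then have "0 < e * (\<kappa> * m) / K"
            using \<open>K > 0\<close> \<open>0 < \<kappa>\<close> \<open>0 < m\<close> by simp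
          then have "\<forall>\<^sub>F n in sequentially. unorm ((f ^^ n) x) / a ^ n < e * (\<kappa> * m) / K"
            using lim by (rule order_tendstoD(2)[rotated])
          from eventually_happens'[OF sequentially_bot this]
          obtain n where "unorm ((f ^^ n) x) / a ^ n < e * (\<kappa> * m) / K"
            by blast
          then have n: "K * unorm ((f ^^ n) x) / (\<kappa> * m) \<le> e * a ^ n"
            using a0 \<open>K > 0\<close> \<open>0 < \<kappa>\<close> \<open>0 < m\<close> by (simp add: field_simps)
          have "unorm ((F ^^ n) (crd x) b) \<le> e * a ^ n * w b" if "b \<in> S \<union> U" for b
          proof -
            have b: "b \<in> Basis"
              using that SU by simp
            show ?thesis
              using crd_le_w[OF b, of "(f ^^ n) x"] mult_right_mono[OF n less_imp_le[OF w[OF b]]]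
              unfolding F_iter by linarith
          qed
          then show "\<exists>n. \<forall>b\<in>S \<union> U. unorm ((F ^^ n) (crd x) b) \<le> e * a ^ n * w b"
            by blast
        qed
      qed
    qed
    finally show ?thesis .
  qed
  show thesis
  proof (rule that[of \<Omega> \<Theta> \<Theta>'])
    show "\<Omega> \<subseteq> V"
      using \<Omega>P PV by blast
    show "analytic_at \<Theta>' y" if "y \<in> \<Theta> ` \<Omega>" for y
      using that \<Omega>P \<Theta>P(1) \<Theta>'_analytic by blast
  qed (use open_\<Omega> \<open>0 \<in> \<Omega>\<close> f\<Omega> open_image \<Theta>'\<Theta> \<Theta>_analytic \<Omega>P char in auto)
qed

end

section \<open>Comparison of exponential rates\<close>

lemma rate_transfer:
  fixes u v :: "nat \<Rightarrow> real"
  assumes u: "(\<lambda>n. u n / a ^ n) \<longlonglongrightarrow> 0" and "0 < a"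
    and v: "\<forall>\<^sub>F n in sequentially. 0 \<le> v n \<and> v n \<le> C * u n"
  shows "(\<lambda>n. v n / a ^ n) \<longlonglongrightarrow> 0"
proof (rule tendsto_sandwich[OF _ _ tendsto_const])
  have "(\<lambda>n. C * (u n / a ^ n)) \<longlonglongrightarrow> C * 0"
    by (intro tendsto_mult_left u)
  then show "(\<lambda>n. C * (u n / a ^ n)) \<longlonglongrightarrow> 0"
    by simp
  show "\<forall>\<^sub>F n in sequentially. 0 \<le> v n / a ^ n"
    using v by eventually_elim (use \<open>0 < a\<close> in simp)
  show "\<forall>\<^sub>F n in sequentially. v n / a ^ n \<le> C * (u n / a ^ n)"
    using v by eventually_elim (use \<open>0 < a\<close> in \<open>simp add: divide_right_mono\<close>)
qed

text \<open>For \<open>a \<le> 1\<close>, division by \<open>a ^ n\<close> can only enlarge a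
  nonnegative sequence.\<close>

lemma rate_imp_tendsto_0:
  fixes u :: "nat \<Rightarrow> real"
  assumes u: "(\<lambda>n. u n / a ^ n) \<longlonglongrightarrow> 0" and a: "0 < a" "a \<le> 1" and nonneg: "\<And>n. 0 \<le> u n"
  shows "u \<longlonglongrightarrow> 0"
proof (rule tendsto_sandwich[OF _ _ tendsto_const u])
  have "u n \<le> u n / a ^ n" for n
    using nonneg[of n] a mult_left_mono[OF power_le_one[of a n] nonneg[of n]]
    by (simp add: pos_le_divide_eq)
  then show "\<forall>\<^sub>F n in sequentially. u n \<le> u n / a ^ n"
    by simp
qed (use nonneg in simp)

context ultrametric_space
begin

text \<open>Used twice with the roles of \<alpha> and of its inverse on the unstable subspace
  exchanged, which gives both matrix identities required by the graph transform.\<close>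

lemma inverse_matrices:
  assumes F: "subspace F" and U: "U \<subseteq> Basis"
    and L: "Vector_Spaces.linear scale scale L" "Vector_Spaces.linear scale scale L'"
      "\<And>x. L' (L x) = x" "\<And>x. L (L' x) = x"
    and LU: "\<And>b. b \<in> U \<Longrightarrow> L b \<in> F" and F_coord: "\<And>x b. x \<in> F \<Longrightarrow> b \<in> Basis - U \<Longrightarrow> crd (L' x) b = 0"
    and g: "\<And>x y. x \<in> F \<Longrightarrow> y \<in> F \<Longrightarrow> g (x + y) = g x + g y" "\<And>c x. x \<in> F \<Longrightarrow> g (scale c x) = scale c (g x)"
    and h: "\<And>x y. x \<in> F \<Longrightarrow> y \<in> F \<Longrightarrow> h (x + y) = h x + h y" "\<And>c x. x \<in> F \<Longrightarrow> h (scale c x) = scale c (h x)"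
      "\<And>x. x \<in> F \<Longrightarrow> h x \<in> F"
    and gh: "\<And>x. x \<in> F \<Longrightarrow> g (h x) = x" and i: "i \<in> U"
  shows "(\<Sum>j\<in>U. crd (L' (g (L j))) i * (\<Sum>k\<in>U. crd (L' (h (L k))) j * y k)) = y i"
proof -
  have L'_sum: "crd (L' (\<Sum>k\<in>U. scale (u k) (x k))) j = (\<Sum>k\<in>U. crd (L' (x k)) j * u k)" for u x j
  proof -
    have "L' (\<Sum>k\<in>U. scale (u k) (x k)) = (\<Sum>k\<in>U. scale (u k) (L' (x k)))"
      by (rule linear_on_subspace_sum[OF subspace_UNIV])
         (use L(2) in \<open>auto simp: Vector_Spaces.linear_iff\<close>)
    then show ?thesis
      by (simp add: crd_sum crd_scale mult.commute)
  qed
  have expand: "x = (\<Sum>j\<in>U. scale (crd (L' x) j) (L j))" if "x \<in> F" for x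
  proof -
    have "x = L (of_crd (crd (L' x)))"
      by (simp add: L(4))
    also have "\<dots> = (\<Sum>j\<in>Basis. scale (crd (L' x) j) (L j))"
      by (rule linear_sum_Basis[OF L(1)])
    also have "\<dots> = (\<Sum>j\<in>U. scale (crd (L' x) j) (L j))"
      using F_coord[OF that] U finite_Basis by (intro sum.mono_neutral_right) auto
    finally show ?thesis .
  qed
  define Y where "Y = (\<Sum>k\<in>U. scale (y k) (L k))"
  have Y: "Y \<in> F"
    unfolding Y_def using F LU by (intro subspace_sum subspace_scale) auto
  have hY: "h Y = (\<Sum>k\<in>U. scale (y k) (h (L k)))"
    unfolding Y_def by (rule linear_on_subspace_sum[OF F h(1,2) LU])
  have "(\<Sum>j\<in>U. crd (L' (g (L j))) i * (\<Sum>k\<in>U. crd (L' (h (L k))) j * y k)) =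
      (\<Sum>j\<in>U. crd (L' (g (L j))) i * crd (L' (h Y)) j)"
    unfolding hY L'_sum ..
  also have "\<dots> = crd (L' (\<Sum>j\<in>U. scale (crd (L' (h Y)) j) (g (L j)))) i"
    unfolding L'_sum ..
  also have "(\<Sum>j\<in>U. scale (crd (L' (h Y)) j) (g (L j))) = g (\<Sum>j\<in>U. scale (crd (L' (h Y)) j) (L j))"
    by (rule linear_on_subspace_sum[OF F g LU, symmetric])
  also have "(\<Sum>j\<in>U. scale (crd (L' (h Y)) j) (L j)) = h Y"
    by (rule expand[OF h(3)[OF Y], symmetric])
  also have "crd (L' (g (h Y))) i = (\<Sum>k\<in>U. crd (L' (L k)) i * y k)"
    unfolding gh[OF Y] unfolding Y_def L'_sum ..
  also have "\<dots> = (\<Sum>k\<in>U. if k = i then y k else 0)"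
    using U by (intro sum.cong) (auto simp: L(3) crd_basis)
  also have "\<dots> = y i"
    using i finite_subset[OF U finite_Basis] by simp
  finally show ?thesis .
qed

lemma has_frechet_derivative_conjugate:
  assumes f: "has_frechet_derivative f \<alpha> 0"
    and L: "Vector_Spaces.linear scale scale L" and L': "Vector_Spaces.linear scale scale L'"
  shows "has_frechet_derivative (\<lambda>x. L' (f (L x))) (\<lambda>x. L' (\<alpha> (L x))) 0"
  unfolding has_frechet_derivative_iff
proof (intro conjI allI impI)
  have lin: "Vector_Spaces.linear scale scale \<alpha>"
    using f by (simp add: has_frechet_derivative_def)
  then show "Vector_Spaces.linear scale scale (\<lambda>x. L' (\<alpha> (L x)))"
    using L L' by (simp add: Vector_Spaces.linear_iff)
  fix e :: real assume "0 < e"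
  obtain K where "K > 0" and K: "\<And>x. unorm (L x) \<le> K * unorm x"
    using linear_bounded[OF L] by blast
  obtain K' where "K' > 0" and K': "\<And>x. unorm (L' x) \<le> K' * unorm x"
    using linear_bounded[OF L'] by blast
  \<comment> \<open>The operator bounds of \<open>L\<close> and \<open>L'\<close> are paid for in
    advance.\<close>
  have "0 < e / (K * K')"
    using \<open>0 < e\<close> \<open>K > 0\<close> \<open>K' > 0\<close> by simp
  then obtain d where "d > 0" and d: "\<And>h. unorm h < d \<Longrightarrow> unorm (f (0 + h) - f 0 - \<alpha> h) \<le> e / (K * K') * unorm h"
    using f unfolding has_frechet_derivative_iff by blast
  show "\<exists>d>0. \<forall>h. unorm h < d \<longrightarrow> unorm (L' (f (L (0 + h))) - L' (f (L 0)) - L' (\<alpha> (L h))) \<le> e * unorm h"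
  proof (intro exI[of _ "d / K"] conjI allI impI)
    show "0 < d / K"
      using \<open>d > 0\<close> \<open>K > 0\<close> by simp
    fix h :: 'e assume h: "unorm h < d / K"
    then have "unorm (L h) < d"
      using K[of h] \<open>K > 0\<close> by (simp add: field_simps)
    then have "unorm (f (L h) - f 0 - \<alpha> (L h)) \<le> e / (K * K') * unorm (L h)"
      using d[of "L h"] by simp
    also have "\<dots> \<le> e / (K * K') * (K * unorm h)"
      using K[of h] \<open>0 < e\<close> \<open>K > 0\<close> \<open>K' > 0\<close> by (intro mult_left_mono) auto
    finally have "K' * unorm (f (L h) - f 0 - \<alpha> (L h)) \<le> K' * (e / (K * K') * (K * unorm h))"
      using \<open>K' > 0\<close> by (intro mult_left_mono) auto
    also have "\<dots> = e * unorm h"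
      using \<open>K > 0\<close> \<open>K' > 0\<close> by simp
    finally have "unorm (L' (f (L h) - f 0 - \<alpha> (L h))) \<le> e * unorm h"
      using K'[of "f (L h) - f 0 - \<alpha> (L h)"] by linarith
    then show "unorm (L' (f (L (0 + h))) - L' (f (L 0)) - L' (\<alpha> (L h))) \<le> e * unorm h"
      by (simp add: linear_diff_eq[OF L'] linear_at_0[OF L])
  qed
qed

text \<open>The weighted maximum norm defined by \<open>om\<close> differs from the adapted norm on
  each summand by at most the factor \<open>1 / t\<close>, so matrix entries inherit the operator
  bounds divided by \<open>t\<close>.\<close>

lemma hyperbolic_adapted_coordinates:
  assumes hyp: "hyperbolic a \<alpha>"
  obtains S U L L' om \<theta> \<beta> D where "S \<union> U = Basis" "S \<inter> U = {}"
    "Vector_Spaces.linear scale scale L" "Vector_Spaces.linear scale scale L'"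
    "\<And>x. L' (L x) = x" "\<And>x. L (L' x) = x"
    "\<And>b. b \<in> Basis \<Longrightarrow> 0 < om b"
    "\<And>i j. i \<in> S \<Longrightarrow> j \<in> U \<Longrightarrow> crd (L' (\<alpha> (L j))) i = 0"
    "\<And>i j. i \<in> U \<Longrightarrow> j \<in> S \<Longrightarrow> crd (L' (\<alpha> (L j))) i = 0"
    "\<And>i j. i \<in> S \<Longrightarrow> j \<in> S \<Longrightarrow> unorm (crd (L' (\<alpha> (L j))) i) * om j \<le> \<theta> * om i"
    "\<And>i j. i \<in> U \<Longrightarrow> j \<in> U \<Longrightarrow> unorm (D i j) * om j \<le> \<beta> * om i"
    "\<And>i y. i \<in> U \<Longrightarrow> (\<Sum>j\<in>U. crd (L' (\<alpha> (L j))) i * (\<Sum>k\<in>U. D j k * y k)) = y i"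
    "\<And>i y. i \<in> U \<Longrightarrow> (\<Sum>j\<in>U. D i j * (\<Sum>k\<in>U. crd (L' (\<alpha> (L k))) j * y k)) = y i"
    "0 < \<theta>" "\<theta> < a" "0 \<le> \<beta>" "\<beta> * a < 1"
proof -
  obtain Es Eu N where a: "0 < a" and lin: "Vector_Spaces.linear scale scale \<alpha>"
    and sub: "subspace Es" "subspace Eu" and inv: "\<alpha> ` Es \<subseteq> Es" "\<alpha> ` Eu \<subseteq> Eu"
    and int: "Es \<inter> Eu = {0}" and span: "{x + y | x y. x \<in> Es \<and> y \<in> Eu} = UNIV"
    and top: "topology_norm N" and bij: "bij_betw \<alpha> Eu Eu"
    and \<theta>a: "op_norm N Es \<alpha> < a"
    and c: "op_norm N Eu (the_inv_into Eu \<alpha>) = 0 \<or> 1 / op_norm N Eu (the_inv_into Eu \<alpha>) > a"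
    using hyp unfolding hyperbolic_def Let_def by (elim conjE exE) (rule that)
  have N: "ultra_norm N"
    using top by (rule topology_norm_imp_ultra_norm)
  have add: "\<alpha> (x + y) = \<alpha> x + \<alpha> y" and hom: "\<alpha> (scale k x) = scale k (\<alpha> x)" for x y k
    using lin by (auto simp: Vector_Spaces.linear_iff)
  define \<gamma> where "\<gamma> = the_inv_into Eu \<alpha>"
  have inj: "inj_on \<alpha> Eu" and img: "\<alpha> ` Eu = Eu"
    using bij by (auto simp: bij_betw_def)
  have \<gamma>_in: "\<gamma> x \<in> Eu" and \<alpha>\<gamma>: "\<alpha> (\<gamma> x) = x" and \<gamma>\<alpha>: "\<gamma> (\<alpha> x) = x" if "x \<in> Eu" for x
    unfolding \<gamma>_def using that inj img
    by (auto intro: the_inv_into_into f_the_inv_into_f the_inv_into_f_f)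
  have \<gamma>_add: "\<gamma> (x + y) = \<gamma> x + \<gamma> y" if "x \<in> Eu" "y \<in> Eu" for x y
    using \<gamma>\<alpha>[of "\<gamma> x + \<gamma> y"] that sub(2) by (simp add: add \<alpha>\<gamma> \<gamma>_in subspace_add)
  have \<gamma>_hom: "\<gamma> (scale k x) = scale k (\<gamma> x)" if "x \<in> Eu" for x k
    using \<gamma>\<alpha>[of "scale k (\<gamma> x)"] that sub(2) by (simp add: hom \<alpha>\<gamma> \<gamma>_in subspace_scale)
  define \<theta>0 where "\<theta>0 = op_norm N Es \<alpha>"
  define c0 where "c0 = op_norm N Eu \<gamma>"
  have \<theta>0_bound: "N (\<alpha> x) \<le> \<theta>0 * N x" if "x \<in> Es" for x
    unfolding \<theta>0_def using that by (rule op_norm_bound(2)[OF sub(1) add hom N])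
  have c0: "0 \<le> c0" and c0_bound: "\<And>x. x \<in> Eu \<Longrightarrow> N (\<gamma> x) \<le> c0 * N x"
    using op_norm_bound[OF sub(2) \<gamma>_add \<gamma>_hom N] by (auto simp: c0_def)
  have \<theta>0: "0 \<le> \<theta>0" "\<theta>0 < a"
    using op_norm_bound(1)[OF sub(1) add hom N] \<theta>a by (auto simp: \<theta>0_def)
  \<comment> \<open>The case \<open>c0 = 0\<close> includes a trivial unstable subspace, where the
    condition on the reciprocal is read as infinity.\<close>
  have c0a: "c0 * a < 1"
  proof (cases "c0 = 0")
    case False
    then have "0 < c0" "a < 1 / c0"
      using c c0 by (auto simp: c0_def \<gamma>_def)
    then show ?thesis
      by (simp add: field_simps)
  qed simp
  \<comment> \<open>Both hyperbolicity conditions become ratios below 1; any \<open>t\<close>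
    strictly between \<open>q\<close> and 1, such as their midpoint, leaves room for the factor
    \<open>1 / t\<close>.\<close>
  define q where "q = max (\<theta>0 / a) (c0 * a)"
  have q: "\<theta>0 / a \<le> q" "c0 * a \<le> q" "q < 1"
    using \<theta>0 a c0a by (auto simp: q_def)
  have "0 \<le> q"
    using c0 a q(2) by (meson mult_nonneg_nonneg less_imp_le order_trans)
  define t where "t = (1 + q) / 2"
  have "0 < t" "t < 1" "q < t"
    using q(3) \<open>0 \<le> q\<close> by (auto simp: t_def)
  then have t: "0 < t" "t < 1" "\<theta>0 / a < t" "c0 * a < t"
    using q(1,2) by auto
  obtain S U L L' where SU: "S \<union> U = Basis" "S \<inter> U = {}"
    and L: "Vector_Spaces.linear scale scale L" "Vector_Spaces.linear scale scale L'"
      "\<And>x. L' (L x) = x" "\<And>x. L (L' x) = x"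
    and L_in: "\<And>b. b \<in> S \<Longrightarrow> L b \<in> Es" "\<And>b. b \<in> U \<Longrightarrow> L b \<in> Eu"
    and coord: "\<And>x b. x \<in> Es \<Longrightarrow> b \<in> U \<Longrightarrow> crd (L' x) b = 0" "\<And>x b. x \<in> Eu \<Longrightarrow> b \<in> S \<Longrightarrow> crd (L' x) b = 0"
    and orth: "\<And>x b. x \<in> Es \<Longrightarrow> b \<in> S \<Longrightarrow> t * (unorm (crd (L' x) b) * N (L b)) \<le> N x"
      "\<And>x b. x \<in> Eu \<Longrightarrow> b \<in> U \<Longrightarrow> t * (unorm (crd (L' x) b) * N (L b)) \<le> N x"
    by (rule adapted_coordinates[OF sub int span N t(1,2)]) blast
  \<comment> \<open>These are the radii of the unit ball of the norm that takes the maximum of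
    \<open>unorm (x b) * N (L b)\<close>.\<close>
  define om where "om b = 1 / N (L b)" for b
  have NL: "0 < N (L b)" if "b \<in> Basis" for b
  proof -
    have "b \<noteq> 0"
      using that independent_Basis dependent_zero by blast
    then have "L b \<noteq> 0"
      using L(3)[of b] linear_at_0[OF L(2)] by auto
    then show ?thesis
      using ultra_norm_nonneg[OF N, of "L b"] ultra_norm_eq_0[OF N, of "L b"] by linarith
  qed
  have scaled: "x * om j \<le> q / t * om i" if "t * (x * N (L i)) \<le> q * N (L j)" "i \<in> Basis" "j \<in> Basis" for x q i j
    using that(1) NL[OF that(2)] NL[OF that(3)] t(1) by (simp add: om_def field_simps)
  \<comment> \<open>The alternative \<open>a / 2\<close> keeps \<theta> positive even if \<alpha>
    vanishes on the stable subspace.\<close>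
  define \<theta> where "\<theta> = max (\<theta>0 / t) (a / 2)"
  define D where "D i j = crd (L' (\<gamma> (L j))) i" for i j
  show thesis
  proof (rule that[OF SU L, of om \<theta> D "c0 / t"])
    show om_pos: "0 < om b" if "b \<in> Basis" for b
      using NL[OF that] by (simp add: om_def)
    show "crd (L' (\<alpha> (L j))) i = 0" if "i \<in> S" "j \<in> U" for i j
      using that L_in inv by (intro coord) auto
    show "crd (L' (\<alpha> (L j))) i = 0" if "i \<in> U" "j \<in> S" for i j
      using that L_in inv by (intro coord) auto
    show "unorm (crd (L' (\<alpha> (L j))) i) * om j \<le> \<theta> * om i" if "i \<in> S" "j \<in> S" for i j
    proof -
      have ij: "i \<in> Basis" "j \<in> Basis"
        using that SU by auto
      have "\<alpha> (L j) \<in> Es"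
        using L_in(1)[OF that(2)] inv by blast
      then have "t * (unorm (crd (L' (\<alpha> (L j))) i) * N (L i)) \<le> \<theta>0 * N (L j)"
        using orth(1)[of "\<alpha> (L j)" i] \<theta>0_bound[OF L_in(1)[OF that(2)]] that(1) by linarith
      then have "unorm (crd (L' (\<alpha> (L j))) i) * om j \<le> \<theta>0 / t * om i"
        using ij by (rule scaled)
      also have "\<dots> \<le> \<theta> * om i"
        using om_pos[OF ij(1)] by (intro mult_right_mono) (auto simp: \<theta>_def)
      finally show ?thesis .
    qed
    show "unorm (D i j) * om j \<le> c0 / t * om i" if "i \<in> U" "j \<in> U" for i j
    proof -
      have ij: "i \<in> Basis" "j \<in> Basis"
        using that SU by auto
      have "t * (unorm (D i j) * N (L i)) \<le> c0 * N (L j)"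
        using orth(2)[OF \<gamma>_in[OF L_in(2)[OF that(2)]] that(1)] c0_bound[OF L_in(2)[OF that(2)]]
        unfolding D_def by linarith
      then show ?thesis
        using ij by (rule scaled)
    qed
    have U: "U \<subseteq> Basis"
      using SU by auto
    have coord': "\<And>x b. x \<in> Eu \<Longrightarrow> b \<in> Basis - U \<Longrightarrow> crd (L' x) b = 0"
      using coord(2) SU by blast
    show "(\<Sum>j\<in>U. crd (L' (\<alpha> (L j))) i * (\<Sum>k\<in>U. D j k * y k)) = y i" if "i \<in> U" for i y
      unfolding D_def
      by (rule inverse_matrices[OF sub(2) U L L_in(2) coord' add hom \<gamma>_add \<gamma>_hom \<gamma>_in \<alpha>\<gamma> that])
    have \<alpha>_in: "\<And>x. x \<in> Eu \<Longrightarrow> \<alpha> x \<in> Eu"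
      using inv by blast
    show "(\<Sum>j\<in>U. D i j * (\<Sum>k\<in>U. crd (L' (\<alpha> (L k))) j * y k)) = y i" if "i \<in> U" for i y
      unfolding D_def
      by (rule inverse_matrices[OF sub(2) U L L_in(2) coord' \<gamma>_add \<gamma>_hom add hom \<alpha>_in \<gamma>\<alpha> that])
    show "0 < \<theta>" "\<theta> < a"
      using a t(1,3) by (auto simp: \<theta>_def field_simps)
    show "0 \<le> c0 / t" "c0 / t * a < 1"
      using c0 t(1,4) by (auto simp: field_simps)
  qed
qed

text \<open>The split version is applied to the conjugate of \<open>f\<close> by \<open>L\<close>
  and pulled back. Decay rates are insensitive to this because \<open>L\<close> and
  \<open>L'\<close> are bounded.\<close>

lemma local_stable_manifold:
  assumes hyp: "hyperbolic a \<alpha>" and a: "a \<le> 1"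
    and v: "absolute_value_extension v" and eig: "eigenvalue_moduli v \<alpha> \<subseteq> {..1}"
    and f: "analytic_at f 0" "f 0 = 0" "has_frechet_derivative f \<alpha> 0"
    and V: "open V" "0 \<in> V"
  obtains F \<Omega> \<Theta> \<Theta>' where "subspace F" "open \<Omega>" "0 \<in> \<Omega>" "\<Omega> \<subseteq> V" "f ` \<Omega> \<subseteq> \<Omega>"
    "open (\<Theta> ` \<Omega>)" "\<And>x. x \<in> \<Omega> \<Longrightarrow> \<Theta>' (\<Theta> x) = x"
    "\<And>x. x \<in> \<Omega> \<Longrightarrow> analytic_at \<Theta> x" "\<And>y. y \<in> \<Theta> ` \<Omega> \<Longrightarrow> analytic_at \<Theta>' y"
    "\<And>x. x \<in> \<Omega> \<Longrightarrow> \<Theta> x \<in> F \<longleftrightarrow> (\<lambda>n. unorm ((f ^^ n) x) / a ^ n) \<longlonglongrightarrow> 0"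
proof -
  have lin: "Vector_Spaces.linear scale scale \<alpha>" and a0: "0 < a"
    using hyp by (auto simp: hyperbolic_def)
  obtain S U L L' om \<theta> \<beta> D where SU: "S \<union> U = Basis" "S \<inter> U = {}"
    and L: "Vector_Spaces.linear scale scale L" "Vector_Spaces.linear scale scale L'"
      "\<And>x. L' (L x) = x" "\<And>x. L (L' x) = x"
    and om: "\<And>b. b \<in> Basis \<Longrightarrow> 0 < om b"
    and block: "\<And>i j. i \<in> S \<Longrightarrow> j \<in> U \<Longrightarrow> crd (L' (\<alpha> (L j))) i = 0"
      "\<And>i j. i \<in> U \<Longrightarrow> j \<in> S \<Longrightarrow> crd (L' (\<alpha> (L j))) i = 0"
    and A: "\<And>i j. i \<in> S \<Longrightarrow> j \<in> S \<Longrightarrow> unorm (crd (L' (\<alpha> (L j))) i) * om j \<le> \<theta> * om i"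
    and D: "\<And>i j. i \<in> U \<Longrightarrow> j \<in> U \<Longrightarrow> unorm (D i j) * om j \<le> \<beta> * om i"
      "\<And>i y. i \<in> U \<Longrightarrow> (\<Sum>j\<in>U. crd (L' (\<alpha> (L j))) i * (\<Sum>k\<in>U. D j k * y k)) = y i"
      "\<And>i y. i \<in> U \<Longrightarrow> (\<Sum>j\<in>U. D i j * (\<Sum>k\<in>U. crd (L' (\<alpha> (L k))) j * y k)) = y i"
    and \<theta>: "0 < \<theta>" "\<theta> < a" and \<beta>: "0 \<le> \<beta>" "\<beta> * a < 1"
    by (rule hyperbolic_adapted_coordinates[OF hyp]) blast
  obtain C where "C > 0" and C: "\<And>n x. unorm ((\<alpha> ^^ n) x) \<le> C * unorm x"
    by (rule power_bounded[OF v lin eig]) blast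
  obtain K where "K > 0" and K: "\<And>x. unorm (L x) \<le> K * unorm x"
    using linear_bounded[OF L(1)] by blast
  obtain K' where "K' > 0" and K': "\<And>x. unorm (L' x) \<le> K' * unorm x"
    using linear_bounded[OF L(2)] by blast
  define \<alpha>' where "\<alpha>' x = L' (\<alpha> (L x))" for x
  define f' where "f' x = L' (f (L x))" for x
  have iter: "(f' ^^ n) (L' x) = L' ((f ^^ n) x)" for n x
    by (induction n) (simp_all add: f'_def L)
  have iter\<alpha>: "(\<alpha>' ^^ n) x = L' ((\<alpha> ^^ n) (L x))" for n x
    by (induction n) (simp_all add: \<alpha>'_def L)
  have pow: "unorm ((\<alpha>' ^^ n) x) \<le> K' * (C * K) * unorm x" for n x
  proof -
    have "unorm ((\<alpha>' ^^ n) x) \<le> K' * unorm ((\<alpha> ^^ n) (L x))"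
      unfolding iter\<alpha> by (rule K')
    also have "\<dots> \<le> K' * (C * unorm (L x))"
      using \<open>K' > 0\<close> by (intro mult_left_mono C) auto
    also have "\<dots> \<le> K' * (C * (K * unorm x))"
      using \<open>K' > 0\<close> \<open>C > 0\<close> by (intro mult_left_mono K) auto
    finally show ?thesis by (simp add: mult_ac)
  qed
  have L0: "L 0 = 0" "L' 0 = 0"
    using linear_at_0 L by auto
  have "analytic_at (\<lambda>x. f (L x)) 0"
    by (rule analytic_at_compose[where f = L and g = f, OF analytic_at_linear[OF L(1)]]) (simp add: L0 f)
  then have f'_analytic: "analytic_at f' 0"
    unfolding f'_def[abs_def]
    by (rule analytic_at_compose[where f = "\<lambda>x. f (L x)" and g = L', OF _ analytic_at_linear[OF L(2)]])
  have f'_0: "f' 0 = 0"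
    by (simp add: f'_def L0 f)
  have f'_deriv: "has_frechet_derivative f' \<alpha>' 0"
    unfolding f'_def[abs_def] \<alpha>'_def[abs_def] by (rule has_frechet_derivative_conjugate[OF f(3) L(1,2)])
  have contL: "continuous_on UNIV L" "continuous_on UNIV L'"
    using linear_continuous_at[OF L(1)] linear_continuous_at[OF L(2)]
    by (auto simp: continuous_on_eq_continuous_at)
  have V': "open (L -` V)" "0 \<in> L -` V"
    using open_vimage[OF V(1) contL(1)] V(2) L0 by auto
  have C': "0 < K' * (C * K)"
    using \<open>C > 0\<close> \<open>K > 0\<close> \<open>K' > 0\<close> by simp
  obtain \<Omega> \<Theta> \<Theta>' where \<Omega>: "open \<Omega>" "0 \<in> \<Omega>" "\<Omega> \<subseteq> L -` V" "f' ` \<Omega> \<subseteq> \<Omega>"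
    and \<Theta>: "open (\<Theta> ` \<Omega>)" "\<And>x. x \<in> \<Omega> \<Longrightarrow> \<Theta>' (\<Theta> x) = x"
      "\<And>x. x \<in> \<Omega> \<Longrightarrow> analytic_at \<Theta> x" "\<And>y. y \<in> \<Theta> ` \<Omega> \<Longrightarrow> analytic_at \<Theta>' y"
    and char: "\<And>x. x \<in> \<Omega> \<Longrightarrow> (\<forall>i\<in>U. crd (\<Theta> x) i = 0) \<longleftrightarrow> (\<lambda>n. unorm ((f' ^^ n) x) / a ^ n) \<longlonglongrightarrow> 0"
    by (rule local_stable_manifold_split[OF SU om block[folded \<alpha>'_def] A[folded \<alpha>'_def] D[folded \<alpha>'_def]
          \<theta> a \<beta> pow C' f'_analytic f'_0 f'_deriv V']) (assumption | rule that)+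
  have img: "(\<lambda>x. \<Theta> (L' x)) ` (L' -` \<Omega>) = \<Theta> ` \<Omega>"
  proof -
    have "L' ` (L' -` \<Omega>) = \<Omega>"
      by (rule surj_image_vimage_eq) (rule surjI[of L' L, OF L(3)])
    moreover have "(\<lambda>x. \<Theta> (L' x)) ` (L' -` \<Omega>) = \<Theta> ` (L' ` (L' -` \<Omega>))"
      by (simp only: image_image)
    ultimately show ?thesis by simp
  qed
  show thesis
  proof (rule that[of "{x. \<forall>i\<in>U. crd x i = 0}" "L' -` \<Omega>" "\<lambda>x. \<Theta> (L' x)" "\<lambda>y. L (\<Theta>' y)"])
    show "subspace {x. \<forall>i\<in>U. crd x i = 0}"
      by (auto simp: subspace_def crd_add crd_scale)
    show "open (L' -` \<Omega>)"
      using open_vimage[OF \<Omega>(1) contL(2)] .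
    show "0 \<in> L' -` \<Omega>"
      using \<Omega>(2) L0 by simp
    show "L' -` \<Omega> \<subseteq> V"
      using \<Omega>(3) L(4) by fastforce
    show "f ` (L' -` \<Omega>) \<subseteq> L' -` \<Omega>"
    proof (intro image_subsetI vimageI2)
      fix x assume "x \<in> L' -` \<Omega>"
      then have "f' (L' x) \<in> \<Omega>"
        using \<Omega>(4) by blast
      then show "L' (f x) \<in> \<Omega>"
        by (simp add: f'_def L)
    qed
    show "open ((\<lambda>x. \<Theta> (L' x)) ` (L' -` \<Omega>))"
      unfolding img by (rule \<Theta>(1))
    show "L (\<Theta>' (\<Theta> (L' x))) = x" if "x \<in> L' -` \<Omega>" for x
      using that by (simp add: \<Theta>(2) L)
    show "analytic_at (\<lambda>x. \<Theta> (L' x)) x" if "x \<in> L' -` \<Omega>" for x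
      using that
      by (intro analytic_at_compose[where f = L' and g = \<Theta>, OF analytic_at_linear[OF L(2)]] \<Theta>) auto
    show "analytic_at (\<lambda>y. L (\<Theta>' y)) y" if "y \<in> (\<lambda>x. \<Theta> (L' x)) ` (L' -` \<Omega>)" for y
      using that unfolding img
      by (rule analytic_at_compose[where f = \<Theta>' and g = L, OF \<Theta>(4) analytic_at_linear[OF L(1)]])
    show "\<Theta> (L' x) \<in> {x. \<forall>i\<in>U. crd x i = 0} \<longleftrightarrow> (\<lambda>n. unorm ((f ^^ n) x) / a ^ n) \<longlonglongrightarrow> 0"
      if "x \<in> L' -` \<Omega>" for x
    proof -
      have "\<Theta> (L' x) \<in> {x. \<forall>i\<in>U. crd x i = 0} \<longleftrightarrow> (\<lambda>n. unorm (L' ((f ^^ n) x)) / a ^ n) \<longlonglongrightarrow> 0"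
        using char[of "L' x"] that by (simp add: iter)
      also have "\<dots> \<longleftrightarrow> (\<lambda>n. unorm ((f ^^ n) x) / a ^ n) \<longlonglongrightarrow> 0"
      proof
        assume "(\<lambda>n. unorm (L' ((f ^^ n) x)) / a ^ n) \<longlonglongrightarrow> 0"
        then show "(\<lambda>n. unorm ((f ^^ n) x) / a ^ n) \<longlonglongrightarrow> 0"
          using a0 by (rule rate_transfer[where C = K]) (use K[of "L' _"] L(4) in simp)
      next
        assume "(\<lambda>n. unorm ((f ^^ n) x) / a ^ n) \<longlonglongrightarrow> 0"
        then show "(\<lambda>n. unorm (L' ((f ^^ n) x)) / a ^ n) \<longlonglongrightarrow> 0"
          using a0 by (rule rate_transfer[where C = K']) (use K' in simp)
      qed
      finally show ?thesis .
    qed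
  qed
qed

subsection \<open>The stable set\<close>

lemma topological_chartD:
  assumes "topological_chart (U, \<phi>)"
  shows "open U" "open (\<phi> ` U)" "inj_on \<phi> U" "continuous_on U \<phi>"
    "continuous_on (\<phi> ` U) (the_inv_into U \<phi>)"
  using assms unfolding topological_chart_def homeomorphism_def by auto

lemma chart_open_image:
  assumes "topological_chart (U, \<phi>)" "open H" "H \<subseteq> U"
  shows "open (\<phi> ` H)"
proof -
  have "\<phi> ` H = the_inv_into U \<phi> -` H \<inter> \<phi> ` U"
    using assms(3) the_inv_into_f_f[OF topological_chartD(3)[OF assms(1)]] by force
  then show ?thesis
    using continuous_on_open_vimage[OF topological_chartD(2)[OF assms(1)], of "the_inv_into U \<phi>"]
      topological_chartD(5)[OF assms(1)] assms(2) by metis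
qed

lemma chart_open_preimage:
  assumes "topological_chart (U, \<phi>)" "open H"
  shows "open (U \<inter> \<phi> -` H)"
  using continuous_on_open_vimage[OF topological_chartD(1)[OF assms(1)], of \<phi>]
    topological_chartD(4)[OF assms(1)] assms(2) by (metis Int_commute)

end

section \<open>Analytic maps and the maximal atlas\<close>

context analytic_manifold
begin

lemma chart_topological: "(U, \<phi>) \<in> charts \<Longrightarrow> topological_chart (U, \<phi>)"
  by (simp add: charts_def)

lemma atlas_subset_charts: "atlas \<subseteq> charts"
  using atlas_charts atlas_compatible by (auto simp: charts_def)

lemma atlas_chart_at:
  obtains W \<eta> where "(W, \<eta>) \<in> atlas" "x \<in> W"
  using atlas_covers by fastforce

lemma chart_inverse: "(U, \<phi>) \<in> charts \<Longrightarrow> x \<in> U \<Longrightarrow> the_inv_into U \<phi> (\<phi> x) = x"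
  using chart_topological topological_chartD(3) the_inv_into_f_f by metis

text \<open>Inserts an intermediate chart into a composition. The factorisation holds only where
  \<open>h\<close> stays in \<open>W\<close>, and continuity of \<open>h\<close> makes that a
  neighbourhood.\<close>

lemma analytic_at_through_chart:
  assumes U: "(U, \<phi>) \<in> charts" "x \<in> U" and W: "(W, \<eta>) \<in> charts" "h x \<in> W"
    and cont: "continuous_on UNIV h"
    and h: "analytic_at (\<eta> \<circ> h \<circ> the_inv_into U \<phi>) (\<phi> x)"
    and g: "analytic_at (g \<circ> the_inv_into W \<eta>) (\<eta> (h x))"
  shows "analytic_at (g \<circ> h \<circ> the_inv_into U \<phi>) (\<phi> x)"
proof (rule analytic_at_cong)
  have tc: "topological_chart (U, \<phi>)"
    by (rule chart_topological[OF U(1)])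
  show "analytic_at (\<lambda>y. (g \<circ> the_inv_into W \<eta>) ((\<eta> \<circ> h \<circ> the_inv_into U \<phi>) y)) (\<phi> x)"
    using g by (intro analytic_at_compose[where f = "\<eta> \<circ> h \<circ> the_inv_into U \<phi>" and g = "g \<circ> the_inv_into W \<eta>", OF h])
      (simp add: chart_inverse[OF U])
  show "open (\<phi> ` (U \<inter> h -` W))"
    using topological_chartD(1)[OF tc] topological_chartD(1)[OF chart_topological[OF W(1)]] cont
    by (intro chart_open_image[OF tc] open_Int open_vimage) auto
  show "\<phi> x \<in> \<phi> ` (U \<inter> h -` W)"
    using U W by auto
  show "(g \<circ> the_inv_into W \<eta>) ((\<eta> \<circ> h \<circ> the_inv_into U \<phi>) y) = (g \<circ> h \<circ> the_inv_into U \<phi>) y"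
    if "y \<in> \<phi> ` (U \<inter> h -` W)" for y
    using that by (auto simp: chart_inverse[OF U(1)] chart_inverse[OF W(1)])
qed

text \<open>Members of the maximal atlas are compared by definition with charts of
  \<open>atlas\<close> only; two of them are related through an atlas chart around the
  point.\<close>

lemma chart_transition:
  assumes U: "(U, \<phi>) \<in> charts" "x \<in> U" and V: "(V, \<psi>) \<in> charts" "x \<in> V"
  shows "analytic_at (\<psi> \<circ> the_inv_into U \<phi>) (\<phi> x)"
proof -
  obtain W \<eta> where W: "(W, \<eta>) \<in> atlas" "x \<in> W"
    by (rule atlas_chart_at)
  then have "compatible (U, \<phi>) (W, \<eta>)" "compatible (V, \<psi>) (W, \<eta>)"
    using U(1) V(1) by (auto simp: charts_def)
  then have "analytic_at (\<eta> \<circ> the_inv_into U \<phi>) (\<phi> x)" "analytic_at (\<psi> \<circ> the_inv_into W \<eta>) (\<eta> x)"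
    using U(2) V(2) W(2) by (auto simp: compatible_def)
  then show ?thesis
    using analytic_at_through_chart[OF U, of W \<eta> "\<lambda>x. x" \<psi>] W atlas_subset_charts
    by (auto simp: o_def)
qed

lemma analytic_mapD:
  assumes "analytic_map f" "(U, \<phi>) \<in> charts" "x \<in> U" "(V, \<psi>) \<in> charts" "f x \<in> V"
  shows "analytic_at (\<psi> \<circ> f \<circ> the_inv_into U \<phi>) (\<phi> x)"
  using assms unfolding analytic_map_def by blast

lemma analytic_map_continuous: "analytic_map f \<Longrightarrow> continuous_on UNIV f"
  by (simp add: analytic_map_def)

lemma analytic_map_ident: "analytic_map (\<lambda>x. x)"
  unfolding analytic_map_def
proof safe
  fix U \<phi> V \<psi> x assume "(U, \<phi>) \<in> charts" "(V, \<psi>) \<in> charts" "x \<in> U" "x \<in> V"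
  then show "analytic_at (\<psi> \<circ> (\<lambda>x. x) \<circ> the_inv_into U \<phi>) (\<phi> x)"
    using chart_transition by (simp add: o_def)
qed (rule continuous_on_id)

lemma analytic_map_compose:
  assumes f: "analytic_map f" and g: "analytic_map g"
  shows "analytic_map (\<lambda>x. g (f x))"
  unfolding analytic_map_def
proof safe
  show "continuous_on UNIV (\<lambda>x. g (f x))"
    using continuous_on_compose2[OF analytic_map_continuous[OF g] analytic_map_continuous[OF f]] by simp
  fix U \<phi> V \<psi> x assume U: "(U, \<phi>) \<in> charts" and V: "(V, \<psi>) \<in> charts" and x: "x \<in> U" "g (f x) \<in> V"
  obtain W \<eta> where W': "(W, \<eta>) \<in> atlas" "f x \<in> W"
    by (rule atlas_chart_at)
  then have W: "(W, \<eta>) \<in> charts"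
    using atlas_subset_charts by blast
  have "analytic_at (\<psi> \<circ> g \<circ> f \<circ> the_inv_into U \<phi>) (\<phi> x)"
    using analytic_map_continuous[OF f] analytic_mapD[OF f U x(1) W W'(2)] analytic_mapD[OF g W W'(2) V x(2)]
    by (intro analytic_at_through_chart[where h = f and g = "\<psi> \<circ> g", OF U x(1) W W'(2)])
  then show "analytic_at (\<psi> \<circ> (\<lambda>x. g (f x)) \<circ> the_inv_into U \<phi>) (\<phi> x)"
    by (simp add: o_def)
qed

lemma analytic_map_funpow: "analytic_map f \<Longrightarrow> analytic_map (f ^^ n)"
proof (induction n)
  case (Suc n)
  then show ?case
    using analytic_map_compose[of "f ^^ n" f] by (simp add: o_def)
qed (simp add: id_def analytic_map_ident)

text \<open>Pulls a chart back along a diffeomorphism and changes coordinates by \<Theta>. It is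
  needed for the identity with a translation, to centre a chart at the fixed point, and for iterates
  of \<open>f\<close> with the straightening map.\<close>

lemma transported_chart:
  assumes U: "(U, \<phi>) \<in> charts" and g: "analytic_map g" "analytic_map g'"
    and g'g: "\<And>x. g' (g x) = x" and gg': "\<And>x. g (g' x) = x"
    and H: "open H" "H \<subseteq> U"
    and \<Theta>: "\<And>y. y \<in> \<phi> ` H \<Longrightarrow> analytic_at \<Theta> y" "\<And>y. y \<in> \<phi> ` H \<Longrightarrow> \<Theta>' (\<Theta> y) = y"
      "\<And>z. z \<in> \<Theta> ` \<phi> ` H \<Longrightarrow> analytic_at \<Theta>' z" "open (\<Theta> ` \<phi> ` H)"
  shows "(g -` H, \<lambda>x. \<Theta> (\<phi> (g x))) \<in> charts"
proof -
  define Q where "Q = g -` H"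
  define \<Psi> where "\<Psi> x = \<Theta> (\<phi> (g x))" for x
  define \<Psi>' where "\<Psi>' z = g' (the_inv_into U \<phi> (\<Theta>' z))" for z
  have tc: "topological_chart (U, \<phi>)"
    by (rule chart_topological[OF U])
  have inverse: "\<Psi>' (\<Psi> x) = x" if "x \<in> Q" for x
    using that H(2) by (simp add: \<Psi>'_def \<Psi>_def Q_def \<Theta>(2) chart_inverse[OF U] subset_iff g'g)
  have inj: "inj_on \<Psi> Q"
    using inverse by (rule inj_on_inverseI)
  have the_inv: "the_inv_into Q \<Psi> z = \<Psi>' z" if "z \<in> \<Psi> ` Q" for z
    using that inverse the_inv_into_f_f[OF inj] by auto
  have gQ: "g ` Q = H"
    unfolding Q_def using gg' by (intro surj_image_vimage_eq surjI[of g g'])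
  have "\<Psi> ` Q = \<Theta> ` \<phi> ` g ` Q"
    unfolding \<Psi>_def[abs_def] by (simp only: image_image)
  then have image: "\<Psi> ` Q = \<Theta> ` \<phi> ` H"
    by (simp only: gQ)
  have open_Q: "open Q"
    unfolding Q_def using H(1) analytic_map_continuous[OF g(1)] by (rule open_vimage)
  have open_image: "open (\<Psi> ` Q)"
    unfolding image by (rule \<Theta>(4))
  have "continuous_on (\<phi> ` H) \<Theta>"
    by (intro continuous_at_imp_continuous_on ballI analytic_at_imp_isCont \<Theta>(1))
  moreover have "continuous_on H \<phi>"
    using topological_chartD(4)[OF tc] H(2) continuous_on_subset by blast
  moreover have "continuous_on Q g"
    using analytic_map_continuous[OF g(1)] continuous_on_subset by blast
  ultimately have cont: "continuous_on Q \<Psi>"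
    unfolding \<Psi>_def[abs_def]
    by (intro continuous_on_compose2[where f = "\<lambda>x. \<phi> (g x)" and g = \<Theta>]
        continuous_on_compose2[where f = g and g = \<phi>]) (auto simp: Q_def)
  have "continuous_on (\<Psi> ` Q) \<Theta>'"
    unfolding image by (intro continuous_at_imp_continuous_on ballI analytic_at_imp_isCont \<Theta>(3))
  moreover have "\<Theta>' ` \<Psi> ` Q \<subseteq> \<phi> ` U"
    unfolding image using \<Theta>(2) H(2) by auto
  ultimately have "continuous_on (\<Psi> ` Q) \<Psi>'"
    unfolding \<Psi>'_def[abs_def] using topological_chartD(5)[OF tc] analytic_map_continuous[OF g(2)]
    by (intro continuous_on_compose2[where f = "\<lambda>z. the_inv_into U \<phi> (\<Theta>' z)" and g = g']
        continuous_on_compose2[where f = \<Theta>' and g = "the_inv_into U \<phi>"]) auto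
  then have cont': "continuous_on (\<Psi> ` Q) (the_inv_into Q \<Psi>)"
    by (rule continuous_on_eq) (simp add: the_inv)
  have "topological_chart (Q, \<Psi>)"
    unfolding topological_chart_def homeomorphism_def
    using open_Q open_image inj cont cont' the_inv_into_onto[OF inj]
    by (auto simp: the_inv_into_f_f f_the_inv_into_f)
  moreover have "compatible (Q, \<Psi>) (W, \<eta>)" if "(W, \<eta>) \<in> atlas" for W \<eta>
  proof -
    have W: "(W, \<eta>) \<in> charts"
      using that atlas_subset_charts by blast
    show ?thesis
      unfolding compatible_def
    proof (clarify, intro conjI)
      fix x assume x: "x \<in> Q" "x \<in> W"
      have gx: "g x \<in> H" "g x \<in> U"
        using x(1) H(2) by (auto simp: Q_def)
      have "analytic_at (\<lambda>z. (\<eta> \<circ> g' \<circ> the_inv_into U \<phi>) (\<Theta>' z)) (\<Psi> x)"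
      proof (rule analytic_at_compose[where f = \<Theta>'])
        show "analytic_at \<Theta>' (\<Psi> x)"
          unfolding \<Psi>_def using gx by (intro \<Theta>(3)) auto
        have "\<Theta>' (\<Psi> x) = \<phi> (g x)"
          using gx by (simp add: \<Psi>_def \<Theta>(2))
        then show "analytic_at (\<eta> \<circ> g' \<circ> the_inv_into U \<phi>) (\<Theta>' (\<Psi> x))"
          using analytic_mapD[OF g(2) U gx(2) W] x(2) by (simp add: g'g)
      qed
      then show "analytic_at (\<eta> \<circ> the_inv_into Q \<Psi>) (\<Psi> x)"
        by (rule analytic_at_cong[OF _ open_image]) (use x(1) the_inv in \<open>auto simp: \<Psi>'_def\<close>)
      have "analytic_at (\<lambda>z. \<Theta> ((\<phi> \<circ> g \<circ> the_inv_into W \<eta>) z)) (\<eta> x)"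
      proof (rule analytic_at_compose[where f = "\<phi> \<circ> g \<circ> the_inv_into W \<eta>"])
        show "analytic_at (\<phi> \<circ> g \<circ> the_inv_into W \<eta>) (\<eta> x)"
          by (rule analytic_mapD[OF g(1) W x(2) U gx(2)])
        show "analytic_at \<Theta> ((\<phi> \<circ> g \<circ> the_inv_into W \<eta>) (\<eta> x))"
          using gx(1) chart_inverse[OF W x(2)] by (auto intro: \<Theta>(1))
      qed
      then show "analytic_at (\<Psi> \<circ> the_inv_into W \<eta>) (\<eta> x)"
        by (simp add: \<Psi>_def o_def)
    qed
  qed
  ultimately have "(Q, \<Psi>) \<in> charts"
    by (auto simp: charts_def)
  then show ?thesis
    by (simp add: Q_def \<Psi>_def[abs_def])
qed

text \<open>Shifting time by \<open>k\<close> multiplies the normalised sequence by the constant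
  \<open>a ^ k\<close>, which does not affect convergence to 0.\<close>

lemma stable_set_funpow:
  assumes "0 < a"
  shows "(f ^^ k) x \<in> stable_set a f p \<longleftrightarrow> x \<in> stable_set a f p"
proof -
  have shift: "(f ^^ n) ((f ^^ k) x) = (f ^^ (n + k)) x" for n
    by (simp add: funpow_add)
  have lim: "(\<lambda>n. (f ^^ (n + k)) x) \<longlonglongrightarrow> p \<longleftrightarrow> (\<lambda>n. (f ^^ n) x) \<longlonglongrightarrow> p"
    by (rule iffI[OF LIMSEQ_offset[of "\<lambda>n. (f ^^ n) x"] LIMSEQ_ignore_initial_segment[of "\<lambda>n. (f ^^ n) x"]])
  have rate: "(\<lambda>n. u (n + k) / a ^ n) \<longlonglongrightarrow> 0 \<longleftrightarrow> (\<lambda>n. u n / a ^ n) \<longlonglongrightarrow> 0" for u :: "nat \<Rightarrow> real"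
  proof -
    have "(\<lambda>n. u (n + k) / a ^ n) \<longlonglongrightarrow> 0 \<longleftrightarrow> (\<lambda>n. a ^ k * (u (n + k) / a ^ (n + k))) \<longlonglongrightarrow> a ^ k * 0"
      using assms by (simp add: power_add)
    also have "\<dots> \<longleftrightarrow> (\<lambda>n. u (n + k) / a ^ (n + k)) \<longlonglongrightarrow> 0"
      using assms by (subst tendsto_mult_left_iff) auto
    also have "\<dots> \<longleftrightarrow> (\<lambda>n. u n / a ^ n) \<longlonglongrightarrow> 0"
      by (rule iffI[OF LIMSEQ_offset[of "\<lambda>n. u n / a ^ n"] LIMSEQ_ignore_initial_segment[of "\<lambda>n. u n / a ^ n"]])
    finally show ?thesis .
  qed
  show ?thesis
    unfolding stable_set_def mem_Collect_eq shift lim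
    by (intro conj_cong bex_cong refl prod.case_cong arg_cong[where f = Ex] ext
        rate[of "\<lambda>n. N (\<phi> ((f ^^ n) x))" for N \<phi>])
qed

text \<open>Frees the rate from the existentially quantified chart and norm: norms are equivalent,
  and the change of charts fixes 0 and is Lipschitz there. Conversely, the rate forces convergence
  to \<open>p\<close> because \<open>a \<le> 1\<close>; keeping the orbit in \<open>U\<close> makes
  the values of \<phi> meaningful.\<close>

lemma stable_set_in_chart:
  assumes U: "(U, \<phi>) \<in> charts" "p \<in> U" "\<phi> p = 0" and a: "0 < a" "a \<le> 1"
    and orbit: "\<And>n. (f ^^ n) x \<in> U"
  shows "x \<in> stable_set a f p \<longleftrightarrow> (\<lambda>n. unorm (\<phi> ((f ^^ n) x)) / a ^ n) \<longlonglongrightarrow> 0"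
proof
  assume "x \<in> stable_set a f p"
  then obtain V \<psi> N where lim: "(\<lambda>n. (f ^^ n) x) \<longlonglongrightarrow> p" and V: "(V, \<psi>) \<in> charts" "p \<in> V" "\<psi> p = 0"
    and top: "topology_norm N" and rate: "(\<lambda>n. N (\<psi> ((f ^^ n) x)) / a ^ n) \<longlonglongrightarrow> 0"
    unfolding stable_set_def by blast
  have N: "ultra_norm N"
    using top by (rule topology_norm_imp_ultra_norm)
  obtain C where "C > 0" and C: "\<And>y. unorm y \<le> C * N y"
    using ultra_norms_equivalent[OF N ultra_norm_unorm] by blast
  define h where "h = \<phi> \<circ> the_inv_into V \<psi>"
  have "analytic_at h 0"
    unfolding h_def using chart_transition[OF V(1,2) U(1,2)] V(3) by simp
  then obtain d K where "d > 0" "K > 0" and K: "\<And>y. unorm y < d \<Longrightarrow> unorm (h (0 + y) - h 0) \<le> K * unorm y"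
    by (rule analytic_at_Lipschitz) blast
  have h0: "h 0 = 0"
    using chart_inverse[OF V(1,2)] V(3) U(3) by (simp add: h_def)
  have "(\<lambda>n. N (\<psi> ((f ^^ n) x))) \<longlonglongrightarrow> 0"
    using rate a ultra_norm_nonneg[OF N] by (rule rate_imp_tendsto_0)
  then have "\<forall>\<^sub>F n in sequentially. N (\<psi> ((f ^^ n) x)) < d / C"
    using \<open>d > 0\<close> \<open>C > 0\<close> by (intro order_tendstoD(2)) auto
  moreover have "\<forall>\<^sub>F n in sequentially. (f ^^ n) x \<in> V"
    using lim topological_chartD(1)[OF chart_topological[OF V(1)]] V(2) by (rule topological_tendstoD)
  ultimately have "\<forall>\<^sub>F n in sequentially. 0 \<le> unorm (\<phi> ((f ^^ n) x)) \<and>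
      unorm (\<phi> ((f ^^ n) x)) \<le> (K * C) * N (\<psi> ((f ^^ n) x))"
  proof eventually_elim
    fix n assume n: "N (\<psi> ((f ^^ n) x)) < d / C" "(f ^^ n) x \<in> V"
    have "C * N (\<psi> ((f ^^ n) x)) < d"
      using n(1) \<open>C > 0\<close> by (simp add: field_simps)
    then have "unorm (h (\<psi> ((f ^^ n) x))) \<le> K * unorm (\<psi> ((f ^^ n) x))"
      using K[of "\<psi> ((f ^^ n) x)"] C[of "\<psi> ((f ^^ n) x)"] h0 by simp
    also have "\<dots> \<le> K * (C * N (\<psi> ((f ^^ n) x)))"
      using \<open>K > 0\<close> by (intro mult_left_mono C) auto
    also have "h (\<psi> ((f ^^ n) x)) = \<phi> ((f ^^ n) x)"
      using chart_inverse[OF V(1) n(2)] by (simp add: h_def)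
    finally show "0 \<le> unorm (\<phi> ((f ^^ n) x)) \<and> unorm (\<phi> ((f ^^ n) x)) \<le> (K * C) * N (\<psi> ((f ^^ n) x))"
      by simp
  qed
  with rate a(1) show "(\<lambda>n. unorm (\<phi> ((f ^^ n) x)) / a ^ n) \<longlonglongrightarrow> 0"
    by (rule rate_transfer)
next
  assume rate: "(\<lambda>n. unorm (\<phi> ((f ^^ n) x)) / a ^ n) \<longlonglongrightarrow> 0"
  then have "(\<lambda>n. unorm (\<phi> ((f ^^ n) x))) \<longlonglongrightarrow> 0"
    using a by (rule rate_imp_tendsto_0) simp
  then have "(\<lambda>n. \<phi> ((f ^^ n) x)) \<longlonglongrightarrow> 0"
    by (simp add: tendsto_iff dist_unorm)
  moreover have tc: "topological_chart (U, \<phi>)"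
    by (rule chart_topological[OF U(1)])
  have "0 \<in> \<phi> ` U"
    using U by force
  ultimately have "(\<lambda>n. the_inv_into U \<phi> (\<phi> ((f ^^ n) x))) \<longlonglongrightarrow> the_inv_into U \<phi> 0"
    using orbit by (intro continuous_on_tendsto_compose[OF topological_chartD(5)[OF tc]]) auto
  then have "(\<lambda>n. (f ^^ n) x) \<longlonglongrightarrow> p"
    using chart_inverse[OF U(1) orbit] chart_inverse[OF U(1,2)] U(3) by simp
  then show "x \<in> stable_set a f p"
    unfolding stable_set_def using U rate topology_norm_unorm by (auto intro!: bexI[of _ "(U, \<phi>)"])
qed

lemma stable_set_submanifold:
  assumes v: "absolute_value_extension v" and f: "analytic_diffeomorphism f" and p: "f p = p"
    and U: "(U, \<phi>) \<in> charts" "p \<in> U"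
    and eig: "eigenvalue_moduli v (tangent_map (U, \<phi>) f p) \<subseteq> {..1}"
    and a: "a \<le> 1" and hyp: "hyperbolic a (tangent_map (U, \<phi>) f p)"
  shows "submanifold (stable_set a f p)"
proof -
  define \<alpha> where "\<alpha> = tangent_map (U, \<phi>) f p"
  have a0: "0 < a"
    using hyp by (simp add: hyperbolic_def)
  have bij: "bij f" and anf: "analytic_map f" and ani: "analytic_map (inv_into UNIV f)"
    using f by (auto simp: analytic_diffeomorphism_def)
  have openU: "open U"
    using topological_chartD(1)[OF chart_topological[OF U(1)]] .
  have openfU: "open (f -` U)"
    using openU analytic_map_continuous[OF anf] by (rule open_vimage)
  define \<phi>' where "\<phi>' x = \<phi> x + - \<phi> p" for x
  have U0: "(U, \<phi>') \<in> charts"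
  proof -
    have img: "(\<lambda>y. y + - \<phi> p) ` \<phi> ` U = (\<lambda>y. y + \<phi> p) -` (\<phi> ` U)"
    proof (intro equalityI subsetI)
      fix y assume "y \<in> (\<lambda>y. y + \<phi> p) -` (\<phi> ` U)"
      then have "(y + \<phi> p) + - \<phi> p \<in> (\<lambda>y. y + - \<phi> p) ` \<phi> ` U"
        by (intro imageI) simp
      then show "y \<in> (\<lambda>y. y + - \<phi> p) ` \<phi> ` U"
        by simp
    qed auto
    have "continuous_on UNIV (\<lambda>y. y + \<phi> p)"
      using analytic_at_imp_isCont[OF analytic_at_translate] by (simp add: continuous_on_eq_continuous_at)
    then have "open ((\<lambda>y. y + - \<phi> p) ` \<phi> ` U)"
      unfolding img using topological_chartD(2)[OF chart_topological[OF U(1)]] by (intro open_vimage)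
    then have "((\<lambda>x. x) -` U, \<lambda>x. \<phi> x + - \<phi> p) \<in> charts"
      by (intro transported_chart[OF U(1) analytic_map_ident analytic_map_ident _ _ openU,
            where \<Theta>' = "\<lambda>y. y + \<phi> p"] analytic_at_translate) auto
    then show ?thesis
      by (simp add: \<phi>'_def[abs_def])
  qed
  have tc0: "topological_chart (U, \<phi>')"
    by (rule chart_topological[OF U0])
  have \<phi>0p: "\<phi>' p = 0"
    by (simp add: \<phi>'_def)
  define F where "F = \<phi>' \<circ> f \<circ> the_inv_into U \<phi>'"
  have F_analytic: "analytic_at F 0"
    unfolding F_def using analytic_mapD[OF anf U0 U(2) U0] U(2) p \<phi>0p by simp
  have F0: "F 0 = 0"
    using chart_inverse[OF U0 U(2)] p \<phi>0p by (simp add: F_def)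
  \<comment> \<open>The tangent map is formed in the original chart, whereas \<open>F\<close> lives
    in the centred one; a translation does not change the derivative.\<close>
  have F_deriv: "has_frechet_derivative F \<alpha> 0"
  proof -
    define F1 where "F1 = \<phi> \<circ> f \<circ> the_inv_into U \<phi>"
    have "analytic_at F1 (\<phi> p)"
      unfolding F1_def using analytic_mapD[OF anf U U(1)] U(2) p by simp
    then obtain D where D: "has_frechet_derivative F1 D (\<phi> p)"
      by (rule analytic_at_expansion) blast
    then have "\<alpha> = D"
      unfolding \<alpha>_def tangent_map_def F1_def using frechet_derivative_at_eqI by simp
    \<comment> \<open>Both sides are descriptions by equivalent predicates, so the equality holds
      for every \<open>h\<close>, also outside the image of the chart.\<close>
    have "the_inv_into U \<phi>' h = the_inv_into U \<phi> (\<phi> p + h)" for h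
      unfolding the_inv_into_def \<phi>'_def
      by (rule arg_cong[where f = The]) (auto simp: algebra_simps)
    then have "F h = F1 (\<phi> p + h) - \<phi> p" for h
      by (simp add: F_def F1_def \<phi>'_def)
    then have "F (0 + h) - F 0 - D h = F1 (\<phi> p + h) - F1 (\<phi> p) - D h" for h
      by simp
    then show ?thesis
      using D unfolding \<open>\<alpha> = D\<close> has_frechet_derivative_def by simp
  qed
  \<comment> \<open>Confining \<Omega> to the image of points that \<open>f\<close> keeps in
    \<open>U\<close> ensures that \<open>F\<close> really represents \<open>f\<close> there.\<close>
  have V: "open (\<phi>' ` (U \<inter> f -` U))" "0 \<in> \<phi>' ` (U \<inter> f -` U)"
    using openU openfU U(2) p \<phi>0p by (auto intro!: chart_open_image[OF tc0] image_eqI[of 0 \<phi>' p])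
  obtain E \<Omega> \<Theta> \<Theta>' where E: "subspace E" and \<Omega>: "open \<Omega>" "0 \<in> \<Omega>" "\<Omega> \<subseteq> \<phi>' ` (U \<inter> f -` U)" "F ` \<Omega> \<subseteq> \<Omega>"
    and \<Theta>: "open (\<Theta> ` \<Omega>)" "\<And>x. x \<in> \<Omega> \<Longrightarrow> \<Theta>' (\<Theta> x) = x"
      "\<And>x. x \<in> \<Omega> \<Longrightarrow> analytic_at \<Theta> x" "\<And>y. y \<in> \<Theta> ` \<Omega> \<Longrightarrow> analytic_at \<Theta>' y"
    and char: "\<And>x. x \<in> \<Omega> \<Longrightarrow> \<Theta> x \<in> E \<longleftrightarrow> (\<lambda>n. unorm ((F ^^ n) x) / a ^ n) \<longlonglongrightarrow> 0"
    by (rule local_stable_manifold[OF hyp[folded \<alpha>_def] a v eig[folded \<alpha>_def] F_analytic F0 F_deriv V])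
       (assumption | rule that)+
  define H where "H = U \<inter> \<phi>' -` \<Omega>"
  have H: "open H" "H \<subseteq> U"
    unfolding H_def using chart_open_preimage[OF tc0 \<Omega>(1)] by auto
  have "\<phi>' ` H = \<Omega>"
    using \<Omega>(3) by (auto simp: H_def)
  have pH: "p \<in> H"
    using U(2) \<phi>0p \<Omega>(2) by (simp add: H_def)
  have step: "f x \<in> H" "\<phi>' (f x) = F (\<phi>' x)" if "x \<in> H" for x
  proof -
    have x: "x \<in> U" "\<phi>' x \<in> \<Omega>"
      using that by (auto simp: H_def)
    \<comment> \<open>Injectivity of the chart identifies \<open>x\<close> with a point
      \<open>y\<close> that is known to be mapped into \<open>U\<close>.\<close>
    then obtain y where "y \<in> U" "f y \<in> U" "\<phi>' x = \<phi>' y"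
      using \<Omega>(3) by blast
    then have "f x \<in> U"
      using x(1) topological_chartD(3)[OF tc0] by (metis inj_onD)
    moreover show "\<phi>' (f x) = F (\<phi>' x)"
      using chart_inverse[OF U0 x(1)] by (simp add: F_def)
    moreover have "F (\<phi>' x) \<in> \<Omega>"
      using \<Omega>(4) x(2) by blast
    ultimately show "f x \<in> H"
      by (simp add: H_def)
  qed
  have iter: "(f ^^ n) x \<in> H \<and> \<phi>' ((f ^^ n) x) = (F ^^ n) (\<phi>' x)" if "x \<in> H" for n x
    using that by (induction n) (auto simp: step)
  have stable: "x \<in> stable_set a f p \<longleftrightarrow> \<Theta> (\<phi>' x) \<in> E" if "x \<in> H" for x
  proof -
    have "x \<in> stable_set a f p \<longleftrightarrow> (\<lambda>n. unorm (\<phi>' ((f ^^ n) x)) / a ^ n) \<longlonglongrightarrow> 0"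
      using iter[OF that] H(2) by (intro stable_set_in_chart[OF U0 U(2) \<phi>0p a0 a]) auto
    also have "\<dots> \<longleftrightarrow> \<Theta> (\<phi>' x) \<in> E"
      using char[of "\<phi>' x"] that iter[OF that] by (simp add: H_def)
    finally show ?thesis .
  qed
  show ?thesis
    unfolding submanifold_def
  \<comment> \<open>The local straightening at \<open>p\<close> supplies one subspace
    \<open>E\<close>, which serves at every point of the stable set.\<close>
  proof (intro exI[of _ E] conjI E ballI)
    fix x assume x: "x \<in> stable_set a f p"
    then have "(\<lambda>n. (f ^^ n) x) \<longlonglongrightarrow> p"
      by (simp add: stable_set_def)
    then have "\<forall>\<^sub>F n in sequentially. (f ^^ n) x \<in> H"
      using H(1) pH by (rule topological_tendstoD)
    from eventually_happens'[OF sequentially_bot this] obtain n where n: "(f ^^ n) x \<in> H"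
      by blast
    define g where "g = f ^^ n"
    define g' where "g' = inv_into UNIV f ^^ n"
    have bijn: "bij g"
      unfolding g_def using bij by (rule bij_fn)
    have g'_inv: "g' = inv_into UNIV g"
      unfolding g_def g'_def using inv_fn[OF bij] by simp
    \<comment> \<open>A chart around \<open>x\<close> arises by pulling back the straightened
      neighbourhood of \<open>p\<close> along the iterate that carries \<open>x\<close> into
      it.\<close>
    have chart: "(g -` H, \<lambda>y. \<Theta> (\<phi>' (g y))) \<in> charts"
    proof (rule transported_chart[OF U0 _ _ _ _ H, where g' = g' and \<Theta>' = \<Theta>'])
      show "analytic_map g" "analytic_map g'"
        unfolding g_def g'_def using anf ani by (auto intro: analytic_map_funpow)
      show "g' (g y) = y" "g (g' y) = y" for y
        unfolding g'_inv using bijn by (auto simp: bij_is_inj bij_is_surj surj_f_inv_f)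
    qed (use \<Theta> \<open>\<phi>' ` H = \<Omega>\<close> in auto)
    \<comment> \<open>Invariance of the stable set under iterates identifies all its points in the
      pulled-back domain, not just those on the orbit of \<open>x\<close>.\<close>
    have mem: "y \<in> stable_set a f p \<longleftrightarrow> \<Theta> (\<phi>' (g y)) \<in> E" if "y \<in> g -` H" for y
      using stable[of "g y"] that stable_set_funpow[OF a0, where f = f and k = n and x = y and p = p]
      by (simp add: g_def)
    have "(\<lambda>y. \<Theta> (\<phi>' (g y))) ` (stable_set a f p \<inter> g -` H) = E \<inter> (\<lambda>y. \<Theta> (\<phi>' (g y))) ` (g -` H)"
      using mem by blast
    moreover have "x \<in> g -` H"
      using n by (simp add: g_def)
    ultimately show "\<exists>(U, \<phi>)\<in>charts. x \<in> U \<and> \<phi> ` (stable_set a f p \<inter> U) = E \<inter> \<phi> ` U"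
      using chart by blast
  qed
qed

end

theorem theoremC:
  fixes scale :: "'k::complete_ultrametric_field \<Rightarrow> 'e::ultrametric_group \<Rightarrow> 'e"
    and Basis :: "'e set"
    and atlas :: "('m::topological_space set \<times> ('m \<Rightarrow> 'e)) set"
    and absv :: "'k alg_closure \<Rightarrow> real"
    and f :: "'m \<Rightarrow> 'm" and p :: 'm
    and U :: "'m set" and \<phi> :: "'m \<Rightarrow> 'e"
    and \<alpha> :: "'e \<Rightarrow> 'e"
  assumes "analytic_manifold scale Basis atlas"
    and "absolute_value_extension absv"
    and "analytic_manifold.analytic_diffeomorphism scale Basis atlas f"
    and "f p = p"
    and "(U, \<phi>) \<in> analytic_manifold.charts scale Basis atlas" and "p \<in> U"
    and "\<alpha> = analytic_manifold.tangent_map scale (U, \<phi>) f p"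
    and "ultrametric_space.eigenvalue_moduli scale Basis absv \<alpha> \<subseteq> {0<..1}"
  shows "\<forall>a\<in>{0<..1}. ultrametric_space.hyperbolic scale a \<alpha> \<longrightarrow>
    analytic_manifold.submanifold scale Basis atlas
      (analytic_manifold.stable_set scale Basis atlas a f p)"
proof -
  interpret analytic_manifold scale Basis atlas
    by fact
  have "eigenvalue_moduli absv (tangent_map (U, \<phi>) f p) \<subseteq> {..1}"
    using assms(7,8) by auto
  then show ?thesis
    using stable_set_submanifold[OF assms(2,3,4,5,6)] assms(7) by auto
qed

end
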